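(* Let $R'=\mathbb{Z}[t^{\pm1},q,p^{\pm1},s^{\pm1}]/\bigl(q(p-t)=0,\ q^2=(1-t)(1-p)\bigr)$. For a diagram $K$ of an (oriented) virtual knot, let $n'(K)=\det N''(K)\in R'$, where $N''(K)$ is the matrix defined in the context. If two diagrams $K$ and $K'$ of virtual knots are equivalent, then $$n'(K)=\pm\, n'(K')\cdot t^{\alpha}p^{\beta}q^{\gamma}$$ for some integers $\alpha,\beta,\gamma$.
   Context: Virtual knots. A virtual knot diagram is a planar 4-valent graph (image of one immersed closed oriented curve) in which each vertex is either a classical crossing (with over/under structure) or is marked as a virtual crossing. Virtual knots are equivalence classes of such diagrams modulo generalized Reidemeister moves: the classical Reidemeister moves (involving classical crossings only) and the detour move, in which a branch containing several consecutive virtual crossings and no classical crossings is replaced by any other branch with the same endpoints, all new intersections and self-intersections being marked as virtual crossings. Two diagrams are equivalent if they represent the same virtual knot. Gaussian parity. The chord diagram of $K$ is the circle parametrizing $K$, with one chord for each classical crossing joining its two preimages. A classical crossing is even if its chord intersects an even number of other chords, and odd otherwise. Parity hierarchy. Let $f(K)$ be the diagram obtained from $K$ by turning all odd classical crossings into virtual crossings. A classical crossing of $K$ has type $0$ if it is odd in $K$; it has type $1$ if it is even in $K$ and odd as a crossing of $f(K)$; it has type $2$ if it is even in $K$ and even as a crossing of $f(K)$. Arcs and labels. Let $n$ be the number of crossings of $K$ of types $1$ and $2$, numbered $1,\dots,n$ arbitrarily. Cut the curve at the underpasses of these $n$ crossings; this gives $n$ arcs, and arc $k$ is the one originating (with respect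 to the orientation) at the underpass of crossing $k$. Each arc is further subdivided into short arcs at its passages (over or under) through crossings of type $0$. Each short arc carries a label $s^m$, $m\in\mathbb{Z}$: the first short arc of each arc, starting at crossing $k$, has label $s^0=1$; crossings of type $0$ are treated as virtual, except that when passing along the orientation through a crossing of type $0$ the label is multiplied by $s$ if the strand crosses the other strand of that crossing from its left to its right, and by $s^{-1}$ if it crosses it from its right to its left. Original virtual crossings do not change the label. The matrix $N''(K)$. It is the $n\times n$ matrix over $R'$ with rows indexed by the crossings of types $1$ and $2$ and columns indexed by the arcs. At each such crossing three branches are incident: the overpass and the two under-branches, on the left and on the right of the oriented overpass. The local labels are: at a crossing of type $2$, $1-t$ for the overpass, $t$ for the right under-branch, $-1$ for the left under-branch; at a crossing of type $1$, $q$ for the overpass, $p$ for the right under-branch, $-1$ for the left under-branch. The entry $N''_{ij}$ is the sum, over all incidences of short arcs of arc $j$ with crossing $i$, of the local label of the incidence times the label $s^m$ of the short arc; it is $0$ if arc $j$ is not incident to crossing $i$.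
   Formalization: If K has no crossings of types 1 and 2 (n = 0), n'(K) is taken to be 0 instead of the empty determinant 1; with the value 1 the claim fails, since the crossingless unknot is equivalent to a one-kink diagram whose 1×1 matrix is (0). *)

theory Defs
  imports
    "HOL-Library.Poly_Mapping"
    "HOL-Library.Product_Plus"
    "HOL-Combinatorics.Orbits"
    "Jordan_Normal_Form.Determinant"
begin

section \<open>The coefficient ring\<close>

text \<open>
  \<open>\<int>[t\<^sup>\<plusminus>\<^sup>1, q, p\<^sup>\<plusminus>\<^sup>1, s\<^sup>\<plusminus>\<^sup>1]\<close> is the monoid ring over \<open>\<int>\<close> of
  \<open>\<int> \<times> \<nat> \<times> \<int> \<times> \<int>\<close>, the monoid of exponents of \<open>t\<close>, \<open>q\<close>, \<open>p\<close>, \<open>s\<close> (in this order).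
\<close>

type_synonym laurent = "(int \<times> nat \<times> int \<times> int) \<Rightarrow>\<^sub>0 int"

definition laurent_t :: laurent where "laurent_t = Poly_Mapping.single (1, 0, 0, 0) 1"
definition laurent_q :: laurent where "laurent_q = Poly_Mapping.single (0, 1, 0, 0) 1"
definition laurent_p :: laurent where "laurent_p = Poly_Mapping.single (0, 0, 1, 0) 1"
definition laurent_s_pow :: "int \<Rightarrow> laurent"
  where "laurent_s_pow m = Poly_Mapping.single (0, 0, 0, m) 1"

definition relator1 :: laurent where
  "relator1 = laurent_q * (laurent_p - laurent_t)"

definition relator2 :: laurent where
  "relator2 = laurent_q ^ 2 - (1 - laurent_t) * (1 - laurent_p)"

definition knot_rel :: "laurent \<Rightarrow> laurent \<Rightarrow> bool" where
  "knot_rel f g \<longleftrightarrow> (\<exists>x y. f - g = x * relator1 + y * relator2)"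

lemma equivp_knot_rel: "equivp knot_rel"
proof (rule equivpI)
  show "reflp knot_rel"
    unfolding reflp_def knot_rel_def by (intro allI exI[of _ 0]) simp
  show "symp knot_rel"
    unfolding symp_def knot_rel_def
  proof (intro allI impI, elim exE)
    fix f g x y assume "f - g = x * relator1 + y * relator2"
    then have "g - f = (- x) * relator1 + (- y) * relator2"
      by (simp add: algebra_simps)
    then show "\<exists>x y. g - f = x * relator1 + y * relator2" by blast
  qed
  show "transp knot_rel"
    unfolding transp_def knot_rel_def
  proof (intro allI impI, elim exE)
    fix f g h x y x' y'
    assume "f - g = x * relator1 + y * relator2" "g - h = x' * relator1 + y' * relator2"
    then have "(f - g) + (g - h) = (x + x') * relator1 + (y + y') * relator2"
      by (simp add: algebra_simps)
    then show "\<exists>x y. f - h = x * relator1 + y * relator2" by auto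
  qed
qed

lemma knot_rel_add:
  assumes "knot_rel a b" "knot_rel c d"
  shows "knot_rel (a + c) (b + d)"
proof -
  from assms obtain x y x' y'
    where "a - b = x * relator1 + y * relator2" "c - d = x' * relator1 + y' * relator2"
    unfolding knot_rel_def by blast
  then have "(a - b) + (c - d) = (x + x') * relator1 + (y + y') * relator2"
    by (simp add: algebra_simps)
  then have "(a + c) - (b + d) = (x + x') * relator1 + (y + y') * relator2"
    by (simp add: algebra_simps)
  then show ?thesis unfolding knot_rel_def by blast
qed

lemma knot_rel_mult_left:
  assumes "knot_rel a b"
  shows "knot_rel (c * a) (c * b)"
proof -
  from assms obtain x y where "a - b = x * relator1 + y * relator2"
    unfolding knot_rel_def by blast
  then have "c * (a - b) = (c * x) * relator1 + (c * y) * relator2"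
    by (simp add: algebra_simps)
  then show ?thesis unfolding knot_rel_def by (metis right_diff_distrib)
qed

lemma knot_rel_mult:
  assumes "knot_rel a b" "knot_rel c d"
  shows "knot_rel (a * c) (b * d)"
proof -
  have "knot_rel (a * c) (a * d)" by (rule knot_rel_mult_left[OF assms(2)])
  moreover have "knot_rel (a * d) (b * d)"
    using knot_rel_mult_left[OF assms(1), of d] by (simp add: mult.commute)
  ultimately show ?thesis using equivp_knot_rel by (meson equivp_transp)
qed

lemma knot_rel_uminus: "knot_rel a b \<Longrightarrow> knot_rel (- a) (- b)"
  using knot_rel_mult_left[of a b "- 1"] by simp

lemma knot_rel_diff: "knot_rel a b \<Longrightarrow> knot_rel c d \<Longrightarrow> knot_rel (a - c) (b - d)"
  using knot_rel_add[OF _ knot_rel_uminus, of a b c d] by simp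

text \<open>The evaluation \<open>t = p = s = 1\<close>, \<open>q = 0\<close> kills both relators, so the quotient is nontrivial.\<close>

definition laurent_eval :: "laurent \<Rightarrow> int" where
  "laurent_eval f =
     (\<Sum>k\<in>Poly_Mapping.keys f. Poly_Mapping.lookup f k when fst (snd k) = 0)"

lemma laurent_eval_superset:
  assumes "finite A" "Poly_Mapping.keys f \<subseteq> A"
  shows "laurent_eval f = (\<Sum>k\<in>A. Poly_Mapping.lookup f k when fst (snd k) = 0)"
  unfolding laurent_eval_def
  by (rule sum.mono_neutral_left[OF assms]) (auto simp: in_keys_iff when_def)

lemma laurent_eval_add: "laurent_eval (f + g) = laurent_eval f + laurent_eval g"
proof -
  let ?A = "Poly_Mapping.keys f \<union> Poly_Mapping.keys g"
  have "finite ?A" by simp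
  moreover have "Poly_Mapping.keys (f + g) \<subseteq> ?A" by (rule keys_add)
  ultimately show ?thesis
    by (simp add: laurent_eval_superset[of ?A] lookup_add when_add_distrib sum.distrib)
qed

lemma laurent_eval_single:
  "laurent_eval (Poly_Mapping.single k v) = (v when fst (snd k) = 0)"
  by (subst laurent_eval_superset[of "{k}"]) auto

lemma laurent_update_eq:
  fixes f :: laurent
  assumes "k \<notin> Poly_Mapping.keys f"
  shows "Poly_Mapping.update k v f = f + Poly_Mapping.single k v"
  using assms
  by (intro poly_mapping_eqI) (auto simp: lookup_update lookup_add lookup_single in_keys_iff when_def)

lemma laurent_eval_mult_single:
  "laurent_eval (f * Poly_Mapping.single k v) = laurent_eval f * laurent_eval (Poly_Mapping.single k v)"
proof (induction f rule: update_induct)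
  case const
  then show ?case by (simp add: laurent_eval_def)
next
  case (update f a b)
  then show ?case
    by (simp add: laurent_update_eq laurent_eval_add distrib_right mult_single laurent_eval_single
        when_def)
qed

lemma laurent_eval_mult: "laurent_eval (f * g) = laurent_eval f * laurent_eval g"
proof (induction g rule: update_induct)
  case const
  then show ?case by (simp add: laurent_eval_def)
next
  case (update g a b)
  then show ?case
    by (simp add: laurent_update_eq laurent_eval_add distrib_left laurent_eval_mult_single)
qed

lemma laurent_eval_uminus: "laurent_eval (- f) = - laurent_eval f"
  using laurent_eval_add[of f "- f"] by (simp add: laurent_eval_def)

lemma laurent_eval_one: "laurent_eval 1 = 1"
  unfolding single_one[symmetric] laurent_eval_single by simp

lemma not_knot_rel_0_1: "\<not> knot_rel 0 1"
proof
  assume "knot_rel 0 1"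
  then obtain x y where *: "0 - 1 = x * relator1 + y * relator2"
    unfolding knot_rel_def by blast
  have "laurent_eval relator1 = 0" "laurent_eval relator2 = 0"
    unfolding relator1_def relator2_def laurent_t_def laurent_q_def laurent_p_def power2_eq_square
    by (simp_all only: diff_conv_add_uminus laurent_eval_add laurent_eval_mult laurent_eval_uminus
        laurent_eval_one laurent_eval_single) simp_all
  then have "laurent_eval (0 - 1) = 0"
    unfolding * by (simp add: laurent_eval_add laurent_eval_mult)
  then show False by (simp add: laurent_eval_uminus laurent_eval_one)
qed

quotient_type knot_ring = laurent / knot_rel
  by (rule equivp_knot_rel)

instantiation knot_ring :: comm_ring_1
begin

lift_definition zero_knot_ring :: knot_ring is 0 .
lift_definition one_knot_ring :: knot_ring is 1 .
lift_definition plus_knot_ring :: "knot_ring \<Rightarrow> knot_ring \<Rightarrow> knot_ring" is "(+)"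
  by (rule knot_rel_add)
lift_definition uminus_knot_ring :: "knot_ring \<Rightarrow> knot_ring" is uminus
  by (rule knot_rel_uminus)
lift_definition minus_knot_ring :: "knot_ring \<Rightarrow> knot_ring \<Rightarrow> knot_ring" is "(-)"
  by (rule knot_rel_diff)
lift_definition times_knot_ring :: "knot_ring \<Rightarrow> knot_ring \<Rightarrow> knot_ring" is "(*)"
  by (rule knot_rel_mult)

instance
proof
  fix a b c :: knot_ring
  note refl = equivp_reflp[OF equivp_knot_rel]
  show "a * b * c = a * (b * c)" by transfer (simp add: mult.assoc refl)
  show "a * b = b * a" by transfer (simp add: mult.commute refl)
  show "1 * a = a" by transfer (simp add: refl)
  show "a + b + c = a + (b + c)" by transfer (simp add: add.assoc refl)
  show "a + b = b + a" by transfer (simp add: add.commute refl)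
  show "0 + a = a" by transfer (simp add: refl)
  show "- a + a = 0" by transfer (simp add: refl)
  show "a - b = a + - b" by transfer (simp add: refl)
  show "(a + b) * c = a * c + b * c" by transfer (simp add: distrib_right refl)
  show "(0 :: knot_ring) \<noteq> 1" by transfer (rule not_knot_rel_0_1)
qed

end

lift_definition ring_t :: knot_ring is laurent_t .
lift_definition ring_q :: knot_ring is laurent_q .
lift_definition ring_p :: knot_ring is laurent_p .
lift_definition ring_s_pow :: "int \<Rightarrow> knot_ring" is laurent_s_pow .

text \<open>
  \<open>is_int_power x k y\<close> says that \<open>y\<close> is the \<open>k\<close>-th power of \<open>x\<close>; for \<open>k < 0\<close> such a \<open>y\<close> exists
  only if \<open>x\<close> is a unit. In \<^typ>\<open>knot_ring\<close> the elements \<open>t\<close> and \<open>p\<close> are units and \<open>q\<close> is not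
  (it is mapped to \<open>0\<close> by the evaluation above), so \<open>q\<^sup>\<gamma>\<close> is available for \<open>\<gamma> \<ge> 0\<close> only.
\<close>

definition is_int_power :: "'a::comm_ring_1 \<Rightarrow> int \<Rightarrow> 'a \<Rightarrow> bool" where
  "is_int_power x k y \<longleftrightarrow> (if 0 \<le> k then y = x ^ nat k else y * x ^ nat (- k) = 1)"


section \<open>Virtual knot diagrams\<close>

text \<open>
  A diagram is recorded by traversing the curve once from a base point and listing the passages
  through all crossings, classical and virtual. A passage records the (name of the) crossing,
  whether the strand is the overpass, the underpass or runs through a virtual crossing, and
  whether the strand crosses the other strand of that crossing from its left to its right.
  The third component encodes the cyclic order of the four half-edges at the crossing, so the list
  determines the 4-valent graph together with its embedding in an oriented surface; the
  diagram is planar iff this surface is the sphere. No face is singled out as the unbounded one;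
  changing it relates only diagrams with the same crossings, types, labels and matrix.
\<close>

datatype level = Over | Under | Virtual

datatype passage = Passage (crossing: nat) (level: level) (left_to_right: bool)

type_synonym diagram = "passage list"

abbreviation crossings :: "diagram \<Rightarrow> nat set" where
  "crossings K \<equiv> crossing ` set K"

definition well_formed :: "diagram \<Rightarrow> bool" where
  "well_formed K \<longleftrightarrow>
     (\<forall>c\<in>crossings K. \<exists>x y. filter (\<lambda>z. crossing z = c) K = [x, y] \<and>
        left_to_right x \<noteq> left_to_right y \<and>
        (level x, level y) \<in> {(Over, Under), (Under, Over), (Virtual, Virtual)})"

definition partner :: "diagram \<Rightarrow> nat \<Rightarrow> nat" where
  "partner K i = (THE j. j < length K \<and> j \<noteq> i \<and> crossing (K ! j) = crossing (K ! i))"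

text \<open>
  Edge \<open>e\<close> of the graph leads from passage \<open>e\<close> to passage \<open>e + 1\<close> (cyclically). The dart
  \<open>(e, True)\<close> is edge \<open>e\<close> traversed along the orientation of the curve, \<open>(e, False)\<close> is edge \<open>e\<close>
  traversed backwards. \<open>face_step\<close> follows a dart to its end and turns left there, so its orbits
  are the boundaries of the faces, each with the face on its left.
\<close>

definition face_step :: "diagram \<Rightarrow> nat \<times> bool \<Rightarrow> nat \<times> bool" where
  "face_step K d =
     (let e = fst d; forward = snd d;
          i = (if forward then (e + 1) mod length K else e);
          j = partner K i
      in if left_to_right (K ! i) = forward
         then (j, True)
         else ((j + length K - 1) mod length K, False))"

definition faces :: "diagram \<Rightarrow> (nat \<times> bool) set set" where
  "faces K = orbit (face_step K) ` ({..<length K} \<times> UNIV)"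

text \<open>
  Planarity is Euler's formula: vertices plus faces equals edges plus two. The graph is connected,
  being the image of one closed curve. The empty list is the circle without crossings.
\<close>

definition planar :: "diagram \<Rightarrow> bool" where
  "planar K \<longleftrightarrow> K = [] \<or> card (crossings K) + card (faces K) = length K + 2"

definition virtual_diagram :: "diagram \<Rightarrow> bool" where
  "virtual_diagram K \<longleftrightarrow> well_formed K \<and> planar K"

fun rename_passage :: "(nat \<Rightarrow> nat) \<Rightarrow> passage \<Rightarrow> passage" where
  "rename_passage f (Passage c l d) = Passage (f c) l d"

text \<open>
  The generalized Reidemeister moves; \<open>base_point\<close> and \<open>renaming\<close> only change the way in which
  the same diagram is recorded. In \<open>reidemeister2\<close> adjacency along both strands together with
  opposite directions at the two crossings forces the two edges to bound a bigon; in
  \<open>reidemeister3\<close> the three edges have to bound a triangular face, \<open>x\<close> is the uppermost strand, and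
  one of the others is the lowest one.

  In \<open>detour\<close> the branches \<open>a\<close> and \<open>a'\<close> run through virtual crossings only. Deleting a branch from
  a diagram erases its crossings also from the rest of the curve; what remains is a plane
  immersed arc, determined up to isotopy by its list of passages. The move is thus the
  replacement of one branch by any other one with the same endpoints.
\<close>

inductive diagram_move :: "diagram \<Rightarrow> diagram \<Rightarrow> bool" where
  base_point: "diagram_move K (rotate1 K)"
| renaming: "inj_on f (crossings K) \<Longrightarrow> diagram_move K (map (rename_passage f) K)"
| reidemeister1:
    "crossing x = crossing y \<Longrightarrow> level x \<noteq> Virtual \<Longrightarrow> level y \<noteq> Virtual \<Longrightarrow>
     diagram_move ([x, y] @ u) u"
| reidemeister2:
    "level x1 = Over \<Longrightarrow> level x2 = Over \<Longrightarrow> level y1 = Under \<Longrightarrow> level y2 = Under \<Longrightarrow>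
     {crossing x1, crossing x2} = {crossing y1, crossing y2} \<Longrightarrow>
     left_to_right x1 \<noteq> left_to_right x2 \<Longrightarrow>
     diagram_move ([x1, x2] @ u @ [y1, y2] @ v) (u @ v)"
| reidemeister3:
    "K = [x1, x2] @ u @ [y1, y2] @ v @ [z1, z2] @ w \<Longrightarrow>
     level x1 = Over \<Longrightarrow> level x2 = Over \<Longrightarrow>
     level y1 = Under \<and> level y2 = Under \<or> level z1 = Under \<and> level z2 = Under \<Longrightarrow>
     orbit (face_step K) (0, b1) =
       {(0, b1), (length u + 2, b2), (length u + length v + 4, b3)} \<Longrightarrow>
     diagram_move K ([x2, x1] @ u @ [y2, y1] @ v @ [z2, z1] @ w)"
| detour:
    "\<forall>x\<in>set a. level x = Virtual \<Longrightarrow> \<forall>x\<in>set a'. level x = Virtual \<Longrightarrow>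
     filter (\<lambda>x. crossing x \<notin> crossings a) b = filter (\<lambda>x. crossing x \<notin> crossings a') b' \<Longrightarrow>
     diagram_move (a @ b) (a' @ b')"

definition equivalent_diagrams :: "diagram \<Rightarrow> diagram \<Rightarrow> bool" where
  "equivalent_diagrams =
     equivclp (\<lambda>K K'. virtual_diagram K \<and> virtual_diagram K' \<and> diagram_move K K')"


section \<open>Parity and types of crossings\<close>

definition classical_crossings :: "diagram \<Rightarrow> nat set" where
  "classical_crossings K = crossing ` {x \<in> set K. level x \<noteq> Virtual}"

definition occurs_at :: "diagram \<Rightarrow> nat \<Rightarrow> nat \<Rightarrow> bool" where
  "occurs_at K c i \<longleftrightarrow> i < length K \<and> crossing (K ! i) = c"

definition chords_intersect :: "diagram \<Rightarrow> nat \<Rightarrow> nat \<Rightarrow> bool" where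
  "chords_intersect K c d \<longleftrightarrow>
     (\<exists>i j k l. i < j \<and> j < k \<and> k < l \<and>
        (occurs_at K c i \<and> occurs_at K d j \<and> occurs_at K c k \<and> occurs_at K d l \<or>
         occurs_at K d i \<and> occurs_at K c j \<and> occurs_at K d k \<and> occurs_at K c l))"

definition odd_crossing :: "diagram \<Rightarrow> nat \<Rightarrow> bool" where
  "odd_crossing K c \<longleftrightarrow>
     odd (card {d \<in> classical_crossings K. d \<noteq> c \<and> chords_intersect K c d})"

text \<open>\<open>virtualize_odd\<close> is the map \<open>f\<close> of the parity hierarchy.\<close>

definition virtualize_odd :: "diagram \<Rightarrow> diagram" where
  "virtualize_odd K =
     map (\<lambda>x. if crossing x \<in> classical_crossings K \<and> odd_crossing K (crossing x)
              then Passage (crossing x) Virtual (left_to_right x) else x) K"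

definition type0 :: "diagram \<Rightarrow> nat set" where
  "type0 K = {c \<in> classical_crossings K. odd_crossing K c}"

definition type1 :: "diagram \<Rightarrow> nat set" where
  "type1 K = {c \<in> classical_crossings K.
     \<not> odd_crossing K c \<and> odd_crossing (virtualize_odd K) c}"

definition type2 :: "diagram \<Rightarrow> nat set" where
  "type2 K = {c \<in> classical_crossings K.
     \<not> odd_crossing K c \<and> \<not> odd_crossing (virtualize_odd K) c}"


section \<open>Arcs, labels and the matrix\<close>

definition underpass :: "diagram \<Rightarrow> nat \<Rightarrow> nat" where
  "underpass K c = (THE i. i < length K \<and> crossing (K ! i) = c \<and> level (K ! i) = Under)"

definition cut_passage :: "diagram \<Rightarrow> passage \<Rightarrow> bool" where
  "cut_passage K x \<longleftrightarrow> level x = Under \<and> crossing x \<in> type1 K \<union> type2 K"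

text \<open>
  The passages along the arc originating at the underpass of \<open>c\<close>, in order, up to and including
  the underpass at which the arc ends (which is that of \<open>c\<close> again if there is only one arc).
\<close>

definition arc_passages :: "diagram \<Rightarrow> nat \<Rightarrow> passage list" where
  "arc_passages K c =
     (let i = underpass K c; xs = drop (i + 1) K @ take (i + 1) K;
          ys = takeWhile (\<lambda>x. \<not> cut_passage K x) xs
      in take (length ys + 1) xs)"

text \<open>
  \<open>label_exponent K xs\<close> is the exponent of \<open>s\<close> on the short arc reached from the beginning of an
  arc after the passages \<open>xs\<close>.
\<close>

definition label_exponent :: "diagram \<Rightarrow> passage list \<Rightarrow> int" where
  "label_exponent K xs =
     (\<Sum>x\<leftarrow>xs. if crossing x \<in> type0 K then (if left_to_right x then 1 else - 1) else 0)"

definition over_label :: "diagram \<Rightarrow> nat \<Rightarrow> knot_ring" where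
  "over_label K c = (if c \<in> type2 K then 1 - ring_t else ring_q)"

definition right_label :: "diagram \<Rightarrow> nat \<Rightarrow> knot_ring" where
  "right_label K c = (if c \<in> type2 K then ring_t else ring_p)"

definition left_label :: "diagram \<Rightarrow> nat \<Rightarrow> knot_ring" where
  "left_label K c = - 1"

text \<open>
  Local labels at a passage \<open>x\<close>: \<open>arriving_label\<close> is that of the overpass or of the
  under-branch along which \<open>x\<close> arrives, \<open>departing_label\<close> that of the under-branch along which the
  underpass \<open>x\<close> departs. A strand going from left to right arrives on the left and departs
  on the right.
\<close>

definition arriving_label :: "diagram \<Rightarrow> passage \<Rightarrow> knot_ring" where
  "arriving_label K x =
     (if level x = Over then over_label K (crossing x)
      else if left_to_right x then left_label K (crossing x)
      else right_label K (crossing x))"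

definition departing_label :: "diagram \<Rightarrow> passage \<Rightarrow> knot_ring" where
  "departing_label K x =
     (if left_to_right x then right_label K (crossing x) else left_label K (crossing x))"

text \<open>
  The entry for crossing \<open>c\<close> and the arc originating at crossing \<open>d\<close>: the first summand is the
  incidence of the arc with the crossing at which it originates (its first short arc has label
  \<open>s\<^sup>0\<close>), the sum ranges over the later incidences.
\<close>

definition knot_matrix_entry :: "diagram \<Rightarrow> nat \<Rightarrow> nat \<Rightarrow> knot_ring" where
  "knot_matrix_entry K c d =
     (if c = d then departing_label K (K ! underpass K c) * ring_s_pow 0 else 0) +
     (\<Sum>m | m < length (arc_passages K d) \<and> crossing (arc_passages K d ! m) = c.
        arriving_label K (arc_passages K d ! m) * ring_s_pow (label_exponent K (take m (arc_passages K d))))"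

definition numbering :: "diagram \<Rightarrow> nat list \<Rightarrow> bool" where
  "numbering K cs \<longleftrightarrow> distinct cs \<and> set cs = type1 K \<union> type2 K"

definition knot_matrix :: "diagram \<Rightarrow> nat list \<Rightarrow> knot_ring mat" where
  "knot_matrix K cs =
     mat (length cs) (length cs) (\<lambda>(i, j). knot_matrix_entry K (cs ! i) (cs ! j))"

text \<open>
  Without crossings of types 1 and 2 the curve is not cut into arcs and there is no matrix. The
  determinant is then taken to be \<open>0\<close>, which is its value after adding a kink by a first
  Reidemeister move; the value \<open>1\<close> of the empty determinant would not be invariant.
\<close>

definition knot_det :: "diagram \<Rightarrow> nat list \<Rightarrow> knot_ring" where
  "knot_det K cs = (if cs = [] then 0 else det (knot_matrix K cs))"

end

theory Submission imports Defs "HOL-Combinatorics.List_Permutation" begin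

text \<open>
  The determinant over arcs is replaced by a larger one with a row and a column for every passage,
  the column of a passage standing for the edge that arrives there. At an underpass of a cut
  crossing the row is the original relation; at every other passage it says that the outgoing
  edge equals the incoming one, multiplied by \<open>s\<^sup>\<plusminus>\<^sup>1\<close> at crossings of type \<open>0\<close>. Eliminating the latter
  rows gives back \<open>N''\<close>. A Reidemeister move now changes boundedly many rows and columns, so its
  invariance is a local row computation. The types allowed there are controlled by parity: with
  respect to a set \<open>S\<close> of crossings, a crossing is even iff its two passages stand at positions of opposite
  parity in the Gauss code restricted to \<open>S\<close>. If the three crossings of a third
  move lie in \<open>S\<close>, an even number of them is therefore odd, and in the cases that remain the
  relations \<open>q (p - t) = 0\<close> and \<open>q\<^sup>2 = (1 - t) (1 - p)\<close> are what the computation needs. Only the first two moves produce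
  units, and these are powers of \<open>t\<close> and \<open>p\<close>.
\<close>

section \<open>Determinants indexed by lists\<close>

text \<open>Labels \<open>s^m\<close> are counted from the start of an arc, so one changed passage
  can affect entries far along the curve, and a move can create or merge arcs and alter the size of
  \<open>N''\<close>. In the edge determinant a row involves only edges at one crossing. Columns are
  indexed by passages, not by numbers, so the untouched part of the curve essentially keeps its
  rows, and any reordering costs only a sign, which the theorem allows; hence all comparisons are
  made up to sign. In the third move let 1, 2, 3 be the crossings of middle and bottom, top and
  bottom, top and middle strand, with label \<open>\<alpha>\<close> for the right under-branch and
  \<open>\<beta>\<close> for the overpass. Eliminating the sides of the triangle leaves two
  conditions, \<open>\<beta>1 \<alpha>2 = \<beta>1 \<alpha>3\<close> and
  \<open>\<alpha>1 \<beta>2 = \<beta>2 - \<beta>1 \<beta>3\<close>; the relations of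
  \<open>R'\<close> are what they become for the labels of types 1 and 2. A diagram without cut
  crossings has value 0: the two passages of a crossing of type 0 contribute inverse powers of
  \<open>s\<close>, so the labels close up along the curve and form a kernel vector of the edge
  matrix.\<close>

definition eq_sign :: "'a::comm_ring_1 \<Rightarrow> 'a \<Rightarrow> bool" (infix "\<simeq>" 50) where
  "a \<simeq> b \<longleftrightarrow> a = b \<or> a = - b"

lemma eq_sign_refl [simp]: "a \<simeq> a"
  by (simp add: eq_sign_def)

lemma eq_sign_sym: "a \<simeq> b \<Longrightarrow> b \<simeq> a"
  by (auto simp: eq_sign_def)

lemma eq_sign_trans [trans]: "a \<simeq> b \<Longrightarrow> b \<simeq> c \<Longrightarrow> a \<simeq> c"
  by (auto simp: eq_sign_def)

lemma eq_sign_mult: "a \<simeq> b \<Longrightarrow> c * a \<simeq> c * b"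
  by (auto simp: eq_sign_def)

lemma eq_sign_0_iff [simp]: "a \<simeq> 0 \<longleftrightarrow> a = 0" "0 \<simeq> a \<longleftrightarrow> a = 0"
  by (auto simp: eq_sign_def)

text \<open>Rows are linear forms and columns are names of variables, so that the edges of a diagram
  can serve as columns directly. The size is read off the columns; \<open>rs\<close> is meant to
  have the same length.\<close>

definition rdet :: "('c \<Rightarrow> 'a::comm_ring_1) list \<Rightarrow> 'c list \<Rightarrow> 'a" where
  "rdet rs cs = det (mat (length cs) (length cs) (\<lambda>(i, j). (rs ! i) (cs ! j)))"

lemma rdet_cong:
  assumes "length rs = length cs" "list_all2 (\<lambda>r r'. \<forall>c\<in>set cs. r c = r' c) rs rs'"
  shows "rdet rs cs = rdet rs' cs"
proof -
  have "mat (length cs) (length cs) (\<lambda>(i, j). (rs ! i) (cs ! j)) =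
      mat (length cs) (length cs) (\<lambda>(i, j). (rs' ! i) (cs ! j))"
    using assms by (intro eq_matI) (auto simp: list_all2_conv_all_nth)
  then show ?thesis
    by (simp add: rdet_def)
qed

text \<open>Equality of multisets stands for "some reordering", so later steps never have to name a
  permutation or compute its sign.\<close>

lemma rdet_permute_rows:
  assumes "length rs = length cs" "mset rs = mset rs'"
  shows "rdet rs cs \<simeq> rdet rs' cs"
proof -
  let ?n = "length cs"
  have len: "length rs' = ?n"
    using assms by (metis size_mset)
  obtain p where p: "p permutes {..<?n}" "permute_list p rs' = rs"
    using mset_eq_permutation[OF assms(2)] len by metis
  let ?A = "mat ?n ?n (\<lambda>(i, j). (rs' ! i) (cs ! j))"
  have p': "p permutes {0..<?n}"
    using p(1) by (simp add: atLeast0LessThan)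
  have "mat ?n ?n (\<lambda>(i, j). (rs ! i) (cs ! j)) = mat ?n ?n (\<lambda>(i, j). ?A $$ (p i, j))"
  proof (rule eq_matI)
    fix i j
    assume "i < dim_row (mat ?n ?n (\<lambda>(i, j). ?A $$ (p i, j)))" "j < dim_col (mat ?n ?n (\<lambda>(i, j). ?A $$ (p i, j)))"
    then have ij: "i < ?n" "j < ?n" by auto
    have "p i < ?n"
      using permutes_in_image[OF p(1), of i] ij by simp
    moreover have "rs ! i = rs' ! p i"
      using permute_list_nth[of p rs' i] p len ij by simp
    ultimately show "mat ?n ?n (\<lambda>(i, j). (rs ! i) (cs ! j)) $$ (i, j) = mat ?n ?n (\<lambda>(i, j). ?A $$ (p i, j)) $$ (i, j)"
      using ij by simp
  qed auto
  then have "rdet rs cs = signof p * rdet rs' cs"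
    using det_permute_rows[of ?A ?n p] p' by (simp add: rdet_def)
  then show ?thesis
    by (auto simp: eq_sign_def sign_def)
qed

lemma rdet_transpose:
  assumes "length rs = length cs"
  shows "rdet rs cs = rdet (map (\<lambda>c r. r c) cs) rs"
proof -
  let ?n = "length cs"
  let ?A = "mat ?n ?n (\<lambda>(i, j). (rs ! i) (cs ! j))"
  have "rdet (map (\<lambda>c r. r c) cs) rs = det (transpose_mat ?A)"
    unfolding rdet_def using assms by (intro arg_cong[of _ _ det] eq_matI) simp_all
  also have "\<dots> = det ?A"
    by (rule det_transpose) auto
  finally show ?thesis
    by (simp add: rdet_def)
qed

lemma rdet_permute_cols:
  assumes "length rs = length cs" "mset cs = mset cs'"
  shows "rdet rs cs \<simeq> rdet rs cs'"
proof -
  have len: "length cs = length cs'"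
    using assms by (metis size_mset)
  have "rdet (map (\<lambda>c r. r c) cs) rs \<simeq> rdet (map (\<lambda>c r. r c) cs') rs"
    using assms len by (intro rdet_permute_rows) auto
  then show ?thesis
    using rdet_transpose[of rs cs] rdet_transpose[of rs cs'] assms len by simp
qed

lemma rdet_permute:
  assumes "length rs = length cs" "mset rs = mset rs'" "mset cs = mset cs'"
  shows "rdet rs cs \<simeq> rdet rs' cs'"
  using eq_sign_trans[OF rdet_permute_rows[OF assms(1,2)] rdet_permute_cols[OF _ assms(3)]]
    assms by (metis size_mset)

text \<open>Compares diagrams whose edges carry different names: after a renaming of crossings, and
  after a third move.\<close>

lemma rdet_map_cols: "rdet rs (map f cs) = rdet (map (\<lambda>r. r \<circ> f) rs) cs" if "length rs = length cs"
proof -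
  have "mat (length cs) (length cs) (\<lambda>(i, j). (rs ! i) (map f cs ! j)) =
      mat (length cs) (length cs) (\<lambda>(i, j). (map (\<lambda>r. r \<circ> f) rs ! i) (cs ! j))"
    using that by (intro eq_matI) simp_all
  then show ?thesis
    by (simp add: rdet_def)
qed

lemma rdet_expand:
  assumes "length rs = length cs" "\<forall>d\<in>set cs. r d = 0"
  shows "rdet (r # rs) (c # cs) = r c * rdet rs cs"
proof -
  let ?n = "length cs"
  let ?A = "mat (Suc ?n) (Suc ?n) (\<lambda>(i, j). ((r # rs) ! i) ((c # cs) ! j))"
  have "det ?A = (\<Sum>j<Suc ?n. ?A $$ (0, j) * cofactor ?A 0 j)"
    by (rule laplace_expansion_row) auto
  also have "\<dots> = (\<Sum>j\<in>{0}. ?A $$ (0, j) * cofactor ?A 0 j)"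
  proof (rule sum.mono_neutral_right)
    show "\<forall>j\<in>{..<Suc ?n} - {0}. ?A $$ (0, j) * cofactor ?A 0 j = 0"
    proof
      fix j assume "j \<in> {..<Suc ?n} - {0}"
      then obtain k where "j = Suc k" "k < ?n" by (cases j) auto
      then show "?A $$ (0, j) * cofactor ?A 0 j = 0"
        using assms(2) by simp
    qed
  qed auto
  also have "\<dots> = r c * det (mat_delete ?A 0 0)"
    by (simp add: cofactor_def)
  also have "mat_delete ?A 0 0 = mat ?n ?n (\<lambda>(i, j). (rs ! i) (cs ! j))"
    by (intro eq_matI) (auto simp: mat_delete_def)
  finally show ?thesis
    by (simp add: rdet_def)
qed

lemma rdet_scale: 
  assumes "length rs = length cs" "length ks = length cs"
  shows "rdet (map2 (\<lambda>k r c. k * r c) ks rs) cs = prod_list ks * rdet rs cs"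
proof -
  let ?n = "length cs"
  let ?A = "mat ?n ?n (\<lambda>(i, j). (rs ! i) (cs ! j))"
  let ?D = "mat ?n ?n (\<lambda>(i, j). if i = j then ks ! i else 0)"
  have "det ?D = prod_list (diag_mat ?D)"
    by (rule det_lower_triangular[of ?n]) auto
  also have "diag_mat ?D = ks"
    using assms by (auto simp: diag_mat_def intro!: nth_equalityI)
  finally have "det (?D * ?A) = prod_list ks * det ?A"
    by (subst det_mult[of _ ?n]) auto
  moreover have "?D * ?A = mat ?n ?n (\<lambda>(i, j). (map2 (\<lambda>k r c. k * r c) ks rs ! i) (cs ! j))"
    (is "_ = ?C")
  proof (rule eq_matI)
    fix i j assume "i < dim_row ?C" "j < dim_col ?C"
    then have ij: "i < ?n" "j < ?n" by auto
    have "(?D * ?A) $$ (i, j) = (\<Sum>k<?n. (if i = k then ks ! i else 0) * (rs ! k) (cs ! j))"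
      using ij by (simp add: scalar_prod_def atLeast0LessThan)
    also have "\<dots> = (\<Sum>k\<in>{i}. (if i = k then ks ! i else 0) * (rs ! k) (cs ! j))"
      using ij by (intro sum.mono_neutral_right) auto
    also have "\<dots> = ?C $$ (i, j)"
      using ij assms by simp
    finally show "(?D * ?A) $$ (i, j) = ?C $$ (i, j)" .
  qed auto
  ultimately show ?thesis
    by (simp add: rdet_def)
qed

lemma rdet_scale_hd:
  assumes "length rs = length cs"
  shows "rdet ((\<lambda>c. k * r c) # rs) (c # cs) = k * rdet (r # rs) (c # cs)"
proof -
  have "map2 (\<lambda>k r c. k * r c) (replicate (length rs) 1) rs = rs"
    by (intro nth_equalityI) auto
  then show ?thesis
    using rdet_scale[of "r # rs" "c # cs" "k # replicate (length rs) 1"] assms by simp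
qed

lemma rdet_add_row:
  assumes "length rs = length cs"
  shows "rdet (r # (\<lambda>c. r' c + k * r c) # rs) (c # d # cs) = rdet (r # r' # rs) (c # d # cs)"
proof -
  let ?n = "Suc (Suc (length cs))"
  let ?A = "mat ?n ?n (\<lambda>(i, j). ((r # r' # rs) ! i) ((c # d # cs) ! j))"
  have "det (addrow k 1 0 ?A) = det ?A"
    by (rule det_addrow[of _ ?n]) auto
  moreover have "addrow k 1 0 ?A =
      mat ?n ?n (\<lambda>(i, j). ((r # (\<lambda>c. r' c + k * r c) # rs) ! i) ((c # d # cs) ! j))"
    (is "_ = ?C")
  proof (rule eq_matI)
    fix i j assume "i < dim_row ?C" "j < dim_col ?C"
    then have ij: "i < ?n" "j < ?n" by auto
    consider "i = 0" | "i = 1" | k where "i = Suc (Suc k)" by (metis One_nat_def not0_implies_Suc)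
    then show "addrow k 1 0 ?A $$ (i, j) = ?C $$ (i, j)"
      using ij by cases (simp_all add: add.commute)
  qed auto
  ultimately show ?thesis
    by (simp add: rdet_def)
qed

definition unit_row :: "'c \<Rightarrow> 'c \<Rightarrow> 'a::comm_ring_1" (\<open>\<delta>\<close>) where
  "\<delta> c = (\<lambda>j. if j = c then 1 else 0)"

text \<open>The linear form \<open>r\<close> after the variable \<open>c\<close> has been replaced
  by the combination \<open>\<psi>\<close>. If \<open>\<psi> c = 0\<close>, the result no longer
  involves \<open>c\<close>.\<close>

definition subst_col :: "'c \<Rightarrow> ('c \<Rightarrow> 'a::comm_ring_1) \<Rightarrow> ('c \<Rightarrow> 'a) \<Rightarrow> 'c \<Rightarrow> 'a" where
  "subst_col c \<psi> r = (\<lambda>j. (if j = c then 0 else r j) + r c * \<psi> j)"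

text \<open>The row \<open>r\<close> is the equation \<open>c = \<psi>\<close>, scaled by
  \<open>u\<close>. Right multiplication by the unitriangular \<open>?B\<close> adds multiples of
  column \<open>c\<close> to the other columns until \<open>r\<close> is \<open>u\<close> times a
  unit row, and then the determinant is expanded along it.\<close>

lemma rdet_eliminate:
  assumes len: "length rs = length cs" and c: "c \<notin> set cs" and \<psi>: "\<psi> c = 0"
    and r: "\<And>j. r j = u * (\<delta> c j - \<psi> j)"
  shows "rdet (r # rs) (c # cs) = u * rdet (map (subst_col c \<psi>) rs) cs"
proof -
  let ?n = "Suc (length cs)"
  let ?A = "mat ?n ?n (\<lambda>(i, j). ((r # rs) ! i) ((c # cs) ! j))"
  let ?B = "mat ?n ?n (\<lambda>(i, j). if i = j then 1 else if i = 0 then \<psi> ((c # cs) ! j) else 0)"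
  define r' where "r' = (\<lambda>j. u * \<delta> c j)"
  have "det ?B = prod_list (diag_mat ?B)"
    by (rule det_upper_triangular[of _ ?n]) auto
  also have "diag_mat ?B = replicate ?n 1"
    by (rule nth_equalityI) (auto simp: diag_mat_def simp del: replicate.simps upt_Suc)
  finally have "det (?A * ?B) = det ?A"
    by (subst det_mult[of _ ?n]) auto
  moreover have "?A * ?B = mat ?n ?n (\<lambda>(i, j). ((r' # map (\<lambda>r j. if j = c then r c else r j + r c * \<psi> j) rs) ! i) ((c # cs) ! j))"
    (is "_ = ?C")
  proof (rule eq_matI)
    fix i j assume "i < dim_row ?C" "j < dim_col ?C"
    then have ij: "i < ?n" "j < ?n" by auto
    let ?r = "(r # rs) ! i"
    have "(?A * ?B) $$ (i, j) = (\<Sum>k<?n. ?r ((c # cs) ! k) *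
        (if k = j then 1 else if k = 0 then \<psi> ((c # cs) ! j) else 0))"
      using ij by (simp add: scalar_prod_def atLeast0LessThan del: sum.lessThan_Suc)
    also have "\<dots> = (\<Sum>k\<in>{0, j}. ?r ((c # cs) ! k) *
        (if k = j then 1 else if k = 0 then \<psi> ((c # cs) ! j) else 0))"
      using ij by (intro sum.mono_neutral_right) auto
    also have "\<dots> = (if j = 0 then ?r c else ?r ((c # cs) ! j) + ?r c * \<psi> ((c # cs) ! j))"
      by auto
    also have "\<dots> = ?C $$ (i, j)"
    proof (cases i)
      case 0
      then show ?thesis
        using ij c \<psi> by (cases j) (auto simp: r r'_def unit_row_def algebra_simps)
    next
      case (Suc k)
      then show ?thesis
        using ij c len by (cases j) auto
    qed
    finally show "(?A * ?B) $$ (i, j) = ?C $$ (i, j)" .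
  qed auto
  ultimately have "rdet (r # rs) (c # cs) =
      rdet (r' # map (\<lambda>r j. if j = c then r c else r j + r c * \<psi> j) rs) (c # cs)"
    by (simp add: rdet_def)
  also have "\<dots> = u * rdet (map (\<lambda>r j. if j = c then r c else r j + r c * \<psi> j) rs) cs"
    using len c by (subst rdet_expand) (auto simp: r'_def unit_row_def)
  \<comment> \<open>The two kinds of rows differ only in column \<open>c\<close>, which is gone by
    now.\<close>
  also have "rdet (map (\<lambda>r j. if j = c then r c else r j + r c * \<psi> j) rs) cs = rdet (map (subst_col c \<psi>) rs) cs"
    using len c by (intro rdet_cong) (auto simp: list_all2_conv_all_nth subst_col_def)
  finally show ?thesis .
qed

lemma rdet_eliminate_mset:
  assumes "length R = length C" "mset R = mset (r # rs)" "mset C = mset (c # cs)" "c \<notin> set cs" "\<psi> c = 0"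
    and "\<And>j. r j = u * (\<delta> c j - \<psi> j)"
  shows "rdet R C \<simeq> u * rdet (map (subst_col c \<psi>) rs) cs"
proof -
  have "length (r # rs) = length (c # cs)"
    using assms(1-3) by (metis size_mset)
  then show ?thesis
    using rdet_permute[OF assms(1-3)] rdet_eliminate[of rs cs c \<psi> r u] assms(4-6) by simp
qed

lemma subst_col_id: "r c = 0 \<Longrightarrow> subst_col c \<psi> r = r"
  by (auto simp: subst_col_def)

section \<open>The determinant over edges\<close>

text \<open>\<open>Skein \<alpha> \<beta>\<close> is a cut crossing with label \<open>\<alpha>\<close> for the right under-branch and \<open>\<beta>\<close> for the overpass.\<close>

datatype kind = Through | Shift | Skein knot_ring knot_ring

text \<open>Of an underpass, this is the other passage of the same crossing.\<close>

definition over_of :: "passage \<Rightarrow> passage" where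
  "over_of x = Passage (crossing x) Over (\<not> left_to_right x)"

definition shift :: "passage \<Rightarrow> int" where
  "shift x = (if left_to_right x then 1 else - 1)"

text \<open>Here \<open>v\<close> is the edge of the overpass, \<open>i\<close> the incoming and \<open>o'\<close> the outgoing edge of the passage.\<close>

definition passage_row :: "kind \<Rightarrow> passage \<Rightarrow> 'e \<Rightarrow> 'e \<Rightarrow> 'e \<Rightarrow> 'e \<Rightarrow> knot_ring" where
  "passage_row k x v i o' = (case k of
      Through \<Rightarrow> (\<lambda>j. \<delta> o' j - \<delta> i j)
    | Shift \<Rightarrow> (\<lambda>j. \<delta> o' j - ring_s_pow (shift x) * \<delta> i j)
    | Skein \<alpha> \<beta> \<Rightarrow>
        if level x = Under
        then (\<lambda>j. \<beta> * \<delta> v j + (if left_to_right x then \<alpha> * \<delta> o' j - \<delta> i j else \<alpha> * \<delta> i j - \<delta> o' j))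
        else (\<lambda>j. \<delta> o' j - \<delta> i j))"

text \<open>An edge is named by the passage where it arrives, so the edge leaving a passage is the
  next list element; \<open>e\<close> names the edge that leaves the last one. With \<open>e\<close>
  as an argument the closed curve can be cut into segments.\<close>

fun walk :: "(nat \<Rightarrow> kind) \<Rightarrow> diagram \<Rightarrow> passage \<Rightarrow> (passage \<Rightarrow> knot_ring) list" where
  "walk T [] e = []"
| "walk T (x # xs) e = passage_row (T (crossing x)) x (over_of x) x (hd (xs @ [e])) # walk T xs e"

text \<open>Taking \<open>hd K\<close> as the final edge closes the list up to a circle. The value 0
  of the circle without crossings agrees with \<open>knot_det\<close> and makes the removal of a
  last \<open>Through\<close> passage correct.\<close>

definition edge_det :: "(nat \<Rightarrow> kind) \<Rightarrow> diagram \<Rightarrow> knot_ring" where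
  "edge_det T K = (if K = [] then 0 else rdet (walk T K (hd K)) K)"

lemma length_walk [simp]: "length (walk T xs e) = length xs"
  by (induction xs) auto

lemma walk_append: "walk T (xs @ ys) e = walk T xs (hd (ys @ [e])) @ walk T ys e"
  by (induction xs) (auto simp: hd_append)

lemma walk_cong: "(\<And>x. x \<in> set xs \<Longrightarrow> T (crossing x) = T' (crossing x)) \<Longrightarrow> walk T xs e = walk T' xs e"
  by (induction xs) auto

lemma edge_det_cong: "(\<And>x. x \<in> set K \<Longrightarrow> T (crossing x) = T' (crossing x)) \<Longrightarrow> edge_det T K = edge_det T' K"
  unfolding edge_det_def using walk_cong by metis

lemma edge_det_rotate: "edge_det T (xs @ ys) \<simeq> edge_det T (ys @ xs)"
proof (cases "xs = [] \<or> ys = []")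
  case False
  then show ?thesis
    unfolding edge_det_def by (auto simp: walk_append intro!: rdet_permute)
qed auto

lemma unit_row_same [simp]: "\<delta> c c = 1"
  by (simp add: unit_row_def)

lemma unit_row_neq [simp]: "j \<noteq> c \<Longrightarrow> \<delta> c j = 0"
  by (simp add: unit_row_def)

section \<open>Removing passages that act as virtual ones\<close>

lemma passage_row_eq_0:
  assumes "i \<noteq> c" "o' \<noteq> c" "v \<noteq> c \<or> k = Through \<or> k = Shift"
  shows "passage_row k x v i o' c = 0"
  using assms by (auto simp: passage_row_def split: kind.splits)

text \<open>An edge inside the moved part of a diagram does not occur in the rows of the rest, so
  substitutions for it leave those rows alone.\<close>

lemma walk_eq_0:
  assumes "c \<notin> set xs" "e \<noteq> c" "\<forall>x\<in>set xs. over_of x \<noteq> c \<or> T (crossing x) = Through \<or> T (crossing x) = Shift"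
    and "r \<in> set (walk T xs e)"
  shows "r c = 0"
  using assms
proof (induction xs)
  case (Cons x xs)
  then have "hd (xs @ [e]) \<noteq> c"
    by (cases xs) auto
  then show ?case
    using Cons by (auto intro!: passage_row_eq_0)
qed simp

lemma subst_col_passage_row:
  assumes "c \<noteq> e"
  shows "subst_col c (\<delta> e) (passage_row k x v i o') =
    passage_row k x (if v = c then e else v) (if i = c then e else i) (if o' = c then e else o')"
  using assms by (auto simp: passage_row_def subst_col_def unit_row_def fun_eq_iff split: kind.splits)

text \<open>Erasing the passage \<open>c\<close> joins the edge arriving there to the edge
  \<open>e\<close>. Rows that name \<open>c\<close> as overpass edge belong to the crossing of
  \<open>c\<close>; it is \<open>Through\<close>, and such rows ignore the overpass edge.\<close>

lemma walk_subst:
  assumes "c \<notin> set xs" "c \<noteq> e" "T (crossing c) = Through"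
  shows "map (subst_col c (\<delta> e)) (walk T xs c) = walk T xs e"
  using assms
proof (induction xs)
  case (Cons x xs)
  have "passage_row (T (crossing x)) x (if over_of x = c then e else over_of x) i o' =
      passage_row (T (crossing x)) x (over_of x) i o'" for i o' :: passage
  proof (cases "over_of x = c")
    case True
    then have "T (crossing x) = Through"
      using Cons.prems by (auto simp: over_of_def)
    then show ?thesis
      by (simp add: passage_row_def)
  qed simp
  moreover have "(if hd (xs @ [c]) = c then e else hd (xs @ [c])) = hd (xs @ [e])"
    using Cons.prems by (cases xs) auto
  ultimately show ?case
    using Cons by (auto simp: subst_col_passage_row)
qed simp

lemma edge_det_remove_hd:
  assumes "distinct (x # xs)" "T (crossing x) = Through"
  shows "edge_det T (x # xs) \<simeq> edge_det T xs"
proof (cases "xs = []")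
  \<comment> \<open>The only edge is both incoming and outgoing, so the row of \<open>x\<close>
    vanishes; the empty list has value 0 by definition.\<close>
  case True
  then show ?thesis
    using assms rdet_expand[of "[]" "[]" "passage_row Through x (over_of x) x x" x]
    by (simp add: edge_det_def passage_row_def)
next
  case False
  then have hd: "hd (xs @ [x]) = hd xs" "hd xs \<noteq> x"
    using assms by auto
  have "rdet (walk T (x # xs) x) (x # xs) = - 1 * rdet (map (subst_col x (\<delta> (hd xs))) (walk T xs x)) xs"
    unfolding walk.simps using assms hd
    by (intro rdet_eliminate) (auto simp: passage_row_def)
  then show ?thesis
    using assms hd False by (simp add: edge_det_def walk_subst eq_sign_def)
qed

lemma edge_det_remove:
  assumes "distinct (xs @ x # ys)" "T (crossing x) = Through"
  shows "edge_det T (xs @ x # ys) \<simeq> edge_det T (xs @ ys)"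
proof -
  have "edge_det T (xs @ x # ys) \<simeq> edge_det T (x # ys @ xs)"
    using edge_det_rotate[of T xs "x # ys"] by simp
  also have "\<dots> \<simeq> edge_det T (ys @ xs)"
    using assms by (intro edge_det_remove_hd) auto
  also have "\<dots> \<simeq> edge_det T (xs @ ys)"
    by (rule edge_det_rotate)
  finally show ?thesis .
qed

text \<open>For the detour move: applied to the kinds of a diagram, this strips off all virtual
  passages at once.\<close>

lemma edge_det_filter:
  assumes "distinct K"
  shows "edge_det T K \<simeq> edge_det T (filter (\<lambda>x. T (crossing x) \<noteq> Through) K)"
  using assms
proof (induction "length K" arbitrary: K rule: less_induct)
  case less
  show ?case
  proof (cases "\<exists>x\<in>set K. T (crossing x) = Through")
    case True
    then obtain xs x ys where K: "K = xs @ x # ys" and x: "T (crossing x) = Through"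
      by (meson split_list)
    have "edge_det T K \<simeq> edge_det T (xs @ ys)"
      unfolding K using less.prems x K by (intro edge_det_remove) auto
    also have "\<dots> \<simeq> edge_det T (filter (\<lambda>x. T (crossing x) \<noteq> Through) (xs @ ys))"
      using less.prems K by (intro less.hyps) auto
    finally show ?thesis
      using K x by simp
  next
    case False
    then show ?thesis
      by (simp cong: filter_cong)
  qed
qed

lemma edge_det_rename:
  assumes "inj_on f (crossings K)"
  shows "edge_det T (map (rename_passage f) K) = edge_det (T \<circ> f) K"
proof -
  let ?g = "rename_passage f"
  let ?C = "{x. crossing x \<in> crossings K}"
  have g: "crossing (?g x) = f (crossing x)" "left_to_right (?g x) = left_to_right x" "level (?g x) = level x" for x
    by (cases x; simp)+
  have ov: "over_of (?g x) = ?g (over_of x)" for x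
    by (cases x) (simp add: over_of_def)
  have inj: "?g x = ?g y \<longleftrightarrow> x = y" if "x \<in> ?C" "y \<in> ?C" for x y
    using assms that by (cases x; cases y) (auto dest: inj_onD)
  have ovC: "over_of x \<in> ?C" if "x \<in> ?C" for x
    using that by (simp add: over_of_def)
  have row: "passage_row k (?g x) (?g v) (?g i) (?g o') (?g j) = passage_row k x v i o' j"
    if "v \<in> ?C" "i \<in> ?C" "o' \<in> ?C" "j \<in> ?C" for k x v i o' j
    using that by (simp add: passage_row_def unit_row_def inj g shift_def split: kind.splits)
  have walk: "list_all2 (\<lambda>r r'. \<forall>c\<in>set K. r c = r' c) (map (\<lambda>r. r \<circ> ?g) (walk T (map ?g xs) (?g e))) (walk (T \<circ> f) xs e)"
    if "set xs \<subseteq> set K" "e \<in> set K" for xs e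
    using that
  proof (induction xs)
    case (Cons x xs)
    have hd: "hd (map ?g xs @ [?g e]) = ?g (hd (xs @ [e]))"
      by (cases xs) auto
    have "hd (xs @ [e]) \<in> set K"
      using Cons.prems by (cases xs) auto
    then show ?case
      using Cons ovC[of x] by (auto simp: hd ov g row)
  qed simp
  show ?thesis
  proof (cases "K = []")
    case False
    have "rdet (walk T (map ?g K) (?g (hd K))) (map ?g K) = rdet (map (\<lambda>r. r \<circ> ?g) (walk T (map ?g K) (?g (hd K)))) K"
      by (rule rdet_map_cols) auto
    also have "\<dots> = rdet (walk (T \<circ> f) K (hd K)) K"
      using walk[of K "hd K"] False by (intro rdet_cong) auto
    finally show ?thesis
      using False by (simp add: edge_det_def hd_map)
  qed (simp add: edge_det_def)
qed

text \<open>The labels \<open>\<alpha>\<close>, \<open>1 - \<alpha>\<close> and \<open>-1\<close>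
  add up to 0. The loop of the kink is an edge at its own crossing, and once it is eliminated, the
  underpass row is a multiple of \<open>?R\<close>, which says that the curve runs straight on. The
  factor is 1 or \<open>\<alpha>\<close> up to sign, depending on the kink.\<close>

lemma edge_det_kink:
  assumes "distinct (x # y # u)" "crossing y = crossing x" "left_to_right x \<noteq> left_to_right y"
    and "(level x, level y) \<in> {(Over, Under), (Under, Over)}"
    and "crossing x \<notin> crossings u" "T (crossing x) = Skein \<alpha> (1 - \<alpha>)"
  shows "\<exists>k\<in>{1, \<alpha>}. edge_det T (x # y # u) \<simeq> k * edge_det T u"
proof -
  let ?T = "T(crossing x := Through)"
  let ?o = "hd (u @ [x])"
  let ?R = "\<lambda>j. \<delta> ?o j - \<delta> x j"
  have o: "?o \<noteq> y"
    using assms(1) by (cases u) auto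
  have u: "crossing z \<noteq> crossing x" if "z \<in> set u" for z
    using assms(5) that by (metis image_eqI)
  have T: "walk ?T u x = walk T u x"
    using assms(5) by (intro walk_cong) (metis fun_upd_other image_eqI)
  have 0: "r y = 0" if "r \<in> set (walk T u x)" for r
    using assms that u by (intro walk_eq_0[of y u x T r]) (auto simp: over_of_def)
  have id: "map (subst_col y \<psi>) (walk T u x) = walk T u x" for \<psi>
    using 0 by (auto intro!: map_idI simp: subst_col_id)
  \<comment> \<open>The term of comparison keeps the passage \<open>x\<close> but lets its crossing
    count as \<open>Through\<close>; its rows are those that the elimination of \<open>y\<close>
    produces, up to a factor.\<close>
  have "edge_det ?T (x # u) \<simeq> edge_det ?T u"
    using assms by (intro edge_det_remove_hd) auto
  moreover have "edge_det ?T u = edge_det T u"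
    using assms(5) by (intro edge_det_cong) (metis fun_upd_other image_eqI)
  moreover have "edge_det ?T (x # u) = rdet (?R # walk T u x) (x # u)"
    by (simp add: edge_det_def passage_row_def T)
  ultimately have *: "rdet (?R # walk T u x) (x # u) \<simeq> edge_det T u"
    by simp
  have K: "edge_det T (x # y # u) = rdet (passage_row (Skein \<alpha> (1 - \<alpha>)) x (over_of x) x y #
      passage_row (Skein \<alpha> (1 - \<alpha>)) y (over_of y) y ?o # walk T u x) (x # y # u)"
    using assms(2,6) by (simp add: edge_det_def)
  have "\<exists>k\<in>{1, \<alpha>, - 1, - \<alpha>}. edge_det T (x # y # u) \<simeq> rdet ((\<lambda>j. k * ?R j) # walk T u x) (x # u)"
  proof (cases "level x = Over")
    case True
    let ?k = "if left_to_right y then \<alpha> else - 1"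
    let ?r = "passage_row (Skein \<alpha> (1 - \<alpha>)) y (over_of y) y ?o"
    have xy: "over_of y = x" "level y = Under"
      using assms True by (auto simp: over_of_def intro: passage.expand)
    have "edge_det T (x # y # u) \<simeq> 1 * rdet (map (subst_col y (\<delta> x)) (?r # walk T u x)) (x # u)"
      unfolding K using assms True
      by (intro rdet_eliminate_mset) (auto simp: passage_row_def)
    also have "map (subst_col y (\<delta> x)) (?r # walk T u x) = (\<lambda>j. ?k * ?R j) # walk T u x"
      using assms o xy by (auto simp: id subst_col_def passage_row_def fun_eq_iff algebra_simps)
    finally show ?thesis
      by (intro bexI[of _ ?k]) auto
  next
    case False
    let ?k = "if left_to_right x then 1 else - \<alpha>"
    let ?r = "passage_row (Skein \<alpha> (1 - \<alpha>)) x (over_of x) x y"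
    have xy: "over_of x = y" "level y = Over" "level x = Under"
      using assms False by (auto simp: over_of_def intro: passage.expand)
    have "edge_det T (x # y # u) \<simeq> - 1 * rdet (map (subst_col y (\<delta> ?o)) (?r # walk T u x)) (x # u)"
      unfolding K using assms xy o
      by (intro rdet_eliminate_mset) (auto simp: passage_row_def)
    also have "map (subst_col y (\<delta> ?o)) (?r # walk T u x) = (\<lambda>j. ?k * ?R j) # walk T u x"
      using assms o xy by (auto simp: id subst_col_def passage_row_def fun_eq_iff algebra_simps)
    also have "- 1 * rdet \<dots> (x # u) \<simeq> rdet \<dots> (x # u)"
      by (simp add: eq_sign_def)
    finally show ?thesis
      by (intro bexI[of _ ?k]) auto
  qed
  then obtain k where k: "k \<in> {1, \<alpha>, - 1, - \<alpha>}" "edge_det T (x # y # u) \<simeq> k * rdet (?R # walk T u x) (x # u)"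
    by (metis length_walk rdet_scale_hd)
  from k(2) have "edge_det T (x # y # u) \<simeq> k * edge_det T u"
    using * eq_sign_mult eq_sign_trans by blast
  then show ?thesis
    using k(1) by (auto simp: eq_sign_def)
qed

lemma ring_s_pow_add: "ring_s_pow (a + b) = ring_s_pow a * ring_s_pow b"
  by transfer (simp add: laurent_s_pow_def mult_single equivp_reflp[OF equivp_knot_rel])

lemma ring_s_pow_0 [simp]: "ring_s_pow 0 = 1"
proof (transfer)
  have "laurent_s_pow 0 = 1"
    unfolding laurent_s_pow_def single_one[symmetric] by (simp add: zero_prod_def)
  then show "knot_rel (laurent_s_pow 0) 1"
    by (simp add: equivp_reflp[OF equivp_knot_rel])
qed

text \<open>The upper strand is not cut at the two crossings, so both underpasses see the same
  overpass edge. The lower strand crosses in opposite directions, and therefore the overpass terms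
  and the middle edge cancel between its two rows. For type 0 the factors \<open>s\<close> and its
  inverse cancel along each strand; setting \<open>\<alpha> = 1\<close> there lets one set of
  factors serve both cases.\<close>

lemma edge_det_bigon:
  assumes dist: "distinct (x1 # x2 # u @ y1 # y2 # v)"
    and lev: "level x1 = Over" "level x2 = Over" "level y1 = Under" "level y2 = Under"
    and c: "{crossing x1, crossing x2} = {crossing y1, crossing y2}" "crossing x1 \<noteq> crossing x2"
    and ltr: "left_to_right x1 \<noteq> left_to_right x2"
    and ov: "over_of y1 \<in> {x1, x2}" "over_of y2 \<in> {x1, x2}"
    and uv: "crossing x1 \<notin> crossings (u @ v)" "crossing x2 \<notin> crossings (u @ v)"
    and T: "T (crossing x1) = k" "T (crossing x2) = k"
    and k: "k = Shift \<and> \<alpha> = 1 \<or> k = Skein \<alpha> \<beta>" and \<alpha>: "\<alpha> * \<alpha>' = 1"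
  shows "\<exists>c\<in>{1, \<alpha>}. edge_det T (x1 # x2 # u @ y1 # y2 # v) \<simeq> c * edge_det T (u @ v)"
proof -
  let ?T = "T(crossing x1 := Through, crossing x2 := Through)"
  let ?ox = "hd (u @ [y1])" and ?oy = "hd (v @ [x1])"
  let ?U = "walk T u y1" and ?V = "walk T v x1"
  let ?K = "x1 # x2 # u @ y1 # y2 # v"
  let ?X1 = "passage_row k x1 (over_of x1) x1 x2" and ?X2 = "passage_row k x2 (over_of x2) x2 ?ox"
  let ?Y1 = "passage_row k y1 (over_of y1) y1 y2" and ?Y2 = "passage_row k y2 (over_of y2) y2 ?oy"
  let ?RX = "\<lambda>j. \<delta> ?ox j - \<delta> x1 j" and ?RY = "\<lambda>j. \<delta> ?oy j - \<delta> y1 j"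
  have Ty: "T (crossing y1) = k" "T (crossing y2) = k" "?T (crossing y1) = Through"
    using c T by (auto simp: doubleton_eq_iff)
  have cuv: "crossing z \<noteq> crossing x1" "crossing z \<noteq> crossing x2" if "z \<in> set u \<union> set v" for z
    using uv that by (metis image_eqI set_append)+
  have T': "walk ?T u y1 = ?U" "walk ?T v x1 = ?V"
    using cuv by (intro walk_cong; simp)+
  have "hd (u @ [y1]) \<in> set (u @ [y1])" "hd (v @ [x1]) \<in> set (v @ [x1])"
    by (rule hd_in_set; simp)+
  then have ne: "?ox \<noteq> x2" "?ox \<noteq> y2" "?oy \<noteq> x2" "?oy \<noteq> y2"
    using dist by auto
  have neq: "x2 \<noteq> x1" "x2 \<noteq> y1" "x2 \<noteq> y2" "y2 \<noteq> x1" "y2 \<noteq> y1" "x1 \<noteq> y1"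
    using dist by auto
  note [simp] = neq neq[symmetric]
  have ltr': "left_to_right y1 \<noteq> left_to_right y2"
    using ltr c ov by (auto simp: over_of_def doubleton_eq_iff)
  have cy: "crossing y2 \<in> {crossing x1, crossing x2}"
    using c by auto
  have 0: "r x2 = 0" "r y2 = 0" if "r \<in> set ?U \<union> set ?V" for r
  proof -
    have *: "over_of z \<noteq> x2 \<and> over_of z \<noteq> y2" if "z \<in> set u \<union> set v" for z
      using cuv[OF that] cy by (auto simp: over_of_def)
    then show "r x2 = 0"
      using that dist walk_eq_0[of x2 u y1 T r] walk_eq_0[of x2 v x1 T r] by auto
    show "r y2 = 0"
      using * that dist walk_eq_0[of y2 u y1 T r] walk_eq_0[of y2 v x1 T r] by auto
  qed
  have id: "map (subst_col c \<psi>) ?U = ?U" "map (subst_col c \<psi>) ?V = ?V" if "c \<in> {x2, y2}" for c \<psi>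
    using 0 that by (auto intro!: map_idI simp: subst_col_id)
  have K: "edge_det T ?K = rdet (?X1 # ?X2 # ?U @ ?Y1 # ?Y2 # ?V) ?K"
    using T Ty by (simp add: edge_det_def walk_append hd_append)
  have "edge_det T (u @ v) = edge_det ?T (u @ v)"
    using cuv by (intro edge_det_cong) simp
  also have "\<dots> \<simeq> edge_det ?T (u @ y1 # v)"
    using dist Ty(3) by (intro eq_sign_sym[OF edge_det_remove]) auto
  also have "\<dots> \<simeq> edge_det ?T (x1 # u @ y1 # v)"
    using dist by (intro eq_sign_sym[OF edge_det_remove_hd]) auto
  also have "\<dots> = rdet (?RX # ?U @ ?RY # ?V) (x1 # u @ y1 # v)"
    using Ty T' by (simp add: edge_det_def walk_append hd_append passage_row_def)
  also have "\<dots> \<simeq> rdet (?RX # ?RY # ?U @ ?V) (x1 # y1 # u @ v)"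
    by (intro rdet_permute) auto
  finally have red: "edge_det T (u @ v) \<simeq> rdet (?RX # ?RY # ?U @ ?V) (x1 # y1 # u @ v)" .
  have "\<exists>c\<in>{1, \<alpha>, - 1, - \<alpha>}. edge_det T ?K \<simeq> c * rdet (?RX # ?RY # ?U @ ?V) (x1 # y1 # u @ v)"
    using k
  proof (elim disjE conjE)
    assume k: "k = Shift"
    have s: "ring_s_pow (shift x2) * ring_s_pow (shift x1) = 1" "ring_s_pow (shift y2) * ring_s_pow (shift y1) = 1"
      using ltr ltr' by (auto simp: shift_def simp flip: ring_s_pow_add)
    have "rdet (?X1 # ?X2 # ?U @ ?Y1 # ?Y2 # ?V) ?K \<simeq>
        1 * rdet (map (subst_col x2 (\<lambda>j. ring_s_pow (shift x1) * \<delta> x1 j)) (?X2 # ?Y1 # ?Y2 # ?U @ ?V)) (x1 # u @ y1 # y2 # v)"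
      using dist lev k by (intro rdet_eliminate_mset) (auto simp: passage_row_def)
    also have "map (subst_col x2 (\<lambda>j. ring_s_pow (shift x1) * \<delta> x1 j)) (?X2 # ?Y1 # ?Y2 # ?U @ ?V) =
        ?RX # ?Y1 # ?Y2 # ?U @ ?V"
      using k ne s by (auto simp: id passage_row_def subst_col_def fun_eq_iff simp flip: mult.assoc)
    also have "1 * rdet \<dots> (x1 # u @ y1 # y2 # v) \<simeq>
        1 * rdet (map (subst_col y2 (\<lambda>j. ring_s_pow (shift y1) * \<delta> y1 j)) (?RX # ?Y2 # ?U @ ?V)) (x1 # y1 # u @ v)"
      unfolding mult_1 using dist lev k
      by (intro rdet_eliminate_mset[where u = 1, unfolded mult_1]) (auto simp: passage_row_def)
    also have "map (subst_col y2 (\<lambda>j. ring_s_pow (shift y1) * \<delta> y1 j)) (?RX # ?Y2 # ?U @ ?V) =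
        ?RX # ?RY # ?U @ ?V"
      using k ne s by (auto simp: id passage_row_def subst_col_def fun_eq_iff simp flip: mult.assoc)
    finally show ?thesis
      unfolding K by blast
  next
    assume k: "k = Skein \<alpha> \<beta>"
    \<comment> \<open>Overpass edges after \<open>x2\<close> has been identified with
      \<open>x1\<close>.\<close>
    define ov where "ov x = (if over_of x = x2 then x1 else over_of x)" for x
    have ovy: "ov y1 = x1" "ov y2 = x1"
      using ov by (auto simp: ov_def)
    let ?Y1' = "passage_row k y1 x1 y1 y2" and ?Y2' = "passage_row k y2 x1 y2 ?oy"
    have "rdet (?X1 # ?X2 # ?U @ ?Y1 # ?Y2 # ?V) ?K \<simeq>
        1 * rdet (map (subst_col x2 (\<delta> x1)) (?X2 # ?Y1 # ?Y2 # ?U @ ?V)) (x1 # u @ y1 # y2 # v)"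
      using dist lev k by (intro rdet_eliminate_mset) (auto simp: passage_row_def)
    also have "map (subst_col x2 (\<delta> x1)) (?X2 # ?Y1 # ?Y2 # ?U @ ?V) = ?RX # ?Y1' # ?Y2' # ?U @ ?V"
    proof -
      have "subst_col x2 (\<delta> x1) ?X2 = ?RX"
        using ne(1) lev(2) k by (simp add: subst_col_passage_row) (simp add: passage_row_def)
      moreover have "subst_col x2 (\<delta> x1) ?Y1 = ?Y1'" "subst_col x2 (\<delta> x1) ?Y2 = ?Y2'"
        using ovy ne(3) by (simp_all add: subst_col_passage_row flip: ov_def)
      ultimately show ?thesis
        by (simp add: id)
    qed
    finally have 1: "edge_det T ?K \<simeq> rdet (?RX # ?Y1' # ?Y2' # ?U @ ?V) (x1 # u @ y1 # y2 # v)"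
      unfolding K by simp
    show ?thesis
    proof (cases "left_to_right y1")
      case True
      \<comment> \<open>The middle edge \<open>y2\<close> has coefficient \<open>\<alpha>\<close> in
        the row of \<open>y1\<close>: solving for it needs the inverse and leaves the factor
        \<open>\<alpha>\<close>.\<close>
      let ?\<psi> = "\<lambda>j. \<alpha>' * (\<delta> y1 j - \<beta> * \<delta> x1 j)"
      have \<alpha>\<alpha>': "\<alpha> * (\<alpha>' * z) = z" for z
        using \<alpha> by (simp flip: mult.assoc)
      note 1
      also have "rdet (?RX # ?Y1' # ?Y2' # ?U @ ?V) (x1 # u @ y1 # y2 # v) \<simeq>
          \<alpha> * rdet (map (subst_col y2 ?\<psi>) (?RX # ?Y2' # ?U @ ?V)) (x1 # y1 # u @ v)"
        using dist lev k True
        by (intro rdet_eliminate_mset) (auto simp: passage_row_def right_diff_distrib \<alpha>\<alpha>')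
      also have "map (subst_col y2 ?\<psi>) (?RX # ?Y2' # ?U @ ?V) = ?RX # (\<lambda>j. - 1 * ?RY j) # ?U @ ?V"
        using lev(4) True k ne ltr' by (auto simp: id passage_row_def subst_col_def fun_eq_iff \<alpha>\<alpha>')
      also have "\<alpha> * rdet \<dots> (x1 # y1 # u @ v) \<simeq> \<alpha> * rdet ((\<lambda>j. - 1 * ?RY j) # ?RX # ?U @ ?V) (y1 # x1 # u @ v)"
        by (intro eq_sign_mult rdet_permute) auto
      also have "\<dots> = - \<alpha> * rdet (?RY # ?RX # ?U @ ?V) (y1 # x1 # u @ v)"
        by (subst rdet_scale_hd) auto
      also have "\<dots> \<simeq> - \<alpha> * rdet (?RX # ?RY # ?U @ ?V) (x1 # y1 # u @ v)"
        by (intro eq_sign_mult rdet_permute) auto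
      finally show ?thesis
        by blast
    next
      case False
      \<comment> \<open>Now \<open>y2\<close> has coefficient \<open>-1\<close> in the row of
        \<open>y1\<close>, and the factor \<open>\<alpha>\<close> comes from the row of
        \<open>y2\<close> after the substitution.\<close>
      let ?\<psi> = "\<lambda>j. \<beta> * \<delta> x1 j + \<alpha> * \<delta> y1 j"
      note 1
      also have "rdet (?RX # ?Y1' # ?Y2' # ?U @ ?V) (x1 # u @ y1 # y2 # v) \<simeq>
          - 1 * rdet (map (subst_col y2 ?\<psi>) (?RX # ?Y2' # ?U @ ?V)) (x1 # y1 # u @ v)"
        using dist lev k False
        by (intro rdet_eliminate_mset) (auto simp: passage_row_def)
      also have "map (subst_col y2 ?\<psi>) (?RX # ?Y2' # ?U @ ?V) = ?RX # (\<lambda>j. \<alpha> * ?RY j) # ?U @ ?V"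
        using lev(4) False k ne ltr' by (auto simp: id passage_row_def subst_col_def fun_eq_iff algebra_simps)
      also have "- 1 * rdet \<dots> (x1 # y1 # u @ v) \<simeq> - 1 * rdet ((\<lambda>j. \<alpha> * ?RY j) # ?RX # ?U @ ?V) (y1 # x1 # u @ v)"
        by (intro eq_sign_mult rdet_permute) auto
      also have "\<dots> = - \<alpha> * rdet (?RY # ?RX # ?U @ ?V) (y1 # x1 # u @ v)"
        by (subst rdet_scale_hd) auto
      also have "\<dots> \<simeq> - \<alpha> * rdet (?RX # ?RY # ?U @ ?V) (x1 # y1 # u @ v)"
        by (intro eq_sign_mult rdet_permute) auto
      finally show ?thesis
        by blast
    qed
  qed
  then obtain c where c: "c \<in> {1, \<alpha>, - 1, - \<alpha>}" "edge_det T ?K \<simeq> c * rdet (?RX # ?RY # ?U @ ?V) (x1 # y1 # u @ v)"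
    by blast
  from c(2) have "edge_det T ?K \<simeq> c * edge_det T (u @ v)"
    using eq_sign_mult[OF eq_sign_sym[OF red]] eq_sign_trans by blast
  then show ?thesis
    using c(1) by (auto simp: eq_sign_def)
qed

section \<open>Local computations for the third move\<close>

lemma subst_col_add: "subst_col c \<psi> (\<lambda>j. f j + g j) = (\<lambda>j. subst_col c \<psi> f j + subst_col c \<psi> g j)"
  by (auto simp: subst_col_def algebra_simps)

lemma subst_col_diff: "subst_col c \<psi> (\<lambda>j. f j - g j) = (\<lambda>j. subst_col c \<psi> f j - subst_col c \<psi> g j)"
  by (auto simp: subst_col_def algebra_simps)

lemma subst_col_scale: "subst_col c \<psi> (\<lambda>j. k * f j) = (\<lambda>j. k * subst_col c \<psi> f j)"
  by (auto simp: subst_col_def algebra_simps)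

lemma subst_col_unit: "\<psi> c = 0 \<Longrightarrow> subst_col c \<psi> (\<delta> a) = (if a = c then \<psi> else \<delta> a)"
  by (auto simp: subst_col_def unit_row_def)

lemmas subst_col_linear = subst_col_add subst_col_diff subst_col_scale subst_col_unit

lemma rdet_add_row_mset:
  assumes "length R = length C" "mset R = mset (r # r' # rs)" "\<And>c. r'' c = r' c + k * r c"
  shows "rdet R C \<simeq> rdet (r'' # r # rs) C"
proof -
  have len: "length C = length rs + 2"
    using assms(1) arg_cong[OF assms(2), of size] by simp
  then obtain c d cs where C: "C = c # d # cs" "length rs = length cs"
    by (auto simp: numeral_eq_Suc length_Suc_conv)
  have "rdet R C \<simeq> rdet (r # r' # rs) C"
    using assms(1,2) by (intro rdet_permute) auto
  also have "\<dots> = rdet (r # r'' # rs) C"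
    using rdet_add_row[of rs cs r r' k c d] C assms(3)[abs_def] by simp
  also have "\<dots> \<simeq> rdet (r'' # r # rs) C"
    using len by (intro rdet_permute) auto
  finally show ?thesis .
qed

text \<open>T, M, B are the top, middle and bottom strand, with edges numbered 0, 1, 2 in the sense
  in which the triangle is traversed; \<open>T1\<close>, \<open>M1\<close>, \<open>B1\<close> are
  its sides. The \<open>v\<close> and \<open>w\<close> are the overpass edges before and after the
  move; each has two candidates because the strand above may run either way. Once the sides are
  eliminated, one row per strand is left on both sides, and \<open>rel\<close> makes these rows
  agree up to row operations.\<close>

lemma rdet_triangle:
  fixes R :: "('e \<Rightarrow> knot_ring) list"
  assumes mids: "distinct [T1, M1, B1]" "{T1, M1, B1} \<inter> (set C \<union> {T0, T2, M0, M2, B0, B2}) = {}"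
    and len: "length C = length R + 3" and R: "\<And>r. r \<in> set R \<Longrightarrow> r T1 = 0 \<and> r M1 = 0 \<and> r B1 = 0"
    and v: "v3 \<in> {T1, T2}" "v2 \<in> {T0, T1}" "v1 \<in> {M1, M2}" "w3 \<in> {T0, T1}" "w2 \<in> {T1, T2}" "w1 \<in> {M0, M1}"
    and \<alpha>: "\<alpha>2 * \<alpha>2' = 1" and rel: "\<beta>1 * \<alpha>2 = \<beta>1 * \<alpha>3" "\<alpha>1 * \<beta>2 = \<beta>2 - \<beta>1 * \<beta>3"
  shows "rdet ([\<lambda>j. \<delta> T1 j - \<delta> T0 j, \<lambda>j. \<delta> T2 j - \<delta> T1 j,
            \<lambda>j. \<beta>3 * \<delta> v3 j + \<alpha>3 * \<delta> M0 j - \<delta> M1 j, \<lambda>j. \<delta> M2 j - \<delta> M1 j,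
            \<lambda>j. \<beta>1 * \<delta> v1 j + \<alpha>1 * \<delta> B0 j - \<delta> B1 j, \<lambda>j. \<beta>2 * \<delta> v2 j + \<alpha>2 * \<delta> B2 j - \<delta> B1 j] @ R)
            (T1 # M1 # B1 # C) \<simeq>
         rdet ([\<lambda>j. \<delta> T2 j - \<delta> T1 j, \<lambda>j. \<delta> T1 j - \<delta> T0 j,
            \<lambda>j. \<beta>3 * \<delta> w3 j + \<alpha>3 * \<delta> M1 j - \<delta> M2 j, \<lambda>j. \<delta> M1 j - \<delta> M0 j,
            \<lambda>j. \<beta>1 * \<delta> w1 j + \<alpha>1 * \<delta> B1 j - \<delta> B2 j, \<lambda>j. \<beta>2 * \<delta> w2 j + \<alpha>2 * \<delta> B1 j - \<delta> B0 j] @ R)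
            (T1 # M1 # B1 # C)"
  (is "rdet ([?t1, ?t2, ?m1, ?m2, ?b1, ?b2] @ R) ?C \<simeq> rdet ([?t1', ?t2', ?m1', ?m2', ?b1', ?b2'] @ R) ?C")
proof -
  let ?f = "\<lambda>a. if a = T1 then \<delta> T0 else \<delta> a"
  \<comment> \<open>What remains of the top strand: its two outer edges are equal.\<close>
  let ?t = "\<lambda>j. \<delta> T2 j - \<delta> T0 j"
  have neq: "T0 \<noteq> T1" "T2 \<noteq> T1" "M0 \<noteq> M1" "M2 \<noteq> M1" "B0 \<noteq> B1" "B2 \<noteq> B1"
      "T0 \<noteq> M1" "T2 \<noteq> M1" "T0 \<noteq> B1" "T2 \<noteq> B1" "M0 \<noteq> T1" "M2 \<noteq> T1" "M0 \<noteq> B1" "M2 \<noteq> B1"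
      "B0 \<noteq> T1" "B2 \<noteq> T1" "B0 \<noteq> M1" "B2 \<noteq> M1"
      "T1 \<noteq> M1" "T1 \<noteq> B1" "M1 \<noteq> B1"
    using mids by auto
  note neq = neq neq[symmetric]
  have vs: "?f v2 = \<delta> T0" "?f w3 = \<delta> T0" "v1 \<noteq> T1" "w1 \<noteq> T1" "v3 \<noteq> M1" "v3 \<noteq> B1" "w2 \<noteq> M1" "w2 \<noteq> B1" "B1 \<noteq> w2"
      "(if v1 = M1 then \<delta> M2 else \<delta> v1) = \<delta> M2" "(if w1 = M1 then \<delta> M0 else \<delta> w1) = \<delta> M0"
    using v neq by auto
  have \<alpha>\<alpha>: "\<alpha>2 * (\<alpha>2' * z) = z" for z
    using \<alpha> by (simp flip: mult.assoc)
  have R': "map (subst_col c \<psi>) R = R" if "c \<in> {T1, M1, B1}" for c \<psi>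
    using R that by (auto intro!: map_idI simp: subst_col_id)
  have "rdet ([?t1, ?t2, ?m1, ?m2, ?b1, ?b2] @ R) ?C \<simeq>
      1 * rdet (map (subst_col T1 (\<delta> T0)) ([?t2, ?m1, ?m2, ?b1, ?b2] @ R)) (M1 # B1 # C)"
    using mids len by (intro rdet_eliminate_mset) (simp_all add: neq)
  also have "map (subst_col T1 (\<delta> T0)) ([?t2, ?m1, ?m2, ?b1, ?b2] @ R) = 
      [?t, \<lambda>j. \<beta>3 * ?f v3 j + \<alpha>3 * \<delta> M0 j - \<delta> M1 j, ?m2, ?b1, \<lambda>j. \<beta>2 * \<delta> T0 j + \<alpha>2 * \<delta> B2 j - \<delta> B1 j] @ R"
    (is "_ = [_, ?m1a, _, _, ?b2a] @ R")
    by (simp add: R' subst_col_linear neq vs)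
  also have "1 * rdet \<dots> (M1 # B1 # C) \<simeq> - 1 * rdet (map (subst_col M1 (\<delta> M2)) ([?t, ?m1a, ?b1, ?b2a] @ R)) (B1 # C)"
    unfolding mult_1 using mids len by (intro rdet_eliminate_mset) (simp_all add: neq)
  also have "map (subst_col M1 (\<delta> M2)) ([?t, ?m1a, ?b1, ?b2a] @ R) =
      [?t, \<lambda>j. \<beta>3 * ?f v3 j + \<alpha>3 * \<delta> M0 j - \<delta> M2 j, \<lambda>j. \<beta>1 * \<delta> M2 j + \<alpha>1 * \<delta> B0 j - \<delta> B1 j, ?b2a] @ R"
    (is "_ = [_, ?m1b, ?b1b, _] @ R")
    by (simp add: R' subst_col_linear neq vs)
  also have "- 1 * rdet \<dots> (B1 # C) \<simeq> rdet \<dots> (B1 # C)"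
    by (simp add: eq_sign_def)
  also have "\<dots> \<simeq> - 1 * rdet (map (subst_col B1 (\<lambda>j. \<beta>2 * \<delta> T0 j + \<alpha>2 * \<delta> B2 j)) ([?t, ?m1b, ?b1b] @ R)) C"
    using mids len by (intro rdet_eliminate_mset) (simp_all add: neq)
  also have "map (subst_col B1 (\<lambda>j. \<beta>2 * \<delta> T0 j + \<alpha>2 * \<delta> B2 j)) ([?t, ?m1b, ?b1b] @ R) =
      [?t, ?m1b, \<lambda>j. \<beta>1 * \<delta> M2 j + \<alpha>1 * \<delta> B0 j - (\<beta>2 * \<delta> T0 j + \<alpha>2 * \<delta> B2 j)] @ R"
    (is "_ = [_, _, ?b1c] @ R")
    by (simp add: R' subst_col_linear neq vs)
  also have "- 1 * rdet \<dots> C \<simeq> rdet \<dots> C"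
    by (simp add: eq_sign_def)
  finally have before: "rdet ([?t1, ?t2, ?m1, ?m2, ?b1, ?b2] @ R) ?C \<simeq> rdet ([?t, ?m1b, ?b1c] @ R) C" .

  have "rdet ([?t1', ?t2', ?m1', ?m2', ?b1', ?b2'] @ R) ?C \<simeq>
      1 * rdet (map (subst_col T1 (\<delta> T0)) ([?t1', ?m1', ?m2', ?b1', ?b2'] @ R)) (M1 # B1 # C)"
    using mids len by (intro rdet_eliminate_mset) (simp_all add: neq)
  also have "map (subst_col T1 (\<delta> T0)) ([?t1', ?m1', ?m2', ?b1', ?b2'] @ R) = 
      [?t, \<lambda>j. \<beta>3 * \<delta> T0 j + \<alpha>3 * \<delta> M1 j - \<delta> M2 j, ?m2', ?b1', \<lambda>j. \<beta>2 * ?f w2 j + \<alpha>2 * \<delta> B1 j - \<delta> B0 j] @ R"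
    (is "_ = [_, ?m1c, _, _, ?b2c] @ R")
    by (simp add: R' subst_col_linear neq vs)
  also have "1 * rdet \<dots> (M1 # B1 # C) \<simeq> 1 * rdet (map (subst_col M1 (\<delta> M0)) ([?t, ?m1c, ?b1', ?b2c] @ R)) (B1 # C)"
    unfolding mult_1 using mids len by (intro rdet_eliminate_mset[where u = 1, unfolded mult_1]) (simp_all add: neq)
  also have "map (subst_col M1 (\<delta> M0)) ([?t, ?m1c, ?b1', ?b2c] @ R) =
      [?t, \<lambda>j. \<beta>3 * \<delta> T0 j + \<alpha>3 * \<delta> M0 j - \<delta> M2 j, \<lambda>j. \<beta>1 * \<delta> M0 j + \<alpha>1 * \<delta> B1 j - \<delta> B2 j, ?b2c] @ R"
    (is "_ = [_, ?m1d, ?b1d, _] @ R")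
    by (simp add: R' subst_col_linear neq vs)
  \<comment> \<open>Here \<open>B1\<close> has coefficient \<open>\<alpha>2\<close> in the row that
    is solved for it, hence the inverse and the factor \<open>\<alpha>2\<close>.\<close>
  also have "1 * rdet \<dots> (B1 # C) \<simeq> \<alpha>2 * rdet (map (subst_col B1 (\<lambda>j. \<alpha>2' * (\<delta> B0 j - \<beta>2 * ?f w2 j))) ([?t, ?m1d, ?b1d] @ R)) C"
    unfolding mult_1 using mids len \<alpha>
    by (intro rdet_eliminate_mset) (auto simp: neq vs algebra_simps \<alpha>\<alpha>)
  also have "map (subst_col B1 (\<lambda>j. \<alpha>2' * (\<delta> B0 j - \<beta>2 * ?f w2 j))) ([?t, ?m1d, ?b1d] @ R) =
      [?t, ?m1d, \<lambda>j. \<beta>1 * \<delta> M0 j + \<alpha>1 * (\<alpha>2' * (\<delta> B0 j - \<beta>2 * ?f w2 j)) - \<delta> B2 j] @ R"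
    (is "_ = [_, _, ?b1e] @ R")
    by (simp add: R' subst_col_linear neq vs)
  finally have after: "rdet ([?t1', ?t2', ?m1', ?m2', ?b1', ?b2'] @ R) ?C \<simeq> \<alpha>2 * rdet ([?t, ?m1d, ?b1e] @ R) C" .

  \<comment> \<open>\<open>m\<close> and \<open>b\<close> are the common normal form of the middle
    and the bottom row, with the overpass edge of the top strand always written as
    \<open>T0\<close>.\<close>
  define m where "m = (\<lambda>j. \<beta>3 * \<delta> T0 j + \<alpha>3 * \<delta> M0 j - \<delta> M2 j)"
  define b where "b = (\<lambda>j. \<beta>1 * \<alpha>3 * \<delta> M0 j + \<alpha>1 * \<delta> B0 j - \<alpha>1 * \<beta>2 * \<delta> T0 j - \<alpha>2 * \<delta> B2 j)"
  \<comment> \<open>Multiples of \<open>?t\<close> that turn \<open>T2\<close> into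
    \<open>T0\<close>. If the overpass edge was \<open>T1\<close>, it has already become
    \<open>T0\<close>.\<close>
  define y3 where "y3 = (if v3 = T1 then 0 else - \<beta>3)"
  define y2 where "y2 = (if w2 = T1 then 0 else \<alpha>1 * \<beta>2)"
  have r1: "\<alpha>2 * (\<beta>1 * z) = \<alpha>3 * (\<beta>1 * z)" for z
    using rel(1) by (metis mult.assoc mult.commute)
  have r2: "\<alpha>1 * (\<beta>2 * z) = \<beta>2 * z - \<beta>1 * (\<beta>3 * z)" for z
    by (simp only: left_diff_distrib rel(2) flip: mult.assoc)
  have "rdet ([?t, ?m1b, ?b1c] @ R) C \<simeq> rdet (m # ?t # ?b1c # R) C"
    using len v(1) by (intro rdet_add_row_mset[where k = y3]) (auto simp: m_def y3_def algebra_simps)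
  \<comment> \<open>Adding \<open>\<beta>1\<close> times \<open>m\<close> cancels \<open>M2\<close>.
    The coefficient of \<open>T0\<close> becomes \<open>\<beta>1 \<beta>3 - \<beta>2\<close>, which
    the second relation turns into \<open>- \<alpha>1 \<beta>2\<close>.\<close>
  also have "\<dots> \<simeq> rdet (b # m # ?t # R) C"
    using len by (intro rdet_add_row_mset[where k = \<beta>1]) (auto simp: b_def m_def algebra_simps r2)
  also have "\<dots> \<simeq> rdet (b # ?t # m # R) C"
    using len by (intro rdet_permute) auto
  finally have 1: "rdet ([?t, ?m1b, ?b1c] @ R) C \<simeq> rdet (b # ?t # m # R) C" .
  obtain c C' where C: "C = c # C'" "length C' = length R + 2"
    using len by (cases C) auto
  have "\<alpha>2 * rdet ([?t, ?m1d, ?b1e] @ R) C \<simeq> \<alpha>2 * rdet (?b1e # ?t # m # R) C"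
    using len by (intro eq_sign_mult rdet_permute) (auto simp: m_def)
  also have "\<dots> = rdet ((\<lambda>j. \<alpha>2 * ?b1e j) # ?t # m # R) C"
    using C by (simp add: rdet_scale_hd)
  \<comment> \<open>After scaling, \<open>M0\<close> has coefficient
    \<open>\<alpha>2 \<beta>1\<close>; the first relation makes it
    \<open>\<alpha>3 \<beta>1\<close>, as in \<open>b\<close>.\<close>
  also have "\<dots> \<simeq> rdet (b # ?t # m # R) C"
    using len v(5) by (intro rdet_add_row_mset[where k = y2]) (auto simp: b_def y2_def algebra_simps \<alpha>\<alpha> r1)
  finally have 2: "\<alpha>2 * rdet ([?t, ?m1d, ?b1e] @ R) C \<simeq> rdet (b # ?t # m # R) C" .
  show ?thesis
    using eq_sign_trans[OF eq_sign_trans[OF before 1] eq_sign_sym[OF eq_sign_trans[OF after 2]]] .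
qed

lemma rdet_scale_append:
  assumes "length ks = length rs" "length rs + length R = length C"
  shows "rdet (map2 (\<lambda>k r c. k * r c) ks rs @ R) C = prod_list ks * rdet (rs @ R) C"
proof -
  have "map2 (\<lambda>k r c. k * r c) (replicate (length R) 1) R = R"
    by (intro nth_equalityI) auto
  then show ?thesis
    using rdet_scale[of "rs @ R" C "ks @ replicate (length R) 1"] assms by simp
qed

text \<open>The strand O meets N and V at crossings of type 0, and N meets V at a cut crossing with
  rows \<open>?f\<close> and \<open>?g\<close>. Pushing O across that crossing multiplies all four
  labels there by the same power of \<open>s\<close>, so both rows are scaled by
  \<open>\<sigma>\<close>. Solving for the sides gives \<open>- \<sigma>\<close> before and
  \<open>- \<sigma>'\<close> after the move, and
  \<open>- \<sigma>' \<sigma> \<sigma> = - \<sigma>\<close>. Only linearity of the two rows matters,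
  hence the arbitrary coefficients.\<close>

lemma rdet_shift_strand:
  fixes R :: "('e \<Rightarrow> knot_ring) list"
  assumes mids: "distinct [O1, N1, V1]" "{O1, N1, V1} \<inter> (set C \<union> {O0, O2, N0, N2, V0, V2}) = {}"
    and len: "length C = length R + 3" and R: "\<And>r. r \<in> set R \<Longrightarrow> r O1 = 0 \<and> r N1 = 0 \<and> r V1 = 0"
    and \<sigma>: "\<sigma> * \<sigma>' = 1"
  shows "rdet ([\<lambda>j. \<delta> O1 j - \<rho> * \<delta> O0 j, \<lambda>j. \<delta> O2 j - \<rho>' * \<delta> O1 j,
            \<lambda>j. \<delta> N1 j - \<sigma>' * \<delta> N0 j, \<lambda>j. \<delta> V2 j - \<sigma> * \<delta> V1 j,
            \<lambda>j. a1 * \<delta> N1 j + a2 * \<delta> N2 j + a3 * \<delta> V0 j + a4 * \<delta> V1 j,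
            \<lambda>j. c1 * \<delta> N1 j + c2 * \<delta> N2 j + c3 * \<delta> V0 j + c4 * \<delta> V1 j] @ R)
            (O1 # N1 # V1 # C) \<simeq>
         rdet ([\<lambda>j. \<delta> O2 j - \<rho> * \<delta> O1 j, \<lambda>j. \<delta> O1 j - \<rho>' * \<delta> O0 j,
            \<lambda>j. \<delta> N2 j - \<sigma>' * \<delta> N1 j, \<lambda>j. \<delta> V1 j - \<sigma> * \<delta> V0 j,
            \<lambda>j. a1 * \<delta> N0 j + a2 * \<delta> N1 j + a3 * \<delta> V1 j + a4 * \<delta> V2 j,
            \<lambda>j. c1 * \<delta> N0 j + c2 * \<delta> N1 j + c3 * \<delta> V1 j + c4 * \<delta> V2 j] @ R)
            (O1 # N1 # V1 # C)"
  (is "rdet ([?o1, ?o2, ?n, ?v, ?f, ?g] @ R) ?C \<simeq> rdet ([?o1', ?o2', ?n', ?v', ?f', ?g'] @ R) ?C")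
proof -
  let ?o = "\<lambda>j. \<delta> O2 j - \<rho>' * (\<rho> * \<delta> O0 j)"
  let ?F = "\<lambda>j. a1 * (\<sigma>' * \<delta> N0 j) + a2 * \<delta> N2 j + a3 * \<delta> V0 j + a4 * (\<sigma>' * \<delta> V2 j)"
  let ?G = "\<lambda>j. c1 * (\<sigma>' * \<delta> N0 j) + c2 * \<delta> N2 j + c3 * \<delta> V0 j + c4 * (\<sigma>' * \<delta> V2 j)"
  have neq: "O0 \<noteq> O1" "O2 \<noteq> O1" "N0 \<noteq> N1" "N2 \<noteq> N1" "V0 \<noteq> V1" "V2 \<noteq> V1"
      "O0 \<noteq> N1" "O2 \<noteq> N1" "O0 \<noteq> V1" "O2 \<noteq> V1" "N0 \<noteq> O1" "N2 \<noteq> O1" "N0 \<noteq> V1" "N2 \<noteq> V1"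
      "V0 \<noteq> O1" "V2 \<noteq> O1" "V0 \<noteq> N1" "V2 \<noteq> N1" "O1 \<noteq> N1" "O1 \<noteq> V1" "N1 \<noteq> V1"
    using mids by auto
  note neq = neq neq[symmetric]
  have R': "map (subst_col c \<psi>) R = R" if "c \<in> {O1, N1, V1}" for c \<psi>
    using R that by (auto intro!: map_idI simp: subst_col_id)
  have \<sigma>\<sigma>: "\<sigma> * (\<sigma>' * z) = z" "\<sigma>' * (\<sigma> * z) = z" for z
    using \<sigma> by (simp_all add: mult.commute flip: mult.assoc)
  have "rdet ([?o1, ?o2, ?n, ?v, ?f, ?g] @ R) ?C \<simeq>
      1 * rdet (map (subst_col O1 (\<lambda>j. \<rho> * \<delta> O0 j)) ([?o2, ?n, ?v, ?f, ?g] @ R)) (N1 # V1 # C)"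
    using mids len by (intro rdet_eliminate_mset) (simp_all add: neq)
  also have "map (subst_col O1 (\<lambda>j. \<rho> * \<delta> O0 j)) ([?o2, ?n, ?v, ?f, ?g] @ R) = [?o, ?n, ?v, ?f, ?g] @ R"
    by (simp add: R' subst_col_linear neq)
  also have "1 * rdet \<dots> (N1 # V1 # C) \<simeq>
      1 * rdet (map (subst_col N1 (\<lambda>j. \<sigma>' * \<delta> N0 j)) ([?o, ?v, ?f, ?g] @ R)) (V1 # C)"
    unfolding mult_1 using mids len
    by (intro rdet_eliminate_mset[where u = 1, unfolded mult_1]) (simp_all add: neq)
  also have "map (subst_col N1 (\<lambda>j. \<sigma>' * \<delta> N0 j)) ([?o, ?v, ?f, ?g] @ R) = [?o, ?v,
      \<lambda>j. a1 * (\<sigma>' * \<delta> N0 j) + a2 * \<delta> N2 j + a3 * \<delta> V0 j + a4 * \<delta> V1 j,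
      \<lambda>j. c1 * (\<sigma>' * \<delta> N0 j) + c2 * \<delta> N2 j + c3 * \<delta> V0 j + c4 * \<delta> V1 j] @ R"
    (is "_ = [_, _, ?f1, ?g1] @ R")
    by (simp add: R' subst_col_linear neq)
  also have "1 * rdet \<dots> (V1 # C) \<simeq>
      - \<sigma> * rdet (map (subst_col V1 (\<lambda>j. \<sigma>' * \<delta> V2 j)) ([?o, ?f1, ?g1] @ R)) C"
    unfolding mult_1 using mids len
    by (intro rdet_eliminate_mset) (auto simp: neq algebra_simps \<sigma>\<sigma>)
  also have "map (subst_col V1 (\<lambda>j. \<sigma>' * \<delta> V2 j)) ([?o, ?f1, ?g1] @ R) = [?o, ?F, ?G] @ R"
    by (simp add: R' subst_col_linear neq)
  finally have before: "rdet ([?o1, ?o2, ?n, ?v, ?f, ?g] @ R) ?C \<simeq> - \<sigma> * rdet ([?o, ?F, ?G] @ R) C" .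

  have "rdet ([?o1', ?o2', ?n', ?v', ?f', ?g'] @ R) ?C \<simeq>
      1 * rdet (map (subst_col O1 (\<lambda>j. \<rho>' * \<delta> O0 j)) ([?o1', ?n', ?v', ?f', ?g'] @ R)) (N1 # V1 # C)"
    using mids len by (intro rdet_eliminate_mset) (simp_all add: neq)
  also have "map (subst_col O1 (\<lambda>j. \<rho>' * \<delta> O0 j)) ([?o1', ?n', ?v', ?f', ?g'] @ R) = [?o, ?n', ?v', ?f', ?g'] @ R"
    by (simp add: R' subst_col_linear neq mult.left_commute)
  also have "1 * rdet \<dots> (N1 # V1 # C) \<simeq>
      - \<sigma>' * rdet (map (subst_col N1 (\<lambda>j. \<sigma> * \<delta> N2 j)) ([?o, ?v', ?f', ?g'] @ R)) (V1 # C)"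
    unfolding mult_1 using mids len
    by (intro rdet_eliminate_mset) (auto simp: neq algebra_simps \<sigma>\<sigma>)
  also have "map (subst_col N1 (\<lambda>j. \<sigma> * \<delta> N2 j)) ([?o, ?v', ?f', ?g'] @ R) = [?o, ?v',
      \<lambda>j. a1 * \<delta> N0 j + a2 * (\<sigma> * \<delta> N2 j) + a3 * \<delta> V1 j + a4 * \<delta> V2 j,
      \<lambda>j. c1 * \<delta> N0 j + c2 * (\<sigma> * \<delta> N2 j) + c3 * \<delta> V1 j + c4 * \<delta> V2 j] @ R"
    (is "_ = [_, _, ?f2, ?g2] @ R")
    by (simp add: R' subst_col_linear neq)
  also have "- \<sigma>' * rdet \<dots> (V1 # C) \<simeq>
      - \<sigma>' * (1 * rdet (map (subst_col V1 (\<lambda>j. \<sigma> * \<delta> V0 j)) ([?o, ?f2, ?g2] @ R)) C)"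
    using mids len by (intro eq_sign_mult rdet_eliminate_mset) (simp_all add: neq)
  also have "map (subst_col V1 (\<lambda>j. \<sigma> * \<delta> V0 j)) ([?o, ?f2, ?g2] @ R) =
      map2 (\<lambda>k r c. k * r c) [1, \<sigma>, \<sigma>] [?o, ?F, ?G] @ R"
    by (simp add: R' subst_col_linear neq) (auto simp: fun_eq_iff algebra_simps \<sigma>\<sigma>)
  also have "1 * rdet \<dots> C = \<sigma> * \<sigma> * rdet ([?o, ?F, ?G] @ R) C"
    using len by (subst rdet_scale_append) auto
  also have "- \<sigma>' * \<dots> = - \<sigma> * rdet ([?o, ?F, ?G] @ R) C"
    by (simp add: \<sigma>\<sigma> mult.assoc)
  finally show ?thesis
    using before eq_sign_sym eq_sign_trans by blast
qed

lemma rdet_scale6: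
  assumes "length C = length R + 6"
  shows "rdet ([\<lambda>j. k1 * r1 j, \<lambda>j. k2 * r2 j, \<lambda>j. k3 * r3 j, \<lambda>j. k4 * r4 j, \<lambda>j. k5 * r5 j, \<lambda>j. k6 * r6 j] @ R) C =
    prod_list [k1, k2, k3, k4, k5, k6] * rdet ([r1, r2, r3, r4, r5, r6] @ R) C"
  using rdet_scale_append[of "[k1, k2, k3, k4, k5, k6]" "[r1, r2, r3, r4, r5, r6]" R C] assms by simp

text \<open>The row of a passage whose strand runs from \<open>a\<close> to \<open>c\<close> if \<open>b\<close> holds, and from \<open>c\<close> to \<open>a\<close> otherwise.\<close>

definition directed_row :: "bool \<Rightarrow> kind \<Rightarrow> passage \<Rightarrow> 'e \<Rightarrow> 'e \<Rightarrow> 'e \<Rightarrow> 'e \<Rightarrow> knot_ring" where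
  "directed_row b k x v a c = passage_row k x v (if b then a else c) (if b then c else a)"

lemma directed_row_over:
  "level x = Over \<Longrightarrow> directed_row b (Skein \<alpha> \<beta>) x v a c = (\<lambda>j. (if b then 1 else - 1) * (\<delta> c j - \<delta> a j))"
  by (auto simp: directed_row_def passage_row_def)

lemma directed_row_shift:
  "directed_row b Shift x v a c = (\<lambda>j. (if b then 1 else - ring_s_pow (shift x)) *
     (\<delta> c j - ring_s_pow (if left_to_right x = b then 1 else - 1) * \<delta> a j))"
proof -
  have "ring_s_pow (shift x) * (ring_s_pow (- shift x) * z) = z" for z
    by (simp flip: mult.assoc ring_s_pow_add)
  then show ?thesis
    by (auto simp: directed_row_def passage_row_def shift_def fun_eq_iff right_diff_distrib)
qed

lemma directed_row_under:
  "level x = Under \<Longrightarrow> directed_row b (Skein \<alpha> \<beta>) x v a c =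
     (\<lambda>j. \<beta> * \<delta> v j + (if left_to_right x = b then \<alpha> * \<delta> c j - \<delta> a j else \<alpha> * \<delta> a j - \<delta> c j))"
  by (auto simp: directed_row_def passage_row_def)

text \<open>Crossing in the other direction exchanges the two under-branches. Dividing by
  \<open>- \<alpha>\<close> restores the coefficient \<open>-1\<close> on the edge reached next and
  replaces \<open>(\<alpha>, \<beta>)\<close> by \<open>(\<alpha>', - \<beta> \<alpha>')\<close>,
  the labels of an inverted crossing.\<close>

lemma directed_row_under_next:
  assumes "level x = Under" "h \<longleftrightarrow> left_to_right x \<noteq> b" "\<alpha> * \<alpha>' = 1"
  shows "directed_row b (Skein \<alpha> \<beta>) x v a c = (\<lambda>j. (if h then 1 else - \<alpha>) *
    ((if h then \<beta> else - \<beta> * \<alpha>') * \<delta> v j + (if h then \<alpha> else \<alpha>') * \<delta> a j - \<delta> c j))"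
proof -
  have "\<alpha> * (\<alpha>' * z) = z" "\<alpha> * (\<beta> * (\<alpha>' * z)) = \<beta> * z" for z
    using assms(3) by (metis mult.assoc mult.commute mult_1)+
  then show ?thesis
    using assms(1,2) by (auto simp: directed_row_under fun_eq_iff right_diff_distrib distrib_left mult.assoc)
qed

lemma directed_row_under_prev:
  assumes "level x = Under" "h \<longleftrightarrow> left_to_right x = b" "\<alpha> * \<alpha>' = 1"
  shows "directed_row b (Skein \<alpha> \<beta>) x v a c = (\<lambda>j. (if h then 1 else - \<alpha>) *
    ((if h then \<beta> else - \<beta> * \<alpha>') * \<delta> v j + (if h then \<alpha> else \<alpha>') * \<delta> c j - \<delta> a j))"
proof -
  have "\<alpha> * (\<alpha>' * z) = z" "\<alpha> * (\<beta> * (\<alpha>' * z)) = \<beta> * z" for z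
    using assms(3) by (metis mult.assoc mult.commute mult_1)+
  then show ?thesis
    using assms(1,2) by (auto simp: directed_row_under fun_eq_iff right_diff_distrib distrib_left mult.assoc)
qed

text \<open>Supplies the unspecified coefficients of the rows at the cut crossing when the other two
  crossings have type 0; an overpass has no third term.\<close>

lemma directed_row_coeffs:
  obtains p q r where "\<And>v a c :: 'e. directed_row b (Skein \<alpha> \<beta>) x v a c = (\<lambda>j. r * \<delta> v j + p * \<delta> a j + q * \<delta> c j)"
    and "level x \<noteq> Under \<Longrightarrow> r = 0"
proof -
  let ?i = "if level x = Under \<and> \<not> left_to_right x then \<alpha> else - 1"
  let ?o = "if level x = Under then if left_to_right x then \<alpha> else - 1 else 1"
  show thesis
    by (rule that[of "if level x = Under then \<beta> else 0" "if b then ?i else ?o" "if b then ?o else ?i"])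
      (auto simp: directed_row_def passage_row_def fun_eq_iff)
qed

text \<open>\<open>hT\<close> and \<open>hM\<close> say whether the triangle lies to the left of the
  oriented top and middle strand. Both crossings under the top strand see the same side of it, so
  they are inverted together. The conditions \<open>rel\<close> survive the replacement of
  \<open>(\<alpha>, \<beta>)\<close> by \<open>(\<alpha>', - \<beta> \<alpha>')\<close> at crossing
  1 and, jointly, at crossings 2 and 3, which reduces all orientations to a single one.\<close>

lemma rdet_directed_triangle:
  fixes R :: "('e \<Rightarrow> knot_ring) list"
  assumes mids: "distinct [T1, M1, B1]" "{T1, M1, B1} \<inter> (set C \<union> {T0, T2, M0, M2, B0, B2}) = {}"
    and len: "length C = length R + 3" and R: "\<And>r. r \<in> set R \<Longrightarrow> r T1 = 0 \<and> r M1 = 0 \<and> r B1 = 0"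
    and lev: "level ts = Over" "level te = Over" "level ms = Under" "level me = Over" "level bs = Under" "level be = Under"
    and ltr: "hT \<longleftrightarrow> left_to_right ms \<noteq> bM" "hM \<longleftrightarrow> left_to_right bs \<noteq> bB" "hT \<longleftrightarrow> left_to_right be = bB"
    and v: "v3 \<in> {T1, T2}" "v2 \<in> {T0, T1}" "v1 \<in> {M1, M2}" "w3 \<in> {T0, T1}" "w2 \<in> {T1, T2}" "w1 \<in> {M0, M1}"
    and k: "k1 = Skein \<alpha>1 \<beta>1" "k2 = Skein \<alpha>2 \<beta>2" "k3 = Skein \<alpha>3 \<beta>3"
    and \<alpha>: "\<alpha>1 * \<alpha>1' = 1" "\<alpha>2 * \<alpha>2' = 1" "\<alpha>3 * \<alpha>3' = 1"
    and rel: "\<beta>1 * \<alpha>2 = \<beta>1 * \<alpha>3" "\<alpha>1 * \<beta>2 = \<beta>2 - \<beta>1 * \<beta>3"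
  shows "rdet ([directed_row bT k2 ts vts T0 T1, directed_row bT k3 te vte T1 T2,
            directed_row bM k3 ms v3 M0 M1, directed_row bM k1 me vme M1 M2,
            directed_row bB k1 bs v1 B0 B1, directed_row bB k2 be v2 B1 B2] @ R) (T1 # M1 # B1 # C) \<simeq>
         rdet ([directed_row bT k2 ts wts T1 T2, directed_row bT k3 te wte T0 T1,
            directed_row bM k3 ms w3 M1 M2, directed_row bM k1 me wme M0 M1,
            directed_row bB k1 bs w1 B1 B2, directed_row bB k2 be w2 B0 B1] @ R) (T1 # M1 # B1 # C)"
proof -
  define a1 b1 where "a1 = (if hM then \<alpha>1 else \<alpha>1')" and "b1 = (if hM then \<beta>1 else - \<beta>1 * \<alpha>1')"
  define a2 b2 where "a2 = (if hT then \<alpha>2 else \<alpha>2')" and "b2 = (if hT then \<beta>2 else - \<beta>2 * \<alpha>2')"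
  define a3 b3 where "a3 = (if hT then \<alpha>3 else \<alpha>3')" and "b3 = (if hT then \<beta>3 else - \<beta>3 * \<alpha>3')"
  define a2' where "a2' = (if hT then \<alpha>2' else \<alpha>2)"
  define g where "g b = (if b then 1 else - 1 :: knot_ring)" for b
  define f where "f h \<alpha> = (if h then 1 else - \<alpha> :: knot_ring)" for h \<alpha>
  let ?ks = "[g bT, g bT, f hT \<alpha>3, g bM, f hM \<alpha>1, f hT \<alpha>2]"
  have a2: "a2 * a2' = 1"
    using \<alpha>(2) by (simp add: a2_def a2'_def mult.commute)
  \<comment> \<open>The first relation for the inverses, obtained by multiplying it by both of them;
    nothing is cancelled.\<close>
  have c: "\<beta>1 * \<alpha>2' = \<beta>1 * \<alpha>3'"
  proof -
    have "\<beta>1 * \<alpha>2' = (\<beta>1 * \<alpha>3) * \<alpha>3' * \<alpha>2'"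
      using \<alpha>(3) by (simp add: mult.assoc)
    also have "\<dots> = (\<beta>1 * \<alpha>2) * \<alpha>3' * \<alpha>2'"
      by (simp only: rel(1))
    also have "\<dots> = \<beta>1 * \<alpha>3' * (\<alpha>2 * \<alpha>2')"
      by (simp only: mult_ac)
    finally show ?thesis
      using \<alpha>(2) by simp
  qed
  have rel1: "b1 * a2 = b1 * a3"
  proof -
    have *: "\<beta>1 * a2 = \<beta>1 * a3"
      using rel(1) c by (simp add: a2_def a3_def)
    then have "\<alpha>1' * (\<beta>1 * a2) = \<alpha>1' * (\<beta>1 * a3)"
      by simp
    then show ?thesis
      using * by (simp add: b1_def mult_ac)
  qed
  have rel': "\<alpha>1 * b2 = b2 - \<beta>1 * b3"
  proof (cases hT)
    case False
    have "\<alpha>1 * (- \<beta>2 * \<alpha>2') = - (\<alpha>1 * \<beta>2) * \<alpha>2'"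
      by (simp add: mult.assoc)
    also have "\<dots> = - \<beta>2 * \<alpha>2' + \<beta>3 * (\<beta>1 * \<alpha>2')"
      by (simp only: rel(2)) (simp add: algebra_simps)
    also have "\<dots> = - \<beta>2 * \<alpha>2' - \<beta>1 * (- \<beta>3 * \<alpha>3')"
      by (simp only: c) (simp add: algebra_simps)
    finally show ?thesis
      using False by (simp add: b2_def b3_def)
  qed (use rel(2) in \<open>simp add: b2_def b3_def\<close>)
  have rel2: "a1 * b2 = b2 - b1 * b3"
  proof (cases hM)
    case False
    have "\<alpha>1' * b2 = \<alpha>1' * (\<alpha>1 * b2 + \<beta>1 * b3)"
      by (simp add: rel')
    also have "\<dots> = (\<alpha>1 * \<alpha>1') * b2 + \<alpha>1' * \<beta>1 * b3"
      by (simp add: algebra_simps)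
    also have "\<dots> = b2 - (- \<beta>1 * \<alpha>1') * b3"
      using \<alpha>(1) by simp
    finally show ?thesis
      using False by (simp add: a1_def b1_def)
  qed (use rel' in \<open>simp add: a1_def b1_def\<close>)
  have over: "directed_row bT k2 ts v a c = (\<lambda>j. g bT * (\<delta> c j - \<delta> a j))"
      "directed_row bT k3 te v a c = (\<lambda>j. g bT * (\<delta> c j - \<delta> a j))"
      "directed_row bM k1 me v a c = (\<lambda>j. g bM * (\<delta> c j - \<delta> a j))" for v a c :: 'e
    using lev by (simp_all add: k directed_row_over g_def)
  have ms: "directed_row bM k3 ms v a c = (\<lambda>j. f hT \<alpha>3 * (b3 * \<delta> v j + a3 * \<delta> a j - \<delta> c j))" for v a c :: 'e
    unfolding k f_def a3_def b3_def using lev ltr \<alpha> by (intro directed_row_under_next) auto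
  have bs: "directed_row bB k1 bs v a c = (\<lambda>j. f hM \<alpha>1 * (b1 * \<delta> v j + a1 * \<delta> a j - \<delta> c j))" for v a c :: 'e
    unfolding k f_def a1_def b1_def using lev ltr \<alpha> by (intro directed_row_under_next) auto
  have be: "directed_row bB k2 be v a c = (\<lambda>j. f hT \<alpha>2 * (b2 * \<delta> v j + a2 * \<delta> c j - \<delta> a j))" for v a c :: 'e
    unfolding k f_def a2_def b2_def using lev ltr \<alpha> by (intro directed_row_under_prev) auto
  have "prod_list ?ks * rdet ([\<lambda>j. \<delta> T1 j - \<delta> T0 j, \<lambda>j. \<delta> T2 j - \<delta> T1 j,
            \<lambda>j. b3 * \<delta> v3 j + a3 * \<delta> M0 j - \<delta> M1 j, \<lambda>j. \<delta> M2 j - \<delta> M1 j,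
            \<lambda>j. b1 * \<delta> v1 j + a1 * \<delta> B0 j - \<delta> B1 j, \<lambda>j. b2 * \<delta> v2 j + a2 * \<delta> B2 j - \<delta> B1 j] @ R)
            (T1 # M1 # B1 # C) \<simeq>
        prod_list ?ks * rdet ([\<lambda>j. \<delta> T2 j - \<delta> T1 j, \<lambda>j. \<delta> T1 j - \<delta> T0 j,
            \<lambda>j. b3 * \<delta> w3 j + a3 * \<delta> M1 j - \<delta> M2 j, \<lambda>j. \<delta> M1 j - \<delta> M0 j,
            \<lambda>j. b1 * \<delta> w1 j + a1 * \<delta> B1 j - \<delta> B2 j, \<lambda>j. b2 * \<delta> w2 j + a2 * \<delta> B1 j - \<delta> B0 j] @ R)
            (T1 # M1 # B1 # C)"
    using a2 rel1 rel2 by (intro eq_sign_mult rdet_triangle mids len R v) auto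
  then show ?thesis
    unfolding ms bs be over using len by (subst (1 2) rdet_scale6) auto
qed

lemma rdet_directed_shift_strand:
  fixes R :: "('e \<Rightarrow> knot_ring) list"
  assumes mids: "distinct [O1, N1, V1]" "{O1, N1, V1} \<inter> (set C \<union> {O0, O2, N0, N2, V0, V2}) = {}"
    and len: "length C = length R + 3" and R: "\<And>r. r \<in> set R \<Longrightarrow> r O1 = 0 \<and> r N1 = 0 \<and> r V1 = 0"
    and ltr: "h \<longleftrightarrow> left_to_right ns \<noteq> bN" "h \<longleftrightarrow> left_to_right ve = bV"
    and vne: "level ne = Under \<Longrightarrow> vne = (if bV then V0 else V1) \<and> wne = (if bV then V1 else V2)"
    and vvs: "level vs = Under \<Longrightarrow> vvs = (if bN then N1 else N2) \<and> wvs = (if bN then N0 else N1)"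
    and k: "k = Skein \<alpha> \<beta>"
  shows "rdet ([directed_row bO Shift os vos O0 O1, directed_row bO Shift oe voe O1 O2,
            directed_row bN Shift ns vns N0 N1, directed_row bV Shift ve vve V1 V2,
            directed_row bN k ne vne N1 N2, directed_row bV k vs vvs V0 V1] @ R) (O1 # N1 # V1 # C) \<simeq>
         rdet ([directed_row bO Shift os wos O1 O2, directed_row bO Shift oe woe O0 O1,
            directed_row bN Shift ns wns N1 N2, directed_row bV Shift ve wve V0 V1,
            directed_row bN k ne wne N0 N1, directed_row bV k vs wvs V1 V2] @ R) (O1 # N1 # V1 # C)"
proof -
  obtain p q r where ne: "\<And>v a c :: 'e. directed_row bN k ne v a c = (\<lambda>j. r * \<delta> v j + p * \<delta> a j + q * \<delta> c j)"
    and r: "level ne \<noteq> Under \<Longrightarrow> r = 0"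
    unfolding k by (rule directed_row_coeffs[of bN \<alpha> \<beta> ne]) blast
  obtain p' q' r' where vs: "\<And>v a c :: 'e. directed_row bV k vs v a c = (\<lambda>j. r' * \<delta> v j + p' * \<delta> a j + q' * \<delta> c j)"
    and r': "level vs \<noteq> Under \<Longrightarrow> r' = 0"
    unfolding k by (rule directed_row_coeffs[of bV \<alpha> \<beta> vs]) blast
  define \<sigma> where "\<sigma> = ring_s_pow (if h then 1 else - 1)"
  define \<sigma>' where "\<sigma>' = ring_s_pow (if h then - 1 else 1)"
  have \<sigma>: "\<sigma> * \<sigma>' = 1"
    by (auto simp: \<sigma>_def \<sigma>'_def simp flip: ring_s_pow_add)
  define \<rho> where "\<rho> x b = ring_s_pow (if left_to_right x = b then 1 else - 1)" for x b
  define f where "f b x = (if b then 1 else - ring_s_pow (shift x))" for b x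
  have sh: "directed_row b Shift x v a c = (\<lambda>j. f b x * (\<delta> c j - \<rho> x b * \<delta> a j))" for b x and v a c :: 'e
    by (simp add: directed_row_shift f_def \<rho>_def)
  have \<rho>: "\<rho> ns bN = \<sigma>'" "\<rho> ve bV = \<sigma>"
    using ltr by (auto simp: \<rho>_def \<sigma>_def \<sigma>'_def)
  let ?ks = "[f bO os, f bO oe, f bN ns, f bV ve, 1, 1]"
  \<comment> \<open>The overpass edge seen by \<open>ne\<close> is the one arriving at the crossing
    along V: \<open>V0\<close> or \<open>V1\<close>, depending on the direction of V. Its
    coefficient goes into the corresponding slot. The same is done for \<open>vs\<close> and
    N.\<close>
  let ?a3 = "if bV then r else 0" and ?a4 = "if bV then 0 else r"
  let ?c1 = "if bN then r' else 0" and ?c2 = "if bN then 0 else r'"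
  have ne': "directed_row bN k ne v a c = (\<lambda>j. p * \<delta> a j + q * \<delta> c j + r * \<delta> v j)" for v a c :: 'e
    by (rule ext) (simp only: ne add_ac)
  have rows_ne: "directed_row bN k ne vne N1 N2 = (\<lambda>j. 1 * (p * \<delta> N1 j + q * \<delta> N2 j + ?a3 * \<delta> V0 j + ?a4 * \<delta> V1 j))"
      "directed_row bN k ne wne N0 N1 = (\<lambda>j. 1 * (p * \<delta> N0 j + q * \<delta> N1 j + ?a3 * \<delta> V1 j + ?a4 * \<delta> V2 j))"
  proof -
    consider "level ne = Under" "vne = V0" "wne = V1" bV | "level ne = Under" "vne = V1" "wne = V2" "\<not> bV" | "r = 0"
      using vne r by (cases "level ne = Under"; cases bV) auto
    note * = this
    show "directed_row bN k ne vne N1 N2 = (\<lambda>j. 1 * (p * \<delta> N1 j + q * \<delta> N2 j + ?a3 * \<delta> V0 j + ?a4 * \<delta> V1 j))"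
      unfolding ne' using * by cases simp_all
    show "directed_row bN k ne wne N0 N1 = (\<lambda>j. 1 * (p * \<delta> N0 j + q * \<delta> N1 j + ?a3 * \<delta> V1 j + ?a4 * \<delta> V2 j))"
      unfolding ne' using * by cases simp_all
  qed
  have rows_vs: "directed_row bV k vs vvs V0 V1 = (\<lambda>j. 1 * (?c1 * \<delta> N1 j + ?c2 * \<delta> N2 j + p' * \<delta> V0 j + q' * \<delta> V1 j))"
      "directed_row bV k vs wvs V1 V2 = (\<lambda>j. 1 * (?c1 * \<delta> N0 j + ?c2 * \<delta> N1 j + p' * \<delta> V1 j + q' * \<delta> V2 j))"
  proof -
    consider "level vs = Under" "vvs = N1" "wvs = N0" bN | "level vs = Under" "vvs = N2" "wvs = N1" "\<not> bN" | "r' = 0"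
      using vvs r' by (cases "level vs = Under"; cases bN) auto
    note * = this
    show "directed_row bV k vs vvs V0 V1 = (\<lambda>j. 1 * (?c1 * \<delta> N1 j + ?c2 * \<delta> N2 j + p' * \<delta> V0 j + q' * \<delta> V1 j))"
      unfolding vs using * by cases simp_all
    show "directed_row bV k vs wvs V1 V2 = (\<lambda>j. 1 * (?c1 * \<delta> N0 j + ?c2 * \<delta> N1 j + p' * \<delta> V1 j + q' * \<delta> V2 j))"
      unfolding vs using * by cases simp_all
  qed
  have "prod_list ?ks * rdet ([\<lambda>j. \<delta> O1 j - \<rho> os bO * \<delta> O0 j, \<lambda>j. \<delta> O2 j - \<rho> oe bO * \<delta> O1 j,
            \<lambda>j. \<delta> N1 j - \<sigma>' * \<delta> N0 j, \<lambda>j. \<delta> V2 j - \<sigma> * \<delta> V1 j,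
            \<lambda>j. p * \<delta> N1 j + q * \<delta> N2 j + ?a3 * \<delta> V0 j + ?a4 * \<delta> V1 j,
            \<lambda>j. ?c1 * \<delta> N1 j + ?c2 * \<delta> N2 j + p' * \<delta> V0 j + q' * \<delta> V1 j] @ R)
            (O1 # N1 # V1 # C) \<simeq>
         prod_list ?ks * rdet ([\<lambda>j. \<delta> O2 j - \<rho> os bO * \<delta> O1 j, \<lambda>j. \<delta> O1 j - \<rho> oe bO * \<delta> O0 j,
            \<lambda>j. \<delta> N2 j - \<sigma>' * \<delta> N1 j, \<lambda>j. \<delta> V1 j - \<sigma> * \<delta> V0 j,
            \<lambda>j. p * \<delta> N0 j + q * \<delta> N1 j + ?a3 * \<delta> V1 j + ?a4 * \<delta> V2 j,
            \<lambda>j. ?c1 * \<delta> N0 j + ?c2 * \<delta> N1 j + p' * \<delta> V1 j + q' * \<delta> V2 j] @ R)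
            (O1 # N1 # V1 # C)"
    by (intro eq_sign_mult rdet_shift_strand mids len R \<sigma>)
  then show ?thesis
    unfolding sh rows_ne rows_vs \<rho>
    using len by (subst (1 2) rdet_scale6) auto
qed

section \<open>Rows of the three strands before and after a third move\<close>

definition strand_before :: "(nat \<Rightarrow> kind) \<Rightarrow> passage \<Rightarrow> passage \<Rightarrow> passage \<Rightarrow> (passage \<Rightarrow> knot_ring) list" where
  "strand_before T x1 x2 e =
     [passage_row (T (crossing x1)) x1 (over_of x1) x1 x2, passage_row (T (crossing x2)) x2 (over_of x2) x2 e]"

text \<open>The strand now runs through \<open>x2\<close> first. Edges are renamed by
  \<open>\<tau>\<close>, which is meant to interchange the passages of a strand, so that
  \<open>x1\<close> is again the edge arriving from outside and \<open>x2\<close> the side of the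
  triangle.\<close>

definition strand_after ::
  "(nat \<Rightarrow> kind) \<Rightarrow> (passage \<Rightarrow> passage) \<Rightarrow> passage \<Rightarrow> passage \<Rightarrow> passage \<Rightarrow> (passage \<Rightarrow> knot_ring) list" where
  "strand_after T \<tau> x1 x2 e =
     [passage_row (T (crossing x1)) x1 (\<tau> (over_of x1)) x2 e, passage_row (T (crossing x2)) x2 (\<tau> (over_of x2)) x1 x2]"

lemma length_strand [simp]: "length (strand_before T x1 x2 e) = 2" "length (strand_after T \<tau> x1 x2 e) = 2"
  by (simp_all add: strand_before_def strand_after_def)

text \<open>Passes from the orientation of the curve to the sense in which the triangle is
  traversed. The order of the two rows depends on \<open>b\<close>, hence the multisets.\<close>

lemma mset_strand:
  assumes "xs = (if b then x1 else x2)" "xe = (if b then x2 else x1)"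
    and "X0 = (if b then x1 else e)" "X2 = (if b then e else x1)"
  shows "mset (strand_before T x1 x2 e) = {#directed_row b (T (crossing xs)) xs (over_of xs) X0 x2,
           directed_row b (T (crossing xe)) xe (over_of xe) x2 X2#}"
    and "mset (strand_after T \<tau> x1 x2 e) = {#directed_row b (T (crossing xs)) xs (\<tau> (over_of xs)) x2 X2,
           directed_row b (T (crossing xe)) xe (\<tau> (over_of xe)) X0 x2#}"
  using assms by (auto simp: strand_before_def strand_after_def directed_row_def)

lemma over_of_eqI:
  "crossing x = crossing y \<Longrightarrow> level x = Over \<Longrightarrow> left_to_right x \<noteq> left_to_right y \<Longrightarrow> over_of y = x"
  by (cases x) (auto simp: over_of_def)

lemma rdet_strands_skein:
  fixes R :: "(passage \<Rightarrow> knot_ring) list"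
  assumes mids: "distinct [t1, t2, m1, m2, b1, b2]" "{t2, m2, b2} \<inter> (set C \<union> {oT, oM, oB}) = {}"
    and len: "length C = length R + 3" and R: "\<And>r. r \<in> set R \<Longrightarrow> r t2 = 0 \<and> r m2 = 0 \<and> r b2 = 0"
    and s: "ts = (if bT then t1 else t2)" "ms = (if bM then m1 else m2)" "bs = (if bB then b1 else b2)"
    and e: "te = (if bT then t2 else t1)" "me = (if bM then m2 else m1)" "be = (if bB then b2 else b1)"
    and lev: "level ts = Over" "level te = Over" "level ms = Under" "level me = Over" "level bs = Under" "level be = Under"
    and cr: "crossing te = crossing ms" "crossing me = crossing bs" "crossing be = crossing ts"
    and ltr_e: "left_to_right te = ((bT = bM) = \<kappa>)" "left_to_right me = ((bM = bB) = \<kappa>)" "left_to_right be = ((bB = bT) = \<kappa>)"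
    and ltr_s: "left_to_right ms \<noteq> left_to_right te" "left_to_right bs \<noteq> left_to_right me" "left_to_right ts \<noteq> left_to_right be"
    and \<tau>: "\<tau> t1 = t2" "\<tau> t2 = t1" "\<tau> m1 = m2" "\<tau> m2 = m1" "\<tau> b1 = b2" "\<tau> b2 = b1"
    and k: "T (crossing me) = Skein \<alpha>1 \<beta>1" "T (crossing be) = Skein \<alpha>2 \<beta>2" "T (crossing te) = Skein \<alpha>3 \<beta>3"
    and \<alpha>: "\<alpha>1 * \<alpha>1' = 1" "\<alpha>2 * \<alpha>2' = 1" "\<alpha>3 * \<alpha>3' = 1"
    and rel: "\<beta>1 * \<alpha>2 = \<beta>1 * \<alpha>3" "\<alpha>1 * \<beta>2 = \<beta>2 - \<beta>1 * \<beta>3"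
  shows "rdet (strand_before T t1 t2 oT @ strand_before T m1 m2 oM @ strand_before T b1 b2 oB @ R) (t2 # m2 # b2 # C) \<simeq>
         rdet (strand_after T \<tau> t1 t2 oT @ strand_after T \<tau> m1 m2 oM @ strand_after T \<tau> b1 b2 oB @ R) (t2 # m2 # b2 # C)"
proof -
  define T0 T2 where "T0 = (if bT then t1 else oT)" and "T2 = (if bT then oT else t1)"
  define M0 M2 where "M0 = (if bM then m1 else oM)" and "M2 = (if bM then oM else m1)"
  define B0 B2 where "B0 = (if bB then b1 else oB)" and "B2 = (if bB then oB else b1)"
  have ov: "over_of ms = te" "over_of bs = me" "over_of be = ts"
    using lev cr ltr_s by (auto intro!: over_of_eqI)
  have "rdet (strand_before T t1 t2 oT @ strand_before T m1 m2 oM @ strand_before T b1 b2 oB @ R) (t2 # m2 # b2 # C) \<simeq>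
     rdet ([directed_row bT (T (crossing be)) ts (over_of ts) T0 t2, directed_row bT (T (crossing te)) te (over_of te) t2 T2,
            directed_row bM (T (crossing te)) ms te M0 m2, directed_row bM (T (crossing me)) me (over_of me) m2 M2,
            directed_row bB (T (crossing me)) bs me B0 b2, directed_row bB (T (crossing be)) be ts b2 B2] @ R) (t2 # m2 # b2 # C)"
    using len by (intro rdet_permute)
      (auto simp: mset_strand(1)[OF s(1) e(1) T0_def T2_def] mset_strand(1)[OF s(2) e(2) M0_def M2_def]
        mset_strand(1)[OF s(3) e(3) B0_def B2_def] ov cr)
  also have "\<dots> \<simeq> 
     rdet ([directed_row bT (T (crossing be)) ts (\<tau> (over_of ts)) t2 T2, directed_row bT (T (crossing te)) te (\<tau> (over_of te)) T0 t2,
            directed_row bM (T (crossing te)) ms (\<tau> te) m2 M2, directed_row bM (T (crossing me)) me (\<tau> (over_of me)) M0 m2,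
            directed_row bB (T (crossing me)) bs (\<tau> me) b2 B2, directed_row bB (T (crossing be)) be (\<tau> ts) B0 b2] @ R) (t2 # m2 # b2 # C)"
  \<comment> \<open>\<open>\<kappa>\<close> holds when the triangle lies to the left of the
    traversal, so \<open>bT = \<kappa>\<close> says that it lies to the left of the oriented
    strand.\<close>
  proof (rule rdet_directed_triangle[where hT = "bT = \<kappa>" and hM = "bM = \<kappa>", OF _ _ len R lev _ _ _ _ _ _ _ _ _ k \<alpha> rel])
    show "distinct [t2, m2, b2]" "{t2, m2, b2} \<inter> (set C \<union> {T0, T2, M0, M2, B0, B2}) = {}"
      using mids by (auto simp: T0_def T2_def M0_def M2_def B0_def B2_def)
    show "(bT = \<kappa>) = (left_to_right ms \<noteq> bM)" "(bM = \<kappa>) = (left_to_right bs \<noteq> bB)" "(bT = \<kappa>) = (left_to_right be = bB)"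
      using ltr_e ltr_s by (cases bT; cases bM; cases bB; cases \<kappa>; simp)+
    show "te \<in> {t2, T2}" "ts \<in> {T0, t2}" "me \<in> {m2, M2}" "\<tau> te \<in> {T0, t2}" "\<tau> ts \<in> {t2, T2}" "\<tau> me \<in> {M0, m2}"
      using s e \<tau> by (auto simp: T0_def T2_def M0_def M2_def)
  qed
  also have "\<dots> \<simeq> rdet (strand_after T \<tau> t1 t2 oT @ strand_after T \<tau> m1 m2 oM @ strand_after T \<tau> b1 b2 oB @ R) (t2 # m2 # b2 # C)"
    using len by (intro rdet_permute)
      (auto simp: mset_strand(2)[OF s(1) e(1) T0_def T2_def] mset_strand(2)[OF s(2) e(2) M0_def M2_def]
        mset_strand(2)[OF s(3) e(3) B0_def B2_def] ov cr)
  finally show ?thesis .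
qed

lemma rdet_strands_shift:
  fixes R :: "(passage \<Rightarrow> knot_ring) list"
  assumes mids: "distinct [o1, o2, n1, n2, v1, v2]" "{o2, n2, v2} \<inter> (set C \<union> {oO, oN, oV}) = {}"
    and len: "length C = length R + 3" and R: "\<And>r. r \<in> set R \<Longrightarrow> r o2 = 0 \<and> r n2 = 0 \<and> r v2 = 0"
    and s: "os = (if bO then o1 else o2)" "ns = (if bN then n1 else n2)" "vs = (if bV then v1 else v2)"
    and e: "oe = (if bO then o2 else o1)" "ne = (if bN then n2 else n1)" "ve = (if bV then v2 else v1)"
    and lev: "(level ne, level vs) \<in> {(Over, Under), (Under, Over)}"
    and cr: "crossing oe = crossing ns" "crossing ne = crossing vs" "crossing ve = crossing os"
    and ltr_e: "left_to_right oe = ((bO = bN) = \<kappa>)" "left_to_right ne = ((bN = bV) = \<kappa>)" "left_to_right ve = ((bV = bO) = \<kappa>)"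
    and ltr_s: "left_to_right ns \<noteq> left_to_right oe" "left_to_right vs \<noteq> left_to_right ne" "left_to_right os \<noteq> left_to_right ve"
    and \<tau>: "\<tau> n1 = n2" "\<tau> n2 = n1" "\<tau> v1 = v2" "\<tau> v2 = v1"
    and k: "T (crossing ne) = Skein \<alpha> \<beta>" "T (crossing ve) = Shift" "T (crossing oe) = Shift"
  shows "rdet (strand_before T o1 o2 oO @ strand_before T n1 n2 oN @ strand_before T v1 v2 oV @ R) (o2 # n2 # v2 # C) \<simeq>
         rdet (strand_after T \<tau> o1 o2 oO @ strand_after T \<tau> n1 n2 oN @ strand_after T \<tau> v1 v2 oV @ R) (o2 # n2 # v2 # C)"
proof -
  define O0 O2 where "O0 = (if bO then o1 else oO)" and "O2 = (if bO then oO else o1)"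
  define N0 N2 where "N0 = (if bN then n1 else oN)" and "N2 = (if bN then oN else n1)"
  define V0 V2 where "V0 = (if bV then v1 else oV)" and "V2 = (if bV then oV else v1)"
  note k' = k[unfolded cr(1,3)]
  have ov: "level ne = Under \<Longrightarrow> over_of ne = vs" "level vs = Under \<Longrightarrow> over_of vs = ne"
    using lev cr ltr_s by (auto intro!: over_of_eqI)
  have "rdet (strand_before T o1 o2 oO @ strand_before T n1 n2 oN @ strand_before T v1 v2 oV @ R) (o2 # n2 # v2 # C) \<simeq>
     rdet ([directed_row bO Shift os (over_of os) O0 o2, directed_row bO Shift oe (over_of oe) o2 O2,
            directed_row bN Shift ns (over_of ns) N0 n2, directed_row bV Shift ve (over_of ve) v2 V2,
            directed_row bN (T (crossing ne)) ne (over_of ne) n2 N2,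
            directed_row bV (T (crossing ne)) vs (over_of vs) V0 v2] @ R) (o2 # n2 # v2 # C)"
    using len by (intro rdet_permute)
      (auto simp: mset_strand(1)[OF s(1) e(1) O0_def O2_def] mset_strand(1)[OF s(2) e(2) N0_def N2_def]
        mset_strand(1)[OF s(3) e(3) V0_def V2_def] k k' cr)
  also have "\<dots> \<simeq> 
     rdet ([directed_row bO Shift os (\<tau> (over_of os)) o2 O2, directed_row bO Shift oe (\<tau> (over_of oe)) O0 o2,
            directed_row bN Shift ns (\<tau> (over_of ns)) n2 N2, directed_row bV Shift ve (\<tau> (over_of ve)) V0 v2,
            directed_row bN (T (crossing ne)) ne (\<tau> (over_of ne)) N0 n2,
            directed_row bV (T (crossing ne)) vs (\<tau> (over_of vs)) v2 V2] @ R) (o2 # n2 # v2 # C)"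
  proof (rule rdet_directed_shift_strand[where h = "bO = \<kappa>", OF _ _ len R _ _ _ _ k(1)])
    show "distinct [o2, n2, v2]" "{o2, n2, v2} \<inter> (set C \<union> {O0, O2, N0, N2, V0, V2}) = {}"
      using mids by (auto simp: O0_def O2_def N0_def N2_def V0_def V2_def)
    show "(bO = \<kappa>) = (left_to_right ns \<noteq> bN)" "(bO = \<kappa>) = (left_to_right ve = bV)"
      using ltr_e ltr_s by (cases bO; cases bN; cases bV; cases \<kappa>; simp)+
    show "level ne = Under \<Longrightarrow> over_of ne = (if bV then V0 else v2) \<and> \<tau> (over_of ne) = (if bV then v2 else V2)"
      using s e \<tau> ov by (auto simp: V0_def V2_def)
    show "level vs = Under \<Longrightarrow> over_of vs = (if bN then n2 else N2) \<and> \<tau> (over_of vs) = (if bN then N0 else n2)"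
      using s e \<tau> ov by (auto simp: N0_def N2_def)
  qed
  also have "\<dots> \<simeq> rdet (strand_after T \<tau> o1 o2 oO @ strand_after T \<tau> n1 n2 oN @ strand_after T \<tau> v1 v2 oV @ R) (o2 # n2 # v2 # C)"
    using len by (intro rdet_permute)
      (auto simp: mset_strand(2)[OF s(1) e(1) O0_def O2_def] mset_strand(2)[OF s(2) e(2) N0_def N2_def]
        mset_strand(2)[OF s(3) e(3) V0_def V2_def] k k' cr)
  finally show ?thesis .
qed

lemma passage_row_comp:
  assumes "\<tau> \<circ> \<tau> = id"
  shows "passage_row k x v i o' \<circ> \<tau> = passage_row k x (\<tau> v) (\<tau> i) (\<tau> o')"
proof -
  have "(\<delta> a (\<tau> j) :: knot_ring) = \<delta> (\<tau> a) j" for a j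
    using pointfree_idE[OF assms] by (auto simp: unit_row_def)
  then show ?thesis
    by (auto simp: passage_row_def fun_eq_iff split: kind.splits)
qed

lemma walk_comp:
  assumes "\<tau> \<circ> \<tau> = id" "\<And>x. x \<in> set xs \<Longrightarrow> \<tau> x = x \<and> \<tau> (over_of x) = over_of x"
  shows "map (\<lambda>r. r \<circ> \<tau>) (walk T xs e) = walk T xs (\<tau> e)"
  using assms(2)
proof (induction xs)
  case (Cons x xs)
  have "\<tau> (hd (xs @ [e])) = hd (xs @ [\<tau> e])"
    using Cons.prems by (cases xs) auto
  then show ?case
    using Cons by (simp only: walk.simps list.map passage_row_comp[OF assms(1)] list.set_intros)
qed simp

text \<open>On lists the third move is the renaming \<open>\<tau>\<close> of passages. Pulling the
  rows after the move back along \<open>\<tau>\<close> gives both diagrams the same columns and the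
  same rows \<open>R\<close> for the rest of the curve; only six rows differ.\<close>

lemma edge_det_triangle_rows:
  fixes T :: "nat \<Rightarrow> kind" and u v w :: diagram
  assumes dist: "distinct (x1 # x2 # u @ y1 # y2 # v @ z1 # z2 # w)"
    and cr: "\<And>p. p \<in> set u \<union> set v \<union> set w \<Longrightarrow>
      crossing p \<notin> {crossing x1, crossing x2, crossing y1, crossing y2, crossing z1, crossing z2}"
  defines "\<tau> \<equiv> id(x1 := x2, x2 := x1, y1 := y2, y2 := y1, z1 := z2, z2 := z1)"
    and "R \<equiv> walk T u y1 @ walk T v z1 @ walk T w x1"
    and "C \<equiv> x1 # u @ y1 # v @ z1 # w"
    and "ox \<equiv> hd (u @ [y1])" and "oy \<equiv> hd (v @ [z1])" and "oz \<equiv> hd (w @ [x1])"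
  shows "edge_det T (x1 # x2 # u @ y1 # y2 # v @ z1 # z2 # w) \<simeq>
      rdet (strand_before T x1 x2 ox @ strand_before T y1 y2 oy @ strand_before T z1 z2 oz @ R) (x2 # y2 # z2 # C)"
    and "edge_det T (x2 # x1 # u @ y2 # y1 # v @ z2 # z1 # w) \<simeq>
      rdet (strand_after T \<tau> x1 x2 ox @ strand_after T \<tau> y1 y2 oy @ strand_after T \<tau> z1 z2 oz @ R) (x2 # y2 # z2 # C)"
    and "length C = length R + 3"
    and "\<And>r. r \<in> set R \<Longrightarrow> r x2 = 0 \<and> r y2 = 0 \<and> r z2 = 0"
    and "{x2, y2, z2} \<inter> (set C \<union> {ox, oy, oz}) = {}"
proof -
  let ?K = "x1 # x2 # u @ y1 # y2 # v @ z1 # z2 # w" and ?K' = "x2 # x1 # u @ y2 # y1 # v @ z2 # z1 # w"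
  show len: "length C = length R + 3"
    by (simp add: C_def R_def)
  have o_set: "ox \<in> set (u @ [y1])" "oy \<in> set (v @ [z1])" "oz \<in> set (w @ [x1])"
    unfolding ox_def oy_def oz_def by (rule hd_in_set; simp)+
  then show "{x2, y2, z2} \<inter> (set C \<union> {ox, oy, oz}) = {}"
    using dist by (auto simp: C_def)
  have six: "p \<notin> {x1, x2, y1, y2, z1, z2} \<and> over_of p \<notin> {x1, x2, y1, y2, z1, z2}"
    if "p \<in> set u \<union> set v \<union> set w" for p
    using cr[OF that] by (auto simp: over_of_def)
  have neq: "x2 \<noteq> x1" "y2 \<noteq> x1" "z2 \<noteq> x1" "x2 \<noteq> y1" "y2 \<noteq> y1" "z2 \<noteq> y1" "x2 \<noteq> z1" "y2 \<noteq> z1" "z2 \<noteq> z1"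
      "x1 \<noteq> y1" "x1 \<noteq> z1" "y1 \<noteq> z1" "x2 \<noteq> y2" "x2 \<noteq> z2" "y2 \<noteq> z2"
    using dist by auto
  note neq = neq neq[symmetric]
  show "r x2 = 0 \<and> r y2 = 0 \<and> r z2 = 0" if "r \<in> set R" for r
  proof -
    have "r c = 0" if c: "c \<in> {x2, y2, z2}" for c
      using \<open>r \<in> set R\<close> six c neq walk_eq_0[of c u y1 T r] walk_eq_0[of c v z1 T r] walk_eq_0[of c w x1 T r]
      by (auto simp: R_def)
    then show ?thesis
      by blast
  qed
  show "edge_det T ?K \<simeq>
      rdet (strand_before T x1 x2 ox @ strand_before T y1 y2 oy @ strand_before T z1 z2 oz @ R) (x2 # y2 # z2 # C)"
    unfolding edge_det_def
    by (simp, intro rdet_permute) (auto simp: strand_before_def walk_append hd_append R_def C_def ox_def oy_def oz_def)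
  have \<tau>: "\<tau> \<circ> \<tau> = id"
    using neq by (auto simp: \<tau>_def fun_eq_iff)
  have \<tau>_fix: "\<tau> p = p \<and> \<tau> (over_of p) = over_of p" if "p \<in> set u \<union> set v \<union> set w" for p
    using six[OF that] by (auto simp: \<tau>_def)
  have \<tau>6: "\<tau> x1 = x2" "\<tau> x2 = x1" "\<tau> y1 = y2" "\<tau> y2 = y1" "\<tau> z1 = z2" "\<tau> z2 = z1"
    using neq by (auto simp: \<tau>_def)
  have map\<tau>: "map \<tau> u = u" "map \<tau> v = v" "map \<tau> w = w"
    using \<tau>_fix by (auto intro!: map_idI)
  have K': "?K' = map \<tau> ?K"
    by (simp add: \<tau>6 map\<tau>)
  have \<tau>o: "\<tau> (hd (u @ [y2])) = ox" "\<tau> (hd (v @ [z2])) = oy" "\<tau> (hd (w @ [x2])) = oz"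
    using \<tau>_fix by (auto simp: ox_def oy_def oz_def \<tau>6 hd_append)
  have walks: "map (\<lambda>r. r \<circ> \<tau>) (walk T u y2) = walk T u y1" "map (\<lambda>r. r \<circ> \<tau>) (walk T v z2) = walk T v z1"
      "map (\<lambda>r. r \<circ> \<tau>) (walk T w x2) = walk T w x1"
    using \<tau>_fix by (subst walk_comp[OF \<tau>]; simp add: \<tau>6)+
  have "edge_det T ?K' = rdet (walk T ?K' x2) (map \<tau> ?K)"
    unfolding K'[symmetric] by (simp add: edge_det_def)
  also have "\<dots> = rdet (map (\<lambda>r. r \<circ> \<tau>) (walk T ?K' x2)) ?K"
    by (rule rdet_map_cols) simp
  also have "\<dots> \<simeq> rdet (strand_after T \<tau> x1 x2 ox @ strand_after T \<tau> y1 y2 oy @ strand_after T \<tau> z1 z2 oz @ R) (x2 # y2 # z2 # C)"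
  proof (rule rdet_permute)
    have [simp]: "hd (u @ y2 # y1 # zs) = hd (u @ [y2])" "hd (v @ z2 # z1 # zs) = hd (v @ [z2])" for zs
      by (simp_all add: hd_append)
    show "mset (map (\<lambda>r. r \<circ> \<tau>) (walk T ?K' x2)) =
        mset (strand_after T \<tau> x1 x2 ox @ strand_after T \<tau> y1 y2 oy @ strand_after T \<tau> z1 z2 oz @ R)"
      by (simp add: walk_append passage_row_comp[OF \<tau>] \<tau>6 \<tau>o walks strand_after_def R_def)
  qed (auto simp: C_def)
  finally show "edge_det T ?K' \<simeq>
      rdet (strand_after T \<tau> x1 x2 ox @ strand_after T \<tau> y1 y2 oy @ strand_after T \<tau> z1 z2 oz @ R) (x2 # y2 # z2 # C)" .
qed

section \<open>Gaussian parity\<close>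

lemma well_formedE:
  assumes "well_formed K" "c \<in> crossings K"
  obtains a x m y b where "K = a @ x # m @ y # b" "crossing x = c" "crossing y = c"
    "c \<notin> crossings a" "c \<notin> crossings m" "c \<notin> crossings b"
    "left_to_right x \<noteq> left_to_right y" "(level x, level y) \<in> {(Over, Under), (Under, Over), (Virtual, Virtual)}"
proof -
  obtain x y where xy: "filter (\<lambda>z. crossing z = c) K = [x, y]" "left_to_right x \<noteq> left_to_right y"
      "(level x, level y) \<in> {(Over, Under), (Under, Over), (Virtual, Virtual)}"
    using assms unfolding well_formed_def by blast
  obtain a K' where a: "K = a @ x # K'" "\<forall>z\<in>set a. crossing z \<noteq> c" "crossing x = c" "filter (\<lambda>z. crossing z = c) K' = [y]"
    using filter_eq_ConsD[OF xy(1)] by metis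
  obtain m b where m: "K' = m @ y # b" "\<forall>z\<in>set m. crossing z \<noteq> c" "crossing y = c" "filter (\<lambda>z. crossing z = c) b = []"
    using filter_eq_ConsD[OF a(4)] by metis
  show thesis
    using a m xy by (intro that[of a x m y b]) (auto simp: filter_empty_conv)
qed

lemma well_formed_distinct:
  assumes "well_formed K"
  shows "distinct K"
proof (rule ccontr)
  assume "\<not> distinct K"
  then obtain xs ys zs x where K: "K = xs @ [x] @ ys @ [x] @ zs"
    using not_distinct_decomp by blast
  then obtain a b where "filter (\<lambda>z. crossing z = crossing x) K = [a, b]" "left_to_right a \<noteq> left_to_right b"
    using assms unfolding well_formed_def by fastforce
  then show False
    unfolding K by (auto simp: append_eq_Cons_conv filter_empty_conv)
qed

lemma well_formed_partner:
  assumes "well_formed K" "x \<in> set K" "y \<in> set K" "crossing x = crossing y" "x \<noteq> y"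
  shows "left_to_right x \<noteq> left_to_right y" "(level x, level y) \<in> {(Over, Under), (Under, Over), (Virtual, Virtual)}"
proof -
  have "crossing x \<in> crossings K"
    using assms(2) by blast
  then obtain a x' m y' b where K: "K = a @ x' # m @ y' # b" "crossing x' = crossing x" "crossing y' = crossing x"
    "crossing x \<notin> crossings a" "crossing x \<notin> crossings m" "crossing x \<notin> crossings b"
    "left_to_right x' \<noteq> left_to_right y'" "(level x', level y') \<in> {(Over, Under), (Under, Over), (Virtual, Virtual)}"
    using well_formedE[OF assms(1)] by metis
  have "z \<in> {x', y'}" if "z \<in> set K" "crossing z = crossing x" for z
    using that K by (auto simp: image_iff)
  then have "x \<in> {x', y'}" "y \<in> {x', y'}"
    using assms by auto
  then show "left_to_right x \<noteq> left_to_right y" "(level x, level y) \<in> {(Over, Under), (Under, Over), (Virtual, Virtual)}"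
    using K assms(5) by auto
qed

lemma well_formed_partner_unique:
  assumes "well_formed K" "x \<in> set K" "y \<in> set K" "z \<in> set K" "crossing x = crossing y" "crossing x = crossing z" "x \<noteq> y" "x \<noteq> z"
  shows "y = z"
proof (rule ccontr)
  assume "y \<noteq> z"
  then have "left_to_right x \<noteq> left_to_right y" "left_to_right x \<noteq> left_to_right z" "left_to_right y \<noteq> left_to_right z"
    using well_formed_partner(1) assms by metis+
  then show False
    by blast
qed

lemma well_formed_partner_exists:
  assumes "well_formed K" "x \<in> set K"
  obtains y where "y \<in> set K" "y \<noteq> x" "crossing y = crossing x"
proof -
  have "crossing x \<in> crossings K"
    using assms(2) by blast
  then obtain a x' m y' b where K: "K = a @ x' # m @ y' # b" "crossing x' = crossing x" "crossing y' = crossing x"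
    "left_to_right x' \<noteq> left_to_right y'"
    using well_formedE[OF assms(1)] by metis
  then have "x' \<noteq> y'"
    by auto
  then show thesis
    using that[of x'] that[of y'] K by auto
qed

lemma occurs_at_iff:
  assumes "well_formed K" "c \<in> crossings K"
  obtains p q where "p < q" "\<And>l. occurs_at K c l \<longleftrightarrow> l = p \<or> l = q"
proof -
  obtain x y where "filter (\<lambda>z. crossing z = c) K = [x, y]"
    using assms unfolding well_formed_def by blast
  then have "card {i. i < length K \<and> crossing (K ! i) = c} = 2"
    using length_filter_conv_card[of "\<lambda>z. crossing z = c" K] by simp
  then obtain p q where pq: "p \<noteq> q" "{i. i < length K \<and> crossing (K ! i) = c} = {p, q}"
    by (auto simp: card_2_iff)
  then have "occurs_at K c l \<longleftrightarrow> l = p \<or> l = q" for l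
    unfolding occurs_at_def by blast
  then show thesis
    using pq(1) that[of p q] that[of q p] by (cases p q rule: linorder_cases) auto
qed

lemma odd_sum_iff_card:
  fixes f :: "'a \<Rightarrow> nat"
  assumes "finite S"
  shows "odd (\<Sum>d\<in>S. f d) \<longleftrightarrow> odd (card {d \<in> S. odd (f d)})"
  using assms
proof (induction S)
  case (insert d S)
  have "{e \<in> insert d S. odd (f e)} = (if odd (f d) then insert d {e \<in> S. odd (f e)} else {e \<in> S. odd (f e)})"
    by auto
  then show ?case
    using insert by auto
qed simp

lemma length_filter_eq_sum:
  assumes "finite S"
  shows "length (filter (\<lambda>x. f x \<in> S) xs) = (\<Sum>d\<in>S. length (filter (\<lambda>x. f x = d) xs))"
proof (induction xs)
  case (Cons x xs)
  have "(\<Sum>d\<in>S. length (filter (\<lambda>x. f x = d) (x # xs))) =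
      (\<Sum>d\<in>S. (if f x = d then 1 else 0) + length (filter (\<lambda>x. f x = d) xs))"
    by (intro sum.cong) auto
  also have "\<dots> = (\<Sum>d\<in>S. if f x = d then 1 else 0) + (\<Sum>d\<in>S. length (filter (\<lambda>x. f x = d) xs))"
    by (rule sum.distrib)
  finally show ?case
    using assms Cons.IH by simp
qed simp

text \<open>Of the two ends of \<open>d\<close>, none, one or both lie on \<open>m\<close>, the part
  of the circle between the ends of \<open>c\<close>; the chords cross when it is exactly
  one.\<close>

lemma chords_intersect_iff_odd:
  assumes wf: "well_formed K" and K: "K = a @ x # m @ y # b" "crossing x = c" "crossing y = c"
    and d: "d \<in> crossings K" "d \<noteq> c"
  shows "chords_intersect K c d \<longleftrightarrow> odd (length (filter (\<lambda>z. crossing z = d) m))"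
proof -
  define i k where "i = length a" and "k = length a + 1 + length m"
  have c: "occurs_at K c i" "occurs_at K c k" "i < k"
    using K by (simp_all add: occurs_at_def i_def k_def nth_append)
  have "c \<in> crossings K"
    using K by auto
  then have occ_c: "occurs_at K c l \<longleftrightarrow> l = i \<or> l = k" for l
    using occurs_at_iff[OF wf] c by (metis less_irrefl)
  obtain p q where pq: "p < q" "\<And>l. occurs_at K d l \<longleftrightarrow> l = p \<or> l = q"
    using occurs_at_iff[OF wf d(1)] by metis
  have ne: "p \<noteq> i" "p \<noteq> k" "q \<noteq> i" "q \<noteq> k"
    using occ_c pq d(2) by (metis occurs_at_def)+
  have iff: "chords_intersect K c d \<longleftrightarrow> (i < p \<and> p < k) \<noteq> (i < q \<and> q < k)"
  proof
    assume "chords_intersect K c d"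
    then show "(i < p \<and> p < k) \<noteq> (i < q \<and> q < k)"
      unfolding chords_intersect_def occ_c pq(2) using c(3) pq(1) by (elim exE conjE disjE) simp_all
  next
    assume "(i < p \<and> p < k) \<noteq> (i < q \<and> q < k)"
    then have "i < p \<and> p < k \<and> k < q \<or> p < i \<and> i < q \<and> q < k"
      using ne c(3) pq(1) by linarith
    then show "chords_intersect K c d"
      unfolding chords_intersect_def occ_c pq(2) by blast
  qed
  have "length (filter (\<lambda>z. crossing z = d) m) = card {j. j < length m \<and> crossing (m ! j) = d}"
    by (rule length_filter_conv_card)
  also have "\<dots> = card ((\<lambda>j. i + 1 + j) ` {j. j < length m \<and> crossing (m ! j) = d})"
    by (rule card_image[symmetric]) (auto simp: inj_on_def)
  also have "(\<lambda>j. i + 1 + j) ` {j. j < length m \<and> crossing (m ! j) = d} = {l. i < l \<and> l < k \<and> (l = p \<or> l = q)}"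
  proof -
    have "m ! j = K ! (i + 1 + j)" if "j < length m" for j
      using that K(1) by (simp add: i_def nth_append)
    then have "crossing (m ! j) = d \<longleftrightarrow> occurs_at K d (i + 1 + j)" if "j < length m" for j
      using that K(1) by (simp add: occurs_at_def i_def)
    then have *: "{j. j < length m \<and> crossing (m ! j) = d} = {j. j < length m \<and> (i + 1 + j = p \<or> i + 1 + j = q)}"
      using pq(2) by auto
    have "l \<in> (\<lambda>j. i + 1 + j) ` {j. j < length m \<and> (i + 1 + j = p \<or> i + 1 + j = q)}"
      if "i < l" "l < k" "l = p \<or> l = q" for l
      using that by (intro image_eqI[of _ _ "l - i - 1"]) (auto simp: i_def k_def)
    then show ?thesis
      unfolding * by (auto simp: i_def k_def)
  qed
  also have "{l. i < l \<and> l < k \<and> (l = p \<or> l = q)} = (if i < p \<and> p < k then {p} else {}) \<union> (if i < q \<and> q < k then {q} else {})"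
    by auto
  finally show ?thesis
    using pq(1) unfolding iff by (auto split: if_splits)
qed

text \<open>Parity when only the chords in \<open>S\<close> are counted. Both levels of the
  hierarchy then live on the same list: \<open>S\<close> consists of all classical crossings for the
  parity in \<open>K\<close>, and of the even ones for the parity in \<open>f(K)\<close>.\<close>

definition odd_wrt :: "nat set \<Rightarrow> diagram \<Rightarrow> nat \<Rightarrow> bool" where
  "odd_wrt S K c \<longleftrightarrow> odd (card {d \<in> S. d \<noteq> c \<and> chords_intersect K c d})"

text \<open>Parity of a position, written with \<open>takeWhile\<close> so that it can be evaluated
  by simplification along \<open>#\<close> and \<open>@\<close>, without indices.\<close>

definition colour :: "diagram \<Rightarrow> passage \<Rightarrow> bool" where
  "colour L x \<longleftrightarrow> odd (length (takeWhile (\<lambda>y. y \<noteq> x) L))"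

lemma colour_split: "x \<notin> set A \<Longrightarrow> colour (A @ x # B) x = odd (length A)"
  by (subst colour_def, subst takeWhile_append2) auto

text \<open>The letters of the restricted code strictly between the two passages count the crossing
  chords modulo 2, because a chord with both ends there contributes 2. The positions of the two
  passages differ by that number plus one.\<close>

lemma odd_wrt_iff_colour:
  assumes wf: "well_formed K" and S: "S \<subseteq> crossings K" "crossing x \<in> S"
    and xy: "x \<in> set K" "y \<in> set K" "x \<noteq> y" "crossing x = crossing y"
  defines "L \<equiv> filter (\<lambda>z. crossing z \<in> S) K"
  shows "odd_wrt S K (crossing x) \<longleftrightarrow> colour L x = colour L y"
proof -
  let ?c = "crossing x"
  have c: "?c \<in> crossings K"
    using xy by blast
  obtain a x' m y' b where K: "K = a @ x' # m @ y' # b" "crossing x' = ?c" "crossing y' = ?c"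
    "?c \<notin> crossings a" "?c \<notin> crossings m" "?c \<notin> crossings b"
    using well_formedE[OF wf c] by metis
  have dist: "distinct K"
    by (rule well_formed_distinct[OF wf])
  have fin: "finite S"
    using S(1) finite_subset by blast
  have "{x, y} = {x', y'}"
  proof -
    have "z \<in> {x', y'}" if "z \<in> set K" "crossing z = ?c" for z
      using that K by (auto simp: image_iff)
    then have "x \<in> {x', y'}" "y \<in> {x', y'}"
      using xy by auto
    then show ?thesis
      using xy(3) by auto
  qed
  then have *: "(colour L x = colour L y) = (colour L x' = colour L y')"
    by (auto simp: doubleton_eq_iff)
  let ?f = "filter (\<lambda>z. crossing z \<in> S)"
  have L: "L = ?f a @ x' # ?f m @ y' # ?f b"
    using K S(2) by (simp add: L_def)
  have "colour L x' = odd (length (?f a))"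
    unfolding L using dist K(1) by (intro colour_split) auto
  moreover have "colour L y' = odd (length (?f a) + 1 + length (?f m))"
    using colour_split[of y' "?f a @ x' # ?f m" "?f b"] dist K(1) L by auto
  ultimately have "(colour L x' = colour L y') = odd (length (?f m))"
    by auto
  also have "length (?f m) = (\<Sum>d\<in>S. length (filter (\<lambda>z. crossing z = d) m))"
    by (rule length_filter_eq_sum[OF fin])
  also have "odd \<dots> = odd (card {d \<in> S. odd (length (filter (\<lambda>z. crossing z = d) m))})"
    by (rule odd_sum_iff_card[OF fin])
  also have "{d \<in> S. odd (length (filter (\<lambda>z. crossing z = d) m))} = {d \<in> S. d \<noteq> ?c \<and> chords_intersect K ?c d}"
  proof -
    have "filter (\<lambda>z. crossing z = ?c) m = []"
      using K(5) by (auto simp: filter_empty_conv image_iff)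
    then have "odd (length (filter (\<lambda>z. crossing z = d) m)) \<longleftrightarrow> d \<noteq> ?c \<and> chords_intersect K ?c d" if "d \<in> S" for d
      using chords_intersect_iff_odd[OF wf K(1-3), of d] S(1) that by (cases "d = ?c") auto
    then show ?thesis
      by blast
  qed
  finally show ?thesis
    using * by (simp add: odd_wrt_def)
qed

lemma odd_crossing_eq_odd_wrt: "odd_crossing K = odd_wrt (classical_crossings K) K"
  by (simp add: odd_crossing_def odd_wrt_def fun_eq_iff)

lemma occurs_at_cong: "map crossing K = map crossing K' \<Longrightarrow> occurs_at K = occurs_at K'"
  unfolding occurs_at_def fun_eq_iff by (metis length_map nth_map)

lemma crossing_virtualize_odd: "map crossing (virtualize_odd K) = map crossing K"
  by (auto simp: virtualize_odd_def)

lemma classical_virtualize_odd: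
  "classical_crossings (virtualize_odd K) = {c \<in> classical_crossings K. \<not> odd_crossing K c}"
proof -
  define f where "f x = (if crossing x \<in> classical_crossings K \<and> odd_crossing K (crossing x)
      then Passage (crossing x) Virtual (left_to_right x) else x)" for x
  have "crossing (f x) = crossing x" for x
    by (simp add: f_def)
  moreover have "level (f x) \<noteq> Virtual \<longleftrightarrow> level x \<noteq> Virtual \<and> \<not> odd_crossing K (crossing x)" if "x \<in> set K" for x
    using that by (auto simp: f_def classical_crossings_def)
  moreover have "virtualize_odd K = map f K"
    by (simp add: virtualize_odd_def f_def)
  moreover have "{x \<in> set (map f K). level x \<noteq> Virtual} = f ` {x \<in> set K. level (f x) \<noteq> Virtual}"
    by auto
  ultimately have "classical_crossings (virtualize_odd K) =
      crossing ` {x \<in> set K. level x \<noteq> Virtual \<and> \<not> odd_crossing K (crossing x)}"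
    unfolding classical_crossings_def by (auto simp: image_image cong: conj_cong)
  then show ?thesis
    by (auto simp: classical_crossings_def)
qed

definition even_crossings :: "diagram \<Rightarrow> nat set" where
  "even_crossings K = {c \<in> classical_crossings K. \<not> odd_crossing K c}"

text \<open>Making crossings virtual changes neither the names in the list nor the chords, only
  which chords are counted.\<close>

lemma odd_crossing_virtualize_odd: "odd_crossing (virtualize_odd K) = odd_wrt (even_crossings K) K"
  using occurs_at_cong[OF crossing_virtualize_odd[of K]]
  by (simp add: odd_crossing_eq_odd_wrt classical_virtualize_odd odd_wrt_def chords_intersect_def even_crossings_def fun_eq_iff)

lemma types_eq:
  "type0 K = {c \<in> classical_crossings K. odd_wrt (classical_crossings K) K c}"
  "type1 K = {c \<in> even_crossings K. odd_wrt (even_crossings K) K c}"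
  "type2 K = {c \<in> even_crossings K. \<not> odd_wrt (even_crossings K) K c}"
  by (auto simp: type0_def odd_crossing_eq_odd_wrt)
    (auto simp: type1_def type2_def even_crossings_def odd_crossing_virtualize_odd)

lemma classical_subset: "classical_crossings K \<subseteq> crossings K"
  by (auto simp: classical_crossings_def)

lemma even_subset: "even_crossings K \<subseteq> classical_crossings K"
  by (auto simp: even_crossings_def)

section \<open>Units and relations of the coefficient ring\<close>

lift_definition ring_t_inv :: knot_ring is "Poly_Mapping.single (- 1, 0, 0, 0) 1" .
lift_definition ring_p_inv :: knot_ring is "Poly_Mapping.single (0, 0, - 1, 0) 1" .

lemma knot_rel_refl: "knot_rel f f"
  by (rule equivp_reflp[OF equivp_knot_rel])

lemma ring_t_inverse: "ring_t * ring_t_inv = 1"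
proof transfer
  have "laurent_t * Poly_Mapping.single (- 1, 0, 0, 0) 1 = 1"
    unfolding laurent_t_def single_one[symmetric] mult_single by (simp add: zero_prod_def)
  then show "knot_rel (laurent_t * Poly_Mapping.single (- 1, 0, 0, 0) 1) 1"
    by (simp add: knot_rel_refl)
qed

lemma ring_p_inverse: "ring_p * ring_p_inv = 1"
proof transfer
  have "laurent_p * Poly_Mapping.single (0, 0, - 1, 0) 1 = 1"
    unfolding laurent_p_def single_one[symmetric] mult_single by (simp add: zero_prod_def)
  then show "knot_rel (laurent_p * Poly_Mapping.single (0, 0, - 1, 0) 1) 1"
    by (simp add: knot_rel_refl)
qed

lemma ring_q_p: "ring_q * ring_p = ring_q * ring_t"
proof transfer
  show "knot_rel (laurent_q * laurent_p) (laurent_q * laurent_t)"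
    unfolding knot_rel_def relator1_def
    by (rule exI[of _ 1], rule exI[of _ 0]) (simp add: right_diff_distrib)
qed

lemma ring_q_q: "ring_q * ring_q = (1 - ring_t) * (1 - ring_p)"
proof transfer
  show "knot_rel (laurent_q * laurent_q) ((1 - laurent_t) * (1 - laurent_p))"
    unfolding knot_rel_def relator2_def
    by (rule exI[of _ 0], rule exI[of _ 1]) (simp add: power2_eq_square)
qed

text \<open>The label \<open>-1\<close> of the left under-branch is the same for types 1 and 2 and
  is built into \<open>passage_row\<close>. Stated by relative parities, so that colours decide how
  a kind changes under a move.\<close>

definition crossing_kind :: "diagram \<Rightarrow> nat \<Rightarrow> kind" where
  "crossing_kind K c =
     (if c \<notin> classical_crossings K then Through
      else if odd_wrt (classical_crossings K) K c then Shift
      else if odd_wrt (even_crossings K) K c then Skein ring_p ring_q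
      else Skein ring_t (1 - ring_t))"

lemma even_crossings_eq: "even_crossings K = {c \<in> classical_crossings K. \<not> odd_wrt (classical_crossings K) K c}"
  by (simp add: even_crossings_def odd_crossing_eq_odd_wrt)

lemma classical_iff:
  assumes "well_formed K" "x \<in> set K"
  shows "crossing x \<in> classical_crossings K \<longleftrightarrow> level x \<noteq> Virtual"
proof
  assume "crossing x \<in> classical_crossings K"
  then obtain y where y: "y \<in> set K" "crossing y = crossing x" "level y \<noteq> Virtual"
    by (auto simp: classical_crossings_def)
  then show "level x \<noteq> Virtual"
    using well_formed_partner(2)[OF assms(1) y(1) assms(2)] by (cases "x = y") auto
qed (use assms in \<open>auto simp: classical_crossings_def\<close>)

lemma colour_Nil [simp]: "colour [] x = False"
  by (simp add: colour_def)

lemma colour_Cons [simp]: "colour (y # L) x \<longleftrightarrow> x \<noteq> y \<and> \<not> colour L x"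
  by (auto simp: colour_def)

lemma colour_append [simp]:
  "colour (A @ B) x = (if x \<in> set A then colour A x else odd (length A) \<noteq> colour B x)"
  by (auto simp: colour_def takeWhile_append)

text \<open>Only the comparison of the two colours of a crossing has to be preserved. The colours
  themselves may change, as they do when the base point moves.\<close>

lemma odd_wrt_eqI:
  assumes wf: "well_formed K" "well_formed K'" and S: "S \<subseteq> crossings K" "S' \<subseteq> crossings K'" "c \<in> S" "c \<in> S'"
    and sub: "\<And>x. x \<in> set K' \<Longrightarrow> crossing x = c \<Longrightarrow> x \<in> set K"
    and eq: "\<And>x y. x \<in> set K' \<Longrightarrow> y \<in> set K' \<Longrightarrow> x \<noteq> y \<Longrightarrow> crossing x = c \<Longrightarrow> crossing y = c \<Longrightarrow>
      (colour (filter (\<lambda>z. crossing z \<in> S) K) x = colour (filter (\<lambda>z. crossing z \<in> S) K) y) =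
      (colour (filter (\<lambda>z. crossing z \<in> S') K') x = colour (filter (\<lambda>z. crossing z \<in> S') K') y)"
  shows "odd_wrt S K c = odd_wrt S' K' c"
proof -
  obtain x where x: "x \<in> set K'" "crossing x = c"
    using S by auto
  obtain y where y: "y \<in> set K'" "y \<noteq> x" "crossing y = c"
    using well_formed_partner_exists[OF wf(2) x(1)] x(2) by metis
  show ?thesis
    using odd_wrt_iff_colour[OF wf(1) S(1), of x y] odd_wrt_iff_colour[OF wf(2) S(2), of x y]
      eq[of x y] S(3,4) sub x y by simp
qed

lemma even_length_filter:
  assumes "well_formed K" "S \<subseteq> crossings K"
  shows "even (length (filter (\<lambda>z. crossing z \<in> S) K))"
proof -
  have "finite S"
    using assms(2) finite_subset by blast
  moreover have "length (filter (\<lambda>z. crossing z = d) K) = 2" if "d \<in> S" for d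
  proof -
    have "d \<in> crossings K"
      using assms(2) that by blast
    then obtain x y where "filter (\<lambda>z. crossing z = d) K = [x, y]"
      using assms(1) unfolding well_formed_def by blast
    then show ?thesis
      by simp
  qed
  ultimately show ?thesis
    by (simp add: length_filter_eq_sum)
qed

lemma crossing_kind_eqI:
  assumes "classical_crossings K = classical_crossings K'"
    and "\<And>S c. S \<subseteq> classical_crossings K \<Longrightarrow> c \<in> S \<Longrightarrow> odd_wrt S K c = odd_wrt S K' c"
  shows "crossing_kind K = crossing_kind K'"
proof -
  have cl: "odd_wrt (classical_crossings K) K c = odd_wrt (classical_crossings K) K' c" if "c \<in> classical_crossings K" for c
    using assms(2) that by blast
  then have ev: "even_crossings K = even_crossings K'"
    using assms(1) by (auto simp: even_crossings_eq)
  have "odd_wrt (even_crossings K) K c = odd_wrt (even_crossings K) K' c" if "c \<in> even_crossings K" for c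
    using assms(2) that by (simp add: even_subset)
  then show ?thesis
    using cl assms(1) ev by (auto simp: crossing_kind_def fun_eq_iff even_crossings_eq)
qed

text \<open>If the first passage counts, moving it to the end lowers all other positions by one, and
  its own position goes from 0 to the number of the others, which is odd because the code has even
  length. So every colour flips.\<close>

lemma crossing_kind_rotate1:
  assumes "well_formed K" "well_formed (rotate1 K)"
  shows "crossing_kind (rotate1 K) = crossing_kind K"
proof (rule crossing_kind_eqI)
  show "classical_crossings (rotate1 K) = classical_crossings K"
    by (simp add: classical_crossings_def)
  fix S c assume S: "S \<subseteq> classical_crossings (rotate1 K)" "c \<in> S"
  then have S': "S \<subseteq> crossings K"
    using classical_subset[of "rotate1 K"] by simp
  show "odd_wrt S (rotate1 K) c = odd_wrt S K c"
  proof (rule odd_wrt_eqI[OF assms(2,1)])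
    fix x y assume xy: "x \<in> set K" "y \<in> set K" "x \<noteq> y" "crossing x = c" "crossing y = c"
    show "(colour (filter (\<lambda>z. crossing z \<in> S) (rotate1 K)) x = colour (filter (\<lambda>z. crossing z \<in> S) (rotate1 K)) y) =
      (colour (filter (\<lambda>z. crossing z \<in> S) K) x = colour (filter (\<lambda>z. crossing z \<in> S) K) y)"
    proof (cases K)
      case (Cons z A)
      let ?B = "filter (\<lambda>z. crossing z \<in> S) A"
      have "distinct K"
        using assms(1) by (rule well_formed_distinct)
      moreover have "odd (length ?B)" if "crossing z \<in> S"
        using even_length_filter[OF assms(1) S'] Cons that by simp
      ultimately show ?thesis
        using xy S(2) Cons by (cases "crossing z \<in> S") auto
    qed (use xy in simp)
  qed (use S S' in simp_all)
qed

lemma crossing_kind_rename: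
  assumes "inj_on f (crossings K)" "c \<in> crossings K"
  shows "crossing_kind (map (rename_passage f) K) (f c) = crossing_kind K c"
proof -
  let ?K = "map (rename_passage f) K"
  have g: "crossing (rename_passage f x) = f (crossing x)" "level (rename_passage f x) = level x" for x
    by (cases x; simp)+
  have cl: "classical_crossings ?K = f ` classical_crossings K"
  proof -
    have "{x \<in> set ?K. level x \<noteq> Virtual} = rename_passage f ` {x \<in> set K. level x \<noteq> Virtual}"
      by (auto simp: g)
    then show ?thesis
      by (simp add: classical_crossings_def image_image g)
  qed
  have occ: "occurs_at ?K (f d) i = occurs_at K d i" if "d \<in> crossings K" for d i
  proof (cases "i < length K")
    case True
    then have "crossing (K ! i) \<in> crossings K"
      by simp
    then have "f (crossing (K ! i)) = f d \<longleftrightarrow> crossing (K ! i) = d"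
      using inj_on_eq_iff[OF assms(1) _ that] by blast
    then show ?thesis
      using True by (simp add: occurs_at_def g)
  qed (simp add: occurs_at_def)
  have odd: "odd_wrt (f ` S) ?K (f d) = odd_wrt S K d" if "S \<subseteq> crossings K" "d \<in> crossings K" for S d
  proof -
    have "{e \<in> f ` S. e \<noteq> f d \<and> chords_intersect ?K (f d) e} = f ` {e \<in> S. e \<noteq> d \<and> chords_intersect K d e}"
    proof -
      have "f e \<noteq> f d \<and> chords_intersect ?K (f d) (f e) \<longleftrightarrow> e \<noteq> d \<and> chords_intersect K d e" if "e \<in> S" for e
      proof -
        have "e \<in> crossings K"
          using that \<open>S \<subseteq> crossings K\<close> by blast
        then show ?thesis
          using \<open>d \<in> crossings K\<close> inj_on_eq_iff[OF assms(1)] by (simp add: chords_intersect_def occ)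
      qed
      then show ?thesis
        by auto
    qed
    moreover have "inj_on f {e \<in> S. e \<noteq> d \<and> chords_intersect K d e}"
      using assms(1) by (rule inj_on_subset) (use that in blast)
    ultimately show ?thesis
      by (simp add: odd_wrt_def card_image)
  qed
  have cl_sub: "classical_crossings K \<subseteq> crossings K" "even_crossings K \<subseteq> crossings K"
    using classical_subset even_subset by blast+
  have mem: "f d \<in> f ` S \<longleftrightarrow> d \<in> S" if "S \<subseteq> crossings K" "d \<in> crossings K" for S d
    using inj_on_image_mem_iff[OF assms(1) that(2,1)] .
  have "f d \<in> even_crossings ?K \<longleftrightarrow> d \<in> even_crossings K" if "d \<in> crossings K" for d
    unfolding even_crossings_eq mem_Collect_eq cl mem[OF cl_sub(1) that] odd[OF cl_sub(1) that] ..
  note * = this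
  have ev: "even_crossings ?K = f ` even_crossings K"
  proof
    show "even_crossings ?K \<subseteq> f ` even_crossings K"
    proof
      fix e assume e: "e \<in> even_crossings ?K"
      then obtain d where "d \<in> classical_crossings K" "e = f d"
        using even_subset[of ?K] cl by auto
      then show "e \<in> f ` even_crossings K"
        using *[of d] e cl_sub(1) by auto
    qed
    show "f ` even_crossings K \<subseteq> even_crossings ?K"
    proof
      fix e assume "e \<in> f ` even_crossings K"
      then obtain d where "d \<in> even_crossings K" "e = f d"
        by auto
      then show "e \<in> even_crossings ?K"
        using *[of d] cl_sub(2) by auto
    qed
  qed
  show ?thesis
    unfolding crossing_kind_def cl ev
      mem[OF cl_sub(1) assms(2)] odd[OF cl_sub(1) assms(2)] odd[OF cl_sub(2) assms(2)] ..
qed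

section \<open>Invariance under the moves\<close>

text \<open>All sets \<open>S\<close> whose parities enter consist of classical crossings, so the
  restricted codes contain classical passages only.\<close>

lemma crossing_kind_filter_eq:
  assumes wf: "well_formed K" "well_formed K'"
    and eq: "filter (\<lambda>x. level x \<noteq> Virtual) K = filter (\<lambda>x. level x \<noteq> Virtual) K'"
  shows "crossing_kind K = crossing_kind K'"
proof (rule crossing_kind_eqI)
  have cl: "classical_crossings K = crossing ` set (filter (\<lambda>x. level x \<noteq> Virtual) K)" for K
    by (auto simp: classical_crossings_def)
  show cl_eq: "classical_crossings K = classical_crossings K'"
    unfolding cl eq ..
  fix S c assume S: "S \<subseteq> classical_crossings K" "c \<in> S"
  have filter: "filter (\<lambda>x. crossing x \<in> S) K = filter (\<lambda>x. crossing x \<in> S) (filter (\<lambda>x. level x \<noteq> Virtual) K)"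
    if "well_formed K" "S \<subseteq> classical_crossings K" for K
    unfolding filter_filter
  proof (rule filter_cong)
    fix x assume "x \<in> set K"
    then show "crossing x \<in> S \<longleftrightarrow> level x \<noteq> Virtual \<and> crossing x \<in> S"
      using classical_iff[OF that(1)] that(2) by blast
  qed simp
  have SS: "filter (\<lambda>x. crossing x \<in> S) K = filter (\<lambda>x. crossing x \<in> S) K'"
    unfolding filter[OF wf(1) S(1)] filter[OF wf(2) S(1)[unfolded cl_eq]] eq ..
  have sub: "S \<subseteq> crossings K" "S \<subseteq> crossings K'"
    using S(1) classical_subset cl_eq by (metis subset_trans)+
  have "x \<in> set K" if "x \<in> set K'" "crossing x = c" for x
  proof -
    have "x \<in> set (filter (\<lambda>x. crossing x \<in> S) K')"
      using that S(2) by simp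
    then show ?thesis
      unfolding SS[symmetric] by simp
  qed
  then show "odd_wrt S K c = odd_wrt S K' c"
    using odd_wrt_eqI[OF wf sub S(2) S(2)] SS by simp
qed

text \<open>Serves the first two moves, with \<open>D\<close> the crossings that disappear. They
  have a common parity in \<open>K\<close>, so the even crossings contain all of \<open>D\<close> or
  nothing of it, and removing \<open>D\<close> is compatible with passing to the second level of the
  hierarchy.\<close>

lemma crossing_kind_removal:
  assumes cl: "classical_crossings K = D \<union> classical_crossings K'" "D \<inter> classical_crossings K' = {}"
    and eq: "\<And>S c. S \<subseteq> classical_crossings K \<Longrightarrow> D \<subseteq> S \<or> D \<inter> S = {} \<Longrightarrow> c \<in> S \<Longrightarrow> c \<notin> D \<Longrightarrow>
      odd_wrt S K c = odd_wrt (S - D) K' c"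
    and D: "(\<forall>c\<in>D. odd_wrt (classical_crossings K) K c) \<or> (\<forall>c\<in>D. \<not> odd_wrt (classical_crossings K) K c)"
    and c: "c \<notin> D"
  shows "crossing_kind K c = crossing_kind K' c"
proof -
  have diff: "classical_crossings K - D = classical_crossings K'"
    using cl by blast
  have 1: "odd_wrt (classical_crossings K) K d = odd_wrt (classical_crossings K') K' d"
    if "d \<in> classical_crossings K" "d \<notin> D" for d
    using eq[of "classical_crossings K" d] that cl(1) diff by simp
  have ev: "even_crossings K - D = even_crossings K'"
    unfolding even_crossings_eq using 1 diff by auto
  have "D \<subseteq> even_crossings K \<or> D \<inter> even_crossings K = {}"
    using D cl(1) by (auto simp: even_crossings_eq)
  then have 2: "odd_wrt (even_crossings K) K d = odd_wrt (even_crossings K') K' d"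
    if "d \<in> even_crossings K" "d \<notin> D" for d
    using eq[OF even_subset, of d] that ev by simp
  have "c \<in> classical_crossings K \<longleftrightarrow> c \<in> classical_crossings K'"
    using c cl by blast
  moreover have "c \<in> classical_crossings K \<Longrightarrow> \<not> odd_wrt (classical_crossings K) K c \<Longrightarrow> c \<in> even_crossings K"
    by (simp add: even_crossings_eq)
  ultimately show ?thesis
    using 1[of c] 2[of c] c by (auto simp: crossing_kind_def)
qed

text \<open>The two passages are neighbours in every restricted code that contains them, so their
  colours differ and the crossing is even at both levels, that is, of type 2. Deleting two
  neighbouring letters keeps the colours of the rest.\<close>

lemma crossing_kind_kink:
  assumes wf: "well_formed (x # y # u)" "well_formed u"
    and xy: "crossing x = crossing y" "level x \<noteq> Virtual" "level y \<noteq> Virtual"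
  shows "crossing x \<notin> crossings u"
    and "crossing_kind (x # y # u) (crossing x) = Skein ring_t (1 - ring_t)"
    and "c \<noteq> crossing x \<Longrightarrow> crossing_kind (x # y # u) c = crossing_kind u c"
proof -
  let ?K = "x # y # u" and ?D = "{crossing x}"
  have dist: "distinct ?K"
    by (rule well_formed_distinct[OF wf(1)])
  show notin: "crossing x \<notin> crossings u"
  proof
    assume "crossing x \<in> crossings u"
    then obtain z where "z \<in> set u" "crossing z = crossing x"
      by (metis imageE)
    then show False
      using well_formed_partner_unique[OF wf(1), of x y z] dist xy(1) by auto
  qed
  then have uz: "crossing z \<noteq> crossing x" if "z \<in> set u" for z
    using that by (metis image_eqI)
  then have filter_u: "filter (\<lambda>z. crossing z \<in> S - ?D) u = filter (\<lambda>z. crossing z \<in> S) u" for S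
    by (intro filter_cong) auto
  have cl: "classical_crossings ?K = ?D \<union> classical_crossings u"
    using xy by (auto simp: classical_crossings_def)
  have cl': "?D \<inter> classical_crossings u = {}"
    using notin classical_subset[of u] by auto
  have even: "\<not> odd_wrt S ?K (crossing x)" if "S \<subseteq> classical_crossings ?K" "crossing x \<in> S" for S
  proof -
    have "S \<subseteq> crossings ?K"
      using that(1) classical_subset by (rule subset_trans)
    then show ?thesis
      using odd_wrt_iff_colour[OF wf(1), of S x y] that xy dist by simp
  qed
  show "crossing_kind ?K (crossing x) = Skein ring_t (1 - ring_t)"
    using even[of "classical_crossings ?K"] even[OF even_subset] cl
    by (simp add: crossing_kind_def even_crossings_eq)
  show "crossing_kind ?K c = crossing_kind u c" if "c \<noteq> crossing x"
  proof (rule crossing_kind_removal[OF cl cl'])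
    fix S c assume S: "S \<subseteq> classical_crossings ?K" "c \<in> S" "c \<notin> ?D"
    show "odd_wrt S ?K c = odd_wrt (S - ?D) u c"
    proof (rule odd_wrt_eqI[OF wf])
      show "S \<subseteq> crossings ?K"
        using S(1) classical_subset by (rule subset_trans)
      show "S - ?D \<subseteq> crossings u"
        using S(1) cl classical_subset[of u] by auto
      fix z w assume zw: "z \<in> set u" "w \<in> set u"
      have "colour (filter (\<lambda>z. crossing z \<in> S) ?K) z = colour (filter (\<lambda>z. crossing z \<in> S) u) z" if "z \<in> set u" for z
        using that dist xy(1) by (cases "crossing y \<in> S") auto
      then show "(colour (filter (\<lambda>z. crossing z \<in> S) ?K) z = colour (filter (\<lambda>z. crossing z \<in> S) ?K) w) =
          (colour (filter (\<lambda>z. crossing z \<in> S - ?D) u) z = colour (filter (\<lambda>z. crossing z \<in> S - ?D) u) w)"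
        unfolding filter_u using zw by simp
    qed (use S in auto)
  qed (use even cl that in auto)
qed

lemma edge_det_reidemeister1:
  assumes wf: "well_formed (x # y # u)" "well_formed u"
    and xy: "crossing x = crossing y" "level x \<noteq> Virtual" "level y \<noteq> Virtual"
  shows "\<exists>k\<in>{1, ring_t}. edge_det (crossing_kind (x # y # u)) (x # y # u) \<simeq> k * edge_det (crossing_kind u) u"
proof -
  have dist: "distinct (x # y # u)"
    by (rule well_formed_distinct[OF wf(1)])
  have "edge_det (crossing_kind (x # y # u)) u = edge_det (crossing_kind u) u"
    using crossing_kind_kink(1,3)[OF wf xy] by (intro edge_det_cong) (metis image_eqI)
  moreover have "left_to_right x \<noteq> left_to_right y" "(level x, level y) \<in> {(Over, Under), (Under, Over)}"
    using well_formed_partner[OF wf(1), of x y] dist xy by auto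
  ultimately show ?thesis
    using edge_det_kink[OF dist, of "crossing_kind (x # y # u)" ring_t] crossing_kind_kink(1,2)[OF wf xy] xy(1) by simp
qed

text \<open>The overpasses are neighbours in the restricted code, and so are the underpasses.
  Whichever way the four are paired, the colours agree at one crossing iff they agree at the other,
  so both crossings have the same type.\<close>

lemma crossing_kind_bigon:
  assumes wf: "well_formed (x1 # x2 # u @ y1 # y2 # v)" "well_formed (u @ v)"
    and lev: "level x1 = Over" "level x2 = Over" "level y1 = Under" "level y2 = Under"
    and cr: "{crossing x1, crossing x2} = {crossing y1, crossing y2}"
  defines "K \<equiv> x1 # x2 # u @ y1 # y2 # v"
  shows "crossing x1 \<noteq> crossing x2"
    and "crossing x1 \<notin> crossings (u @ v)" "crossing x2 \<notin> crossings (u @ v)"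
    and "over_of y1 \<in> {x1, x2}" "over_of y2 \<in> {x1, x2}"
    and "crossing_kind K (crossing x1) = crossing_kind K (crossing x2)"
    and "crossing x1 \<in> classical_crossings K"
    and "c \<notin> {crossing x1, crossing x2} \<Longrightarrow> crossing_kind K c = crossing_kind (u @ v) c"
proof -
  let ?D = "{crossing x1, crossing x2}"
  note wfK = wf(1)[folded K_def]
  have dist: "distinct K"
    by (rule well_formed_distinct[OF wfK])
  have in_K: "x1 \<in> set K" "x2 \<in> set K" "y1 \<in> set K" "y2 \<in> set K"
    by (simp_all add: K_def)
  have neq: "x1 \<noteq> x2" "x1 \<noteq> y1" "x1 \<noteq> y2" "x2 \<noteq> y1" "x2 \<noteq> y2" "y1 \<noteq> y2"
    using dist by (auto simp: K_def)
  show cne: "crossing x1 \<noteq> crossing x2"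
    using well_formed_partner(2)[OF wfK in_K(1,2)] neq lev by auto
  have pair: "crossing x1 = crossing y1 \<and> crossing x2 = crossing y2 \<or> crossing x1 = crossing y2 \<and> crossing x2 = crossing y1"
    using cr by (auto simp: doubleton_eq_iff)
  have uv: "crossing z \<notin> ?D" if "z \<in> set (u @ v)" for z
  proof
    have z: "z \<in> set K" "z \<noteq> x1" "z \<noteq> x2" "z \<noteq> y1" "z \<noteq> y2"
      using that dist by (auto simp: K_def)
    assume "crossing z \<in> ?D"
    then have "crossing x1 = crossing z \<or> crossing x2 = crossing z"
      by auto
    then show False
      using pair well_formed_partner_unique[OF wfK in_K(1) _ z(1), of y1] well_formed_partner_unique[OF wfK in_K(1) _ z(1), of y2]
        well_formed_partner_unique[OF wfK in_K(2) _ z(1), of y1] well_formed_partner_unique[OF wfK in_K(2) _ z(1), of y2]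
        in_K z neq by metis
  qed
  then have notin: "crossing x1 \<notin> crossings (u @ v)" "crossing x2 \<notin> crossings (u @ v)"
    by (metis imageE insertI1, metis imageE insertI1 insertI2)
  then show "crossing x1 \<notin> crossings (u @ v)" "crossing x2 \<notin> crossings (u @ v)" .
  have over: "over_of y = x" if "crossing x = crossing y" "x \<in> {x1, x2}" "y \<in> {y1, y2}" for x y
    using well_formed_partner(1)[OF wfK, of x y] that in_K neq lev by (intro over_of_eqI) auto
  then show "over_of y1 \<in> {x1, x2}" "over_of y2 \<in> {x1, x2}"
    using pair by (metis insertI1 insertI2)+
  have cl: "classical_crossings K = ?D \<union> classical_crossings (u @ v)"
    using lev cr by (auto simp: classical_crossings_def K_def)
  have cl': "?D \<inter> classical_crossings (u @ v) = {}"
    using notin classical_subset[of "u @ v"] by blast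
  show "crossing x1 \<in> classical_crossings K"
    using cl by simp
  have y_in: "crossing y1 \<in> S \<and> crossing y2 \<in> S" if "?D \<subseteq> S" for S
    using that cr by auto
  have same: "odd_wrt S K (crossing x1) = odd_wrt S K (crossing x2)" if "S \<subseteq> classical_crossings K" "?D \<subseteq> S" for S
  proof -
    let ?f = "filter (\<lambda>z. crossing z \<in> S)"
    have S: "S \<subseteq> crossings K"
      using that(1) classical_subset by (rule subset_trans)
    have L: "?f K = x1 # x2 # ?f u @ y1 # y2 # ?f v"
      using that(2) y_in[OF that(2)] by (simp add: K_def)
    have col: "colour (?f K) x1 = False" "colour (?f K) x2 = True"
        "colour (?f K) y1 = odd (length (?f u))" "colour (?f K) y2 = even (length (?f u))"
      unfolding L using neq dist by (auto simp: K_def)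
    show ?thesis
      using pair
    proof (elim disjE conjE)
      assume "crossing x1 = crossing y1" "crossing x2 = crossing y2"
      then show ?thesis
        using odd_wrt_iff_colour[OF wfK S, of x1 y1] odd_wrt_iff_colour[OF wfK S, of x2 y2] that(2) in_K neq col by auto
    next
      assume "crossing x1 = crossing y2" "crossing x2 = crossing y1"
      then show ?thesis
        using odd_wrt_iff_colour[OF wfK S, of x1 y2] odd_wrt_iff_colour[OF wfK S, of x2 y1] that(2) in_K neq col by auto
    qed
  qed
  have D_cl: "?D \<subseteq> classical_crossings K"
    using cl by simp
  have both: "odd_wrt (classical_crossings K) K (crossing x1) = odd_wrt (classical_crossings K) K (crossing x2)"
    using same[OF subset_refl D_cl] .
  show "crossing_kind K (crossing x1) = crossing_kind K (crossing x2)"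
  proof (cases "odd_wrt (classical_crossings K) K (crossing x1)")
    case False
    then have "?D \<subseteq> even_crossings K"
      using both D_cl by (simp add: even_crossings_eq)
    then show ?thesis
      using both D_cl same[OF even_subset] by (simp add: crossing_kind_def)
  qed (use both D_cl in \<open>simp add: crossing_kind_def\<close>)
  show "crossing_kind K c = crossing_kind (u @ v) c" if "c \<notin> ?D"
  proof (rule crossing_kind_removal[OF cl cl'])
    fix S c assume S: "S \<subseteq> classical_crossings K" "?D \<subseteq> S \<or> ?D \<inter> S = {}" "c \<in> S" "c \<notin> ?D"
    let ?f = "filter (\<lambda>z. crossing z \<in> S)"
    have f: "filter (\<lambda>z. crossing z \<in> S - ?D) (u @ v) = ?f (u @ v)"
      using uv by (intro filter_cong) auto
    show "odd_wrt S K c = odd_wrt (S - ?D) (u @ v) c"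
    proof (rule odd_wrt_eqI[OF wfK wf(2)])
      show "S \<subseteq> crossings K"
        using S(1) classical_subset by (rule subset_trans)
      show "S - ?D \<subseteq> crossings (u @ v)"
        using S(1) cl classical_subset[of "u @ v"] by auto
      show "x \<in> set K" if "x \<in> set (u @ v)" for x
        using that by (auto simp: K_def)
      fix x y assume xy: "x \<in> set (u @ v)" "y \<in> set (u @ v)"
      have "colour (?f K) z = colour (?f (u @ v)) z" if "z \<in> set (u @ v)" for z
      proof -
        have z: "z \<noteq> x1" "z \<noteq> x2" "z \<noteq> y1" "z \<noteq> y2"
          using that dist by (auto simp: K_def)
        show ?thesis
        proof (cases "?D \<subseteq> S")
          case True
          then have "?f K = x1 # x2 # ?f u @ y1 # y2 # ?f v"
            using y_in[OF True] by (simp add: K_def)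
          then show ?thesis
            using z by simp
        next
          case False
          then have "crossing x1 \<notin> S" "crossing x2 \<notin> S" "crossing y1 \<notin> S" "crossing y2 \<notin> S"
            using S(2) pair by auto
          then have "?f K = ?f u @ ?f v"
            by (simp add: K_def)
          then show ?thesis
            by simp
        qed
      qed
      then show "(colour (?f K) x = colour (?f K) y) =
          (colour (filter (\<lambda>z. crossing z \<in> S - ?D) (u @ v)) x = colour (filter (\<lambda>z. crossing z \<in> S - ?D) (u @ v)) y)"
        unfolding f using xy by simp
    qed (use S in auto)
  qed (use both that in auto)
qed

lemma edge_det_reidemeister2:
  assumes wf: "well_formed (x1 # x2 # u @ y1 # y2 # v)" "well_formed (u @ v)"
    and lev: "level x1 = Over" "level x2 = Over" "level y1 = Under" "level y2 = Under"
    and cr: "{crossing x1, crossing x2} = {crossing y1, crossing y2}"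
    and ltr: "left_to_right x1 \<noteq> left_to_right x2"
  defines "K \<equiv> x1 # x2 # u @ y1 # y2 # v"
  shows "\<exists>k\<in>{1, ring_t, ring_p}. edge_det (crossing_kind K) K \<simeq> k * edge_det (crossing_kind (u @ v)) (u @ v)"
proof -
  note bigon = crossing_kind_bigon[OF wf lev cr, folded K_def]
  have dist: "distinct K"
    unfolding K_def by (rule well_formed_distinct[OF wf(1)])
  have uv: "edge_det (crossing_kind K) (u @ v) = edge_det (crossing_kind (u @ v)) (u @ v)"
    using bigon(2,3,8) by (intro edge_det_cong) (metis image_eqI insertE singletonD)
  have kind: "crossing_kind K (crossing x1) = Shift \<or> crossing_kind K (crossing x1) = Skein ring_p ring_q \<or>
      crossing_kind K (crossing x1) = Skein ring_t (1 - ring_t)"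
    using bigon(7) by (auto simp: crossing_kind_def)
  have "\<exists>k\<in>{1, \<alpha>}. edge_det (crossing_kind K) K \<simeq> k * edge_det (crossing_kind K) (u @ v)"
    if "crossing_kind K (crossing x1) = Shift \<and> \<alpha> = 1 \<or> crossing_kind K (crossing x1) = Skein \<alpha> \<beta>" "\<alpha> * \<alpha>' = 1" for \<alpha> \<beta> \<alpha>'
    unfolding K_def
    by (rule edge_det_bigon[OF dist[unfolded K_def] lev cr bigon(1) ltr bigon(4,5,2,3) refl]) 
      (use bigon(6) that in \<open>simp_all add: K_def\<close>)
  note * = this
  show ?thesis
    using kind *[of 1 _ 1] *[of ring_p ring_q ring_p_inv] *[of ring_t "1 - ring_t" ring_t_inv]
      ring_p_inverse ring_t_inverse uv by auto
qed

text \<open>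
  Going around a triangle in a fixed sense, \<open>b\<close> tells whether a side is traversed along its orientation;
  \<open>\<kappa>\<close> records the sense.
\<close>

definition meets :: "bool \<Rightarrow> passage \<Rightarrow> passage \<Rightarrow> bool \<Rightarrow> passage \<Rightarrow> passage \<Rightarrow> bool \<Rightarrow> bool" where
  "meets \<kappa> x1 x2 bx y1 y2 b\<^sub>y \<longleftrightarrow> (let xe = (if bx then x2 else x1); ys = (if b\<^sub>y then y1 else y2) in
     crossing xe = crossing ys \<and> left_to_right xe = ((bx = b\<^sub>y) = \<kappa>) \<and> left_to_right ys \<noteq> left_to_right xe)"

lemma meets_flip: "meets \<kappa> x1 x2 bx y1 y2 b\<^sub>y \<Longrightarrow> meets (\<not> \<kappa>) y1 y2 (\<not> b\<^sub>y) x1 x2 (\<not> bx)"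
  by (cases bx; cases b\<^sub>y; cases \<kappa>; simp add: meets_def)

definition triangle :: "bool \<Rightarrow> passage \<Rightarrow> passage \<Rightarrow> bool \<Rightarrow> passage \<Rightarrow> passage \<Rightarrow> bool \<Rightarrow> passage \<Rightarrow> passage \<Rightarrow> bool \<Rightarrow> bool" where
  "triangle \<kappa> x1 x2 b1 y1 y2 b2 z1 z2 b3 \<longleftrightarrow>
     meets \<kappa> x1 x2 b1 y1 y2 b2 \<and> meets \<kappa> y1 y2 b2 z1 z2 b3 \<and> meets \<kappa> z1 z2 b3 x1 x2 b1"

lemma triangle_flip: "triangle \<kappa> x1 x2 b1 y1 y2 b2 z1 z2 b3 \<Longrightarrow> triangle (\<not> \<kappa>) x1 x2 (\<not> b1) z1 z2 (\<not> b3) y1 y2 (\<not> b2)"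
  unfolding triangle_def by (intro conjI; rule meets_flip; simp)

section \<open>Triangular faces as orbits of \<open>face_step\<close>\<close>

lemma partner_eq:
  assumes "well_formed K" "i < length K"
  shows "partner K i < length K \<and> partner K i \<noteq> i \<and> crossing (K ! partner K i) = crossing (K ! i)"
proof -
  have "crossing (K ! i) \<in> crossings K"
    using assms(2) by simp
  then obtain p q where pq: "p < q" "\<And>l. occurs_at K (crossing (K ! i)) l \<longleftrightarrow> l = p \<or> l = q"
    by (rule occurs_at_iff[OF assms(1)]) blast
  have "i = p \<or> i = q"
    using pq(2)[of i] assms(2) by (simp add: occurs_at_def)
  then obtain j where j: "j \<noteq> i" "\<And>l. occurs_at K (crossing (K ! i)) l \<longleftrightarrow> l = i \<or> l = j"
    using pq by (metis less_irrefl)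
  have "\<exists>!j. j < length K \<and> j \<noteq> i \<and> crossing (K ! j) = crossing (K ! i)"
  proof (rule ex1I[of _ j])
    show "j < length K \<and> j \<noteq> i \<and> crossing (K ! j) = crossing (K ! i)"
      using j(1) j(2)[of j] by (simp add: occurs_at_def)
    fix l assume "l < length K \<and> l \<noteq> i \<and> crossing (K ! l) = crossing (K ! i)"
    then show "l = j"
      using j(2)[of l] by (simp add: occurs_at_def)
  qed
  then show ?thesis
    unfolding partner_def by (rule theI')
qed

text \<open>A left turn continues along the orientation of the other strand iff the traversal
  crosses that strand from left to right.\<close>

lemma face_step_meets:
  assumes wf: "well_formed K" and L: "Suc e < length K" "Suc e' < length K"
    and step: "face_step K (e, b) = (e', b')"
  shows "meets True (K ! e) (K ! Suc e) b (K ! e') (K ! Suc e') b'"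
proof -
  define i where "i = (if b then Suc e else e)"
  have i: "i < length K"
    using L by (simp add: i_def)
  have mod: "(e + 1) mod length K = Suc e"
    using L by simp
  define j where "j = partner K i"
  have j: "j < length K" "j \<noteq> i" "crossing (K ! j) = crossing (K ! i)"
    using partner_eq[OF wf i] by (simp_all add: j_def)
  have fs: "face_step K (e, b) = (if left_to_right (K ! i) = b then (j, True) else ((j + length K - 1) mod length K, False))"
    unfolding face_step_def Let_def i_def j_def by (simp add: mod L(1))
  have ltr: "left_to_right (K ! i) = (b = b')"
    using step unfolding fs by (auto split: if_splits)
  have j': "j = (if b' then e' else Suc e')"
  proof (cases "left_to_right (K ! i) = b")
    case True
    then show ?thesis
      using step unfolding fs by auto
  next
    case False
    then have *: "(j + length K - 1) mod length K = e'" "\<not> b'"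
      using step unfolding fs by auto
    \<comment> \<open>For \<open>j = 0\<close> the step would lead to the edge that closes the list
      up to a circle, which \<open>L(2)\<close> excludes.\<close>
    have "j \<noteq> 0"
    proof
      assume "j = 0"
      then have "length K - 1 = e'"
        using * j(1) by simp
      then show False
        using L(2) by simp
    qed
    then have "(j + length K - 1) mod length K = j - 1"
      using j(1) by (simp add: Nat.add_diff_assoc2 mod_if)
    then show ?thesis
      using * \<open>j \<noteq> 0\<close> by simp
  qed
  have "K ! j \<noteq> K ! i"
    using well_formed_distinct[OF wf] i j by (simp add: nth_eq_iff_index_eq)
  then have "left_to_right (K ! j) \<noteq> left_to_right (K ! i)"
    using well_formed_partner(1)[OF wf, of "K ! j" "K ! i"] i j by simp
  then show ?thesis
    using ltr j(3) unfolding meets_def Let_def j' i_def by auto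
qed

text \<open>A set that contains \<open>f s\<close> and is closed under \<open>f\<close> contains the
  whole orbit. Each map other than the two cyclic ones would have a closed set that is too
  small.\<close>

lemma orbit_three:
  assumes orb: "orbit f s = {s, t, r}" and d: "s \<noteq> t" "s \<noteq> r" "t \<noteq> r"
  shows "f s = t \<and> f t = r \<and> f r = s \<or> f s = r \<and> f r = t \<and> f t = s"
proof -
  have s: "s \<in> orbit f s"
    using orb by simp
  have closed: "f x \<in> {s, t, r}" if "x \<in> {s, t, r}" for x
    using that orbit.step[of _ f s] unfolding orb by blast
  have min: "orbit f s \<subseteq> A" if "f s \<in> A" "\<And>x. x \<in> A \<Longrightarrow> f x \<in> A" for A
  proof
    fix x assume "x \<in> orbit f s"
    then show "x \<in> A"
      by induction (use that in auto)
  qed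
  have 1: "f s \<noteq> s"
    using min[of "{s}"] orb d by auto
  have 2: "f t \<noteq> t" if "f s = t"
    using min[of "{t}"] orb d that by auto
  have 3: "f r \<noteq> r" if "f s = r"
    using min[of "{r}"] orb d that by auto
  have 4: "f t \<noteq> s" if "f s = t"
    using min[of "{s, t}"] orb d that by auto
  have 5: "f r \<noteq> s" if "f s = r"
    using min[of "{s, r}"] orb d that by auto
  have 6: "f r \<noteq> r" "f r \<noteq> t" if "f s = t" "f t = r"
    using min[of "{t, r}"] orb d that by auto
  have 7: "f t \<noteq> t" "f t \<noteq> r" if "f s = r" "f r = t"
    using min[of "{t, r}"] orb d that by auto
  show ?thesis
    using closed[of s] closed[of t] closed[of r] 1 2 3 4 5 6 7 by (simp, metis)
qed

text \<open>The face may visit the second and third strand in either order. If the order is the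
  other one, the triangle is traversed backwards, which negates \<open>\<kappa>\<close>.\<close>

lemma reidemeister3_triangle:
  assumes wf: "well_formed K" and K: "K = [x1, x2] @ u @ [y1, y2] @ v @ [z1, z2] @ w"
    and orb: "orbit (face_step K) (0, b1) = {(0, b1), (length u + 2, b2), (length u + length v + 4, b3)}"
  obtains \<kappa> b1 b2 b3 where "triangle \<kappa> x1 x2 b1 y1 y2 b2 z1 z2 b3"
proof -
  have nth: "K ! 0 = x1" "K ! Suc 0 = x2" "K ! (length u + 2) = y1" "K ! Suc (length u + 2) = y2"
      "K ! (length u + length v + 4) = z1" "K ! Suc (length u + length v + 4) = z2"
    unfolding K by (simp_all add: nth_append nth_Cons')
  have len: "Suc 0 < length K" "Suc (length u + 2) < length K" "Suc (length u + length v + 4) < length K"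
    unfolding K by simp_all
  note meets = face_step_meets[OF wf]
  have "face_step K (0, b1) = (length u + 2, b2) \<and>
      face_step K (length u + 2, b2) = (length u + length v + 4, b3) \<and>
      face_step K (length u + length v + 4, b3) = (0, b1) \<or>
      face_step K (0, b1) = (length u + length v + 4, b3) \<and>
      face_step K (length u + length v + 4, b3) = (length u + 2, b2) \<and>
      face_step K (length u + 2, b2) = (0, b1)"
    by (rule orbit_three[OF orb]) simp_all
  then show thesis
  proof (elim disjE conjE)
    assume *: "face_step K (0, b1) = (length u + 2, b2)"
      "face_step K (length u + 2, b2) = (length u + length v + 4, b3)"
      "face_step K (length u + length v + 4, b3) = (0, b1)"
    have "triangle True x1 x2 b1 y1 y2 b2 z1 z2 b3"
      using meets[OF len(1,2) *(1)] meets[OF len(2,3) *(2)] meets[OF len(3,1) *(3)]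
      unfolding triangle_def nth by blast
    then show thesis
      by (rule that)
  next
    assume *: "face_step K (0, b1) = (length u + length v + 4, b3)"
      "face_step K (length u + length v + 4, b3) = (length u + 2, b2)"
      "face_step K (length u + 2, b2) = (0, b1)"
    have "triangle True x1 x2 b1 z1 z2 b3 y1 y2 b2"
      using meets[OF len(1,3) *(1)] meets[OF len(3,2) *(2)] meets[OF len(2,1) *(3)]
      unfolding triangle_def nth by blast
    then show thesis
      by (rule that[OF triangle_flip])
  qed
qed

locale reidemeister3_setup =
  fixes K K' u v w :: diagram and x1 x2 y1 y2 z1 z2 :: passage and \<kappa> b1 b2 b3 :: bool
  assumes K_def: "K = x1 # x2 # u @ y1 # y2 # v @ z1 # z2 # w"
    and K'_def: "K' = x2 # x1 # u @ y2 # y1 # v @ z2 # z1 # w"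
    and wf: "well_formed K" "well_formed K'"
    and triangle: "triangle \<kappa> x1 x2 b1 y1 y2 b2 z1 z2 b3"
    and x_over: "level x1 = Over" "level x2 = Over"
    and bottom: "level y1 = Under \<and> level y2 = Under \<or> level z1 = Under \<and> level z2 = Under"
begin

text \<open>The endings \<open>s\<close> and \<open>e\<close> mark the start and the end of a side
  in the sense of traversal. The three crossings of the triangle are represented by
  \<open>xe\<close>, \<open>ye\<close> and \<open>ze\<close>.\<close>

definition "xs = (if b1 then x1 else x2)"
definition "xe = (if b1 then x2 else x1)"
definition "ys = (if b2 then y1 else y2)"
definition "ye = (if b2 then y2 else y1)"
definition "zs = (if b3 then z1 else z2)"
definition "ze = (if b3 then z2 else z1)"

lemmas strand_defs = xs_def xe_def ys_def ye_def zs_def ze_def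

lemma dist: "distinct K"
  by (rule well_formed_distinct[OF wf(1)])

lemma cr: "crossing xe = crossing ys" "crossing ye = crossing zs" "crossing ze = crossing xs"
  using triangle by (simp_all add: triangle_def meets_def Let_def strand_defs)

lemma ltr_e: "left_to_right xe = ((b1 = b2) = \<kappa>)" "left_to_right ye = ((b2 = b3) = \<kappa>)" "left_to_right ze = ((b3 = b1) = \<kappa>)"
  using triangle unfolding triangle_def meets_def Let_def strand_defs by blast+

lemma ltr_s: "left_to_right ys \<noteq> left_to_right xe" "left_to_right zs \<noteq> left_to_right ye" "left_to_right xs \<noteq> left_to_right ze"
  using triangle unfolding triangle_def meets_def Let_def strand_defs by blast+

lemma in_K: "xs \<in> set K" "xe \<in> set K" "ys \<in> set K" "ye \<in> set K" "zs \<in> set K" "ze \<in> set K"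
  by (simp_all add: strand_defs K_def)

lemma pairs: "{x1, x2} = {xs, xe}" "{y1, y2} = {ys, ye}" "{z1, z2} = {zs, ze}"
  by (auto simp: strand_defs)

lemma neq6: "distinct [x1, x2, y1, y2, z1, z2]"
  using dist by (auto simp: K_def)

lemma neq: "distinct [xs, xe, ys, ye, zs, ze]"
  unfolding strand_defs using neq6 by (cases b1; cases b2; cases b3; auto)

lemma rest_notin: "p \<in> set u \<union> set v \<union> set w \<Longrightarrow> p \<notin> {x1, x2, y1, y2, z1, z2}"
  using dist by (auto simp: K_def)

lemma six_eq: "{x1, x2, y1, y2, z1, z2} = {xs, xe, ys, ye, zs, ze}"
  using pairs by auto

lemma cr_unique:
  assumes "a \<in> set K" "b \<in> set K" "c \<in> set K" "crossing a = crossing b" "crossing a = crossing c" "a \<noteq> b" "a \<noteq> c"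
  shows "b = c"
  using well_formed_partner_unique[OF wf(1)] assms by blast

lemma cr_rest:
  assumes "p \<in> set u \<union> set v \<union> set w"
  shows "crossing p \<notin> {crossing xe, crossing ye, crossing ze}"
proof -
  have p: "p \<in> set K" "p \<noteq> xs" "p \<noteq> xe" "p \<noteq> ys" "p \<noteq> ye" "p \<noteq> zs" "p \<noteq> ze"
    using assms rest_notin[OF assms] unfolding six_eq by (auto simp: K_def)
  show ?thesis
    using cr_unique[of xe ys p] cr_unique[of ye zs p] cr_unique[of ze xs p] in_K cr neq p by auto
qed

lemma cr_set: "{crossing x1, crossing x2} = {crossing ze, crossing xe}" "{crossing y1, crossing y2} = {crossing xe, crossing ye}"
    "{crossing z1, crossing z2} = {crossing ye, crossing ze}"
proof -
  have "crossing ` {x1, x2} = crossing ` {xs, xe}" "crossing ` {y1, y2} = crossing ` {ys, ye}"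
      "crossing ` {z1, z2} = crossing ` {zs, ze}"
    using pairs by simp_all
  then show "{crossing x1, crossing x2} = {crossing ze, crossing xe}" "{crossing y1, crossing y2} = {crossing xe, crossing ye}"
    "{crossing z1, crossing z2} = {crossing ye, crossing ze}"
    using cr by simp_all
qed

lemma cr_rest6:
  assumes "p \<in> set u \<union> set v \<union> set w"
  shows "crossing p \<notin> {crossing x1, crossing x2, crossing y1, crossing y2, crossing z1, crossing z2}"
proof -
  have "{crossing x1, crossing x2, crossing y1, crossing y2, crossing z1, crossing z2} =
      {crossing x1, crossing x2} \<union> {crossing y1, crossing y2} \<union> {crossing z1, crossing z2}"
    by auto
  then show ?thesis
    using cr_rest[OF assms] by (simp add: cr_set)
qed

text \<open>Every crossing of the triangle lies on the top or on the bottom strand, whose levels are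
  given, and well-formedness then determines its other passage. In particular none is
  virtual.\<close>

lemma levels: "(level xe, level ys) \<in> {(Over, Under), (Under, Over)}" "(level ye, level zs) \<in> {(Over, Under), (Under, Over)}"
    "(level ze, level xs) \<in> {(Over, Under), (Under, Over)}"
proof -
  have x: "level xs = Over" "level xe = Over"
    using x_over by (simp_all add: strand_defs)
  have yz: "level ys = Under \<and> level ye = Under \<or> level zs = Under \<and> level ze = Under"
    using bottom by (auto simp: strand_defs)
  have wf_pair: "(level a, level b) \<in> {(Over, Under), (Under, Over), (Virtual, Virtual)}"
    if "a \<in> set K" "b \<in> set K" "crossing a = crossing b" "a \<noteq> b" for a b
    using well_formed_partner(2)[OF wf(1) that] .
  show "(level xe, level ys) \<in> {(Over, Under), (Under, Over)}"
    using wf_pair[of xe ys] in_K cr neq x by auto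
  show "(level ze, level xs) \<in> {(Over, Under), (Under, Over)}"
    using wf_pair[of ze xs] in_K cr neq x by auto
  show "(level ye, level zs) \<in> {(Over, Under), (Under, Over)}"
    using wf_pair[of ye zs] in_K cr neq yz by auto
qed

lemma set_K': "set K' = set K"
  by (auto simp: K_def K'_def)

lemma classical_K': "classical_crossings K' = classical_crossings K"
  by (simp add: classical_crossings_def set_K')

lemma cr_classical: "{crossing xe, crossing ye, crossing ze} \<subseteq> classical_crossings K"
  using levels in_K classical_iff[OF wf(1)] by fastforce

context
  fixes S
  assumes S: "S \<subseteq> classical_crossings K"
begin

abbreviation (input) "L \<equiv> filter (\<lambda>p. crossing p \<in> S) K"
abbreviation (input) "L' \<equiv> filter (\<lambda>p. crossing p \<in> S) K'"

lemma S_crossings: "S \<subseteq> crossings K" "S \<subseteq> crossings K'"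
  using S classical_subset[of K] by (auto simp: set_K')

lemma cr_in_S: "{crossing xe, crossing ye, crossing ze} \<subseteq> S \<Longrightarrow>
    crossing x1 \<in> S \<and> crossing x2 \<in> S \<and> crossing y1 \<in> S \<and> crossing y2 \<in> S \<and> crossing z1 \<in> S \<and> crossing z2 \<in> S"
  using cr_set by (metis insert_subset)

text \<open>All six passages belong to the restricted code, and each strand interchanges two
  neighbours; nothing else moves.\<close>

lemma colour_flip:
  assumes "{crossing xe, crossing ye, crossing ze} \<subseteq> S" "p \<in> set K"
  shows "colour L' p = (colour L p \<noteq> (p \<in> {x1, x2, y1, y2, z1, z2}))"
  using cr_in_S[OF assms(1)] dist assms(2) by (auto simp: K_def K'_def)

text \<open>Either both passages of a crossing belong to the triangle or neither does, so the flips
  cancel when their colours are compared.\<close>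

lemma odd_wrt_flip:
  assumes "{crossing xe, crossing ye, crossing ze} \<subseteq> S" "c \<in> S"
  shows "odd_wrt S K' c = odd_wrt S K c"
proof (rule odd_wrt_eqI[OF wf(2,1) S_crossings(2,1) assms(2,2)])
  fix p q assume pq: "p \<in> set K" "q \<in> set K" "p \<noteq> q" "crossing p = c" "crossing q = c"
  have six: "p \<in> {x1, x2, y1, y2, z1, z2} \<longleftrightarrow> crossing p \<in> {crossing xe, crossing ye, crossing ze}" if "p \<in> set K" for p
  proof
    assume "p \<in> {x1, x2, y1, y2, z1, z2}"
    then show "crossing p \<in> {crossing xe, crossing ye, crossing ze}"
      unfolding six_eq using cr by auto
  next
    assume "crossing p \<in> {crossing xe, crossing ye, crossing ze}"
    then show "p \<in> {x1, x2, y1, y2, z1, z2}"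
      using that cr_rest[of p] by (auto simp: K_def)
  qed
  show "(colour L' p = colour L' q) = (colour L p = colour L q)"
    using colour_flip[OF assms(1)] pq six[of p] six[of q] by auto
qed (simp add: set_K')

text \<open>Each strand has at most one letter in the restricted code, so interchanging its two
  passages leaves that code as it is.\<close>

lemma odd_wrt_same:
  assumes "\<not> {crossing xe, crossing ye} \<subseteq> S" "\<not> {crossing ye, crossing ze} \<subseteq> S" "\<not> {crossing ze, crossing xe} \<subseteq> S" "c \<in> S"
  shows "odd_wrt S K' c = odd_wrt S K c"
proof -
  have "\<not> (crossing x1 \<in> S \<and> crossing x2 \<in> S)" "\<not> (crossing y1 \<in> S \<and> crossing y2 \<in> S)" "\<not> (crossing z1 \<in> S \<and> crossing z2 \<in> S)"
    using assms(1-3) unfolding cr_set[symmetric] by auto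
  then have LL: "L' = L"
    by (simp add: K_def K'_def)
  show ?thesis
    using odd_wrt_eqI[OF wf(2,1) S_crossings(2,1) assms(4,4)] LL set_K' by simp
qed

text \<open>Going once round the triangle, the colour changes along each of the three sides and at
  each even crossing. The total number of changes is even, so the number of even crossings is
  odd.\<close>

lemma parity_three:
  assumes "{crossing xe, crossing ye, crossing ze} \<subseteq> S"
  shows "(odd_wrt S K (crossing xe) = odd_wrt S K (crossing ye)) = (\<not> odd_wrt S K (crossing ze))"
proof -
  let ?f = "\<lambda>xs. length (filter (\<lambda>p. crossing p \<in> S) xs)"
  have c: "colour L x1 = False" "colour L x2 = True" "colour L y1 = odd (?f u)" "colour L y2 = even (?f u)"
      "colour L z1 = odd (?f u + ?f v)" "colour L z2 = even (?f u + ?f v)"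
    using cr_in_S[OF assms] dist by (auto simp: K_def)
  have "colour L xe \<noteq> colour L xs" "colour L ye \<noteq> colour L ys" "colour L ze \<noteq> colour L zs"
    using c by (auto simp: strand_defs)
  moreover have "odd_wrt S K (crossing xe) = (colour L xe = colour L ys)"
    using assms in_K neq cr by (intro odd_wrt_iff_colour[OF wf(1) S_crossings(1)]) auto
  moreover have "odd_wrt S K (crossing ye) = (colour L ye = colour L zs)"
    using assms in_K neq cr by (intro odd_wrt_iff_colour[OF wf(1) S_crossings(1)]) auto
  moreover have "odd_wrt S K (crossing ze) = (colour L ze = colour L xs)"
    using assms in_K neq cr by (intro odd_wrt_iff_colour[OF wf(1) S_crossings(1)]) auto
  ultimately show ?thesis
    by blast
qed

end

lemma even_K': "even_crossings K' = even_crossings K"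
  using odd_wrt_flip[OF subset_refl cr_classical] by (auto simp: even_crossings_eq classical_K')

text \<open>Among the three crossings either all or exactly one is even. In these situations
  \<open>odd_wrt_flip\<close> and \<open>odd_wrt_same\<close>, respectively, control the second
  level of the hierarchy.\<close>

lemma even_cases:
  obtains (three) "{crossing xe, crossing ye, crossing ze} \<subseteq> even_crossings K"
  | (one) "\<not> {crossing xe, crossing ye} \<subseteq> even_crossings K" "\<not> {crossing ye, crossing ze} \<subseteq> even_crossings K"
      "\<not> {crossing ze, crossing xe} \<subseteq> even_crossings K"
      "crossing xe \<in> even_crossings K \<or> crossing ye \<in> even_crossings K \<or> crossing ze \<in> even_crossings K"
proof -
  have "crossing p \<in> even_crossings K \<longleftrightarrow> \<not> odd_wrt (classical_crossings K) K (crossing p)" if "p \<in> {xe, ye, ze}" for p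
    using cr_classical that by (auto simp: even_crossings_eq)
  then show thesis
    using parity_three[OF subset_refl cr_classical] three one by auto
qed

lemma crossing_kind_K': "crossing_kind K' = crossing_kind K"
proof -
  have "odd_wrt (even_crossings K) K' c = odd_wrt (even_crossings K) K c" if "c \<in> even_crossings K" for c
    using that odd_wrt_flip[OF even_subset _ that] odd_wrt_same[OF even_subset _ _ _ that]
    by (cases rule: even_cases) auto
  moreover have "odd_wrt (classical_crossings K) K' c = odd_wrt (classical_crossings K) K c" if "c \<in> classical_crossings K" for c
    using odd_wrt_flip[OF subset_refl cr_classical that] .
  moreover have "c \<in> even_crossings K \<longleftrightarrow> c \<in> classical_crossings K \<and> \<not> odd_wrt (classical_crossings K) K c" for c
    by (simp add: even_crossings_eq)
  ultimately show ?thesis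
    by (auto simp: crossing_kind_def fun_eq_iff classical_K' even_K')
qed

text \<open>With one even crossing the other two have type 0. With three,
  \<open>parity_three\<close> applies once more, now relative to the even crossings, and leaves none
  or two of type 1.\<close>

lemma kinds:
  defines "A \<equiv> Skein ring_t (1 - ring_t)" and "B \<equiv> Skein ring_p ring_q"
    and "k \<equiv> crossing_kind K"
  shows "k (crossing xe) \<in> {A, B} \<and> k (crossing ye) = Shift \<and> k (crossing ze) = Shift \<or>
    k (crossing ye) \<in> {A, B} \<and> k (crossing ze) = Shift \<and> k (crossing xe) = Shift \<or>
    k (crossing ze) \<in> {A, B} \<and> k (crossing xe) = Shift \<and> k (crossing ye) = Shift \<or>
    (k (crossing xe), k (crossing ye), k (crossing ze)) \<in> {(A, A, A), (A, B, B), (B, A, B), (B, B, A)}"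
proof -
  have k: "k (crossing p) = (if crossing p \<in> even_crossings K then if odd_wrt (even_crossings K) K (crossing p) then B else A else Shift)"
    if "p \<in> {xe, ye, ze}" for p
    using cr_classical that by (auto simp: k_def A_def B_def crossing_kind_def even_crossings_eq)
  show ?thesis
  proof (cases rule: even_cases)
    case three
    then show ?thesis
      using parity_three[OF even_subset three]
      by (cases "odd_wrt (even_crossings K) K (crossing xe)"; cases "odd_wrt (even_crossings K) K (crossing ye)"; simp add: k)
  next
    case one
    then show ?thesis
      by (auto simp: k)
  qed
qed

lemma edge_det_eq: "edge_det (crossing_kind K) K \<simeq> edge_det (crossing_kind K') K'"
proof -
  define T where "T = crossing_kind K"
  define \<tau> where "\<tau> = id(x1 := x2, x2 := x1, y1 := y2, y2 := y1, z1 := z2, z2 := z1)"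
  define R where "R = walk T u y1 @ walk T v z1 @ walk T w x1"
  define C where "C = x1 # u @ y1 # v @ z1 # w"
  define ox where "ox = hd (u @ [y1])"
  define oy where "oy = hd (v @ [z1])"
  define oz where "oz = hd (w @ [x1])"
  note rows = edge_det_triangle_rows(1-4)[where T = T, OF dist[unfolded K_def] cr_rest6,
      folded K_def K'_def \<tau>_def R_def C_def ox_def oy_def oz_def]
    edge_det_triangle_rows(5)[OF dist[unfolded K_def] cr_rest6, folded C_def ox_def oy_def oz_def]
  have \<tau>: "\<tau> x1 = x2" "\<tau> x2 = x1" "\<tau> y1 = y2" "\<tau> y2 = y1" "\<tau> z1 = z2" "\<tau> z2 = z1"
    using neq6 by (auto simp: \<tau>_def)
  have mids: "x2 \<notin> set C" "y2 \<notin> set C" "z2 \<notin> set C" "x2 \<notin> {ox, oy, oz}" "y2 \<notin> {ox, oy, oz}" "z2 \<notin> {ox, oy, oz}"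
    using rows(5) by auto
  have len: "length C = length R + 3" and R: "\<And>r. r \<in> set R \<Longrightarrow> r x2 = 0 \<and> r y2 = 0 \<and> r z2 = 0"
    using rows(3,4) by auto
  let ?b = "\<lambda>C. rdet (strand_before T x1 x2 ox @ strand_before T y1 y2 oy @ strand_before T z1 z2 oz @ R) (x2 # y2 # z2 # C)"
  let ?a = "\<lambda>C. rdet (strand_after T \<tau> x1 x2 ox @ strand_after T \<tau> y1 y2 oy @ strand_after T \<tau> z1 z2 oz @ R) (x2 # y2 # z2 # C)"
  \<comment> \<open>The local lemmas expect the strands in a fixed order round the triangle.\<close>
  have perm: "rdet (a @ b @ c @ R) (x2 # y2 # z2 # C) \<simeq> rdet (b @ c @ a @ R) (y2 # z2 # x2 # C)"
    "rdet (a @ b @ c @ R) (x2 # y2 # z2 # C) \<simeq> rdet (c @ a @ b @ R) (z2 # x2 # y2 # C)"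
    "rdet (a @ b @ c @ R) (x2 # y2 # z2 # C) \<simeq> rdet (a @ c @ b @ R) (x2 # z2 # y2 # C)"
    if "length a = 2" "length b = 2" "length c = 2" for a b c :: "(passage \<Rightarrow> knot_ring) list"
    using that len by (intro rdet_permute; auto)+
  note perm_b = perm[of "strand_before T x1 x2 ox" "strand_before T y1 y2 oy" "strand_before T z1 z2 oz", simplified]
  note perm_a = perm[of "strand_after T \<tau> x1 x2 ox" "strand_after T \<tau> y1 y2 oy" "strand_after T \<tau> z1 z2 oz", simplified]
  have "?b C \<simeq> ?a C"
    using kinds[folded T_def]
  proof (elim disjE conjE)
    assume k: "T (crossing xe) \<in> {Skein ring_t (1 - ring_t), Skein ring_p ring_q}" "T (crossing ye) = Shift" "T (crossing ze) = Shift"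
    then obtain \<alpha> \<beta> where k': "T (crossing xe) = Skein \<alpha> \<beta>"
      by blast
    \<comment> \<open>The cut crossing is that of \<open>x\<close> and \<open>y\<close>, so
      \<open>z\<close> is the strand pushed across it and has to come first.\<close>
    have "rdet (strand_before T z1 z2 oz @ strand_before T x1 x2 ox @ strand_before T y1 y2 oy @ R) (z2 # x2 # y2 # C) \<simeq>
        rdet (strand_after T \<tau> z1 z2 oz @ strand_after T \<tau> x1 x2 ox @ strand_after T \<tau> y1 y2 oy @ R) (z2 # x2 # y2 # C)"
      by (rule rdet_strands_shift[OF _ _ len _ zs_def xs_def ys_def ze_def xe_def ye_def levels(1) cr(3,1,2)
            ltr_e(3,1,2) ltr_s(3,1,2) \<tau>(1-4) k' k(2,3)])
        (use neq6 mids R in auto)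
    then show ?thesis
      using perm_b(2) perm_a(2) eq_sign_sym eq_sign_trans by blast
  next
    assume k: "T (crossing ye) \<in> {Skein ring_t (1 - ring_t), Skein ring_p ring_q}" "T (crossing ze) = Shift" "T (crossing xe) = Shift"
    then obtain \<alpha> \<beta> where k': "T (crossing ye) = Skein \<alpha> \<beta>"
      by blast
    show ?thesis
      by (rule rdet_strands_shift[OF _ _ len _ xs_def ys_def zs_def xe_def ye_def ze_def levels(2) cr
            ltr_e ltr_s \<tau>(3-6) k' k(2,3)])
        (use neq6 mids R in auto)
  next
    assume k: "T (crossing ze) \<in> {Skein ring_t (1 - ring_t), Skein ring_p ring_q}" "T (crossing xe) = Shift" "T (crossing ye) = Shift"
    then obtain \<alpha> \<beta> where k': "T (crossing ze) = Skein \<alpha> \<beta>"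
      by blast
    have "rdet (strand_before T y1 y2 oy @ strand_before T z1 z2 oz @ strand_before T x1 x2 ox @ R) (y2 # z2 # x2 # C) \<simeq>
        rdet (strand_after T \<tau> y1 y2 oy @ strand_after T \<tau> z1 z2 oz @ strand_after T \<tau> x1 x2 ox @ R) (y2 # z2 # x2 # C)"
      by (rule rdet_strands_shift[OF _ _ len _ ys_def zs_def xs_def ye_def ze_def xe_def levels(3) cr(2,3,1)
            ltr_e(2,3,1) ltr_s(2,3,1) \<tau>(5,6,1,2) k' k(2,3)])
        (use neq6 mids R in auto)
    then show ?thesis
      using perm_b(1) perm_a(1) eq_sign_sym eq_sign_trans by blast
  next
    assume k: "(T (crossing xe), T (crossing ye), T (crossing ze)) \<in>
        {(Skein ring_t (1 - ring_t), Skein ring_t (1 - ring_t), Skein ring_t (1 - ring_t)),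
         (Skein ring_t (1 - ring_t), Skein ring_p ring_q, Skein ring_p ring_q),
         (Skein ring_p ring_q, Skein ring_t (1 - ring_t), Skein ring_p ring_q),
         (Skein ring_p ring_q, Skein ring_p ring_q, Skein ring_t (1 - ring_t))}"
    define good where "good \<alpha>1 \<beta>1 \<alpha>2 \<beta>2 \<alpha>3 \<beta>3 \<longleftrightarrow>
      (\<exists>\<alpha>1' \<alpha>2' \<alpha>3'. \<alpha>1 * \<alpha>1' = 1 \<and> \<alpha>2 * \<alpha>2' = 1 \<and> \<alpha>3 * \<alpha>3' = 1) \<and>
      \<beta>1 * \<alpha>2 = \<beta>1 * \<alpha>3 \<and> \<alpha>1 * \<beta>2 = \<beta>2 - \<beta>1 * \<beta>3" for \<alpha>1 \<beta>1 \<alpha>2 \<beta>2 \<alpha>3 \<beta>3 :: knot_ring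
    \<comment> \<open>In the order middle-bottom, top-bottom, top-middle: a type 2 crossing in the
      first place makes both conditions identities. Types 1, 2, 1 give \<open>q t = q p\<close> and
      \<open>p (1 - t) = (1 - t) - q^2\<close>; types 1, 1, 2 give \<open>q p = q t\<close>
      twice.\<close>
    have good: "good ring_t (1 - ring_t) ring_t (1 - ring_t) ring_t (1 - ring_t)"
      "good ring_t (1 - ring_t) ring_p ring_q ring_p ring_q"
      "good ring_p ring_q ring_t (1 - ring_t) ring_p ring_q"
      "good ring_p ring_q ring_p ring_q ring_t (1 - ring_t)"
      unfolding good_def using ring_t_inverse ring_p_inverse ring_q_p ring_q_q
      by (auto simp: algebra_simps)
    show ?thesis
    proof (cases "level z1 = Under \<and> level z2 = Under")
      case True
      have lev: "level xs = Over" "level xe = Over" "level ys = Under" "level ye = Over" "level zs = Under" "level ze = Under"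
        using levels x_over True by (auto simp: strand_defs split: if_splits)
      obtain \<alpha>1 \<beta>1 \<alpha>2 \<beta>2 \<alpha>3 \<beta>3 where T: "T (crossing ye) = Skein \<alpha>1 \<beta>1" "T (crossing ze) = Skein \<alpha>2 \<beta>2"
          "T (crossing xe) = Skein \<alpha>3 \<beta>3" "good \<alpha>1 \<beta>1 \<alpha>2 \<beta>2 \<alpha>3 \<beta>3"
        using k good by auto
      then obtain \<alpha>1' \<alpha>2' \<alpha>3' where \<alpha>: "\<alpha>1 * \<alpha>1' = 1" "\<alpha>2 * \<alpha>2' = 1" "\<alpha>3 * \<alpha>3' = 1"
        and rel: "\<beta>1 * \<alpha>2 = \<beta>1 * \<alpha>3" "\<alpha>1 * \<beta>2 = \<beta>2 - \<beta>1 * \<beta>3"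
        unfolding good_def by blast
      show ?thesis
        by (rule rdet_strands_skein[OF _ _ len _ xs_def ys_def zs_def xe_def ye_def ze_def lev cr ltr_e ltr_s \<tau> T(1-3) \<alpha> rel])
          (use neq6 mids R in auto)
    next
      case False
      \<comment> \<open>With \<open>y\<close> at the bottom the triangle is traversed backwards, in
        the order x, z, y. This exchanges start and end of each side and negates
        \<open>\<kappa>\<close>.\<close>
      then have "level y1 = Under \<and> level y2 = Under"
        using bottom by blast
      then have lev: "level xe = Over" "level xs = Over" "level ze = Under" "level zs = Over" "level ye = Under" "level ys = Under"
        using levels x_over by (auto simp: strand_defs split: if_splits)
      obtain \<alpha>1 \<beta>1 \<alpha>2 \<beta>2 \<alpha>3 \<beta>3 where T: "T (crossing zs) = Skein \<alpha>1 \<beta>1" "T (crossing ys) = Skein \<alpha>2 \<beta>2"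
          "T (crossing xs) = Skein \<alpha>3 \<beta>3" "good \<alpha>1 \<beta>1 \<alpha>2 \<beta>2 \<alpha>3 \<beta>3"
        using k good unfolding cr(1,2) cr(3) by auto
      then obtain \<alpha>1' \<alpha>2' \<alpha>3' where \<alpha>: "\<alpha>1 * \<alpha>1' = 1" "\<alpha>2 * \<alpha>2' = 1" "\<alpha>3 * \<alpha>3' = 1"
        and rel: "\<beta>1 * \<alpha>2 = \<beta>1 * \<alpha>3" "\<alpha>1 * \<beta>2 = \<beta>2 - \<beta>1 * \<beta>3"
        unfolding good_def by blast
      have ss: "xe = (if \<not> b1 then x1 else x2)" "ze = (if \<not> b3 then z1 else z2)" "ye = (if \<not> b2 then y1 else y2)"
        "xs = (if \<not> b1 then x2 else x1)" "zs = (if \<not> b3 then z2 else z1)" "ys = (if \<not> b2 then y2 else y1)"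
        by (simp_all add: strand_defs)
      have ltr: "left_to_right xs = ((\<not> b1) = (\<not> b3)) = (\<not> \<kappa>)" "left_to_right zs = ((\<not> b3) = (\<not> b2)) = (\<not> \<kappa>)"
        "left_to_right ys = ((\<not> b2) = (\<not> b1)) = (\<not> \<kappa>)"
        using ltr_e ltr_s by auto
      have "rdet (strand_before T x1 x2 ox @ strand_before T z1 z2 oz @ strand_before T y1 y2 oy @ R) (x2 # z2 # y2 # C) \<simeq>
          rdet (strand_after T \<tau> x1 x2 ox @ strand_after T \<tau> z1 z2 oz @ strand_after T \<tau> y1 y2 oy @ R) (x2 # z2 # y2 # C)"
        by (rule rdet_strands_skein[OF _ _ len _ ss lev _ _ _ _ _ _ _ _ _ \<tau>(1,2,5,6,3,4) T(1-3) \<alpha> rel,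
              where \<kappa> = "\<not> \<kappa>"])
          (use neq6 mids R cr ltr ltr_s in auto)
      then show ?thesis
        using perm_b(3) perm_a(3) eq_sign_sym eq_sign_trans by blast
    qed
  qed
  then show ?thesis
    using rows(1,2) eq_sign_sym eq_sign_trans unfolding crossing_kind_K' T_def[symmetric] by blast
qed

end

section \<open>Block determinants and change of columns\<close>

lemma rdet_zero_col:
  assumes "length rs = length cs" "c \<in> set cs" "\<And>r. r \<in> set rs \<Longrightarrow> r c = 0"
  shows "rdet rs cs = 0"
proof -
  obtain as bs where cs: "cs = as @ c # bs"
    using assms(2) by (meson split_list)
  obtain r rs' where rs: "rs = r # rs'"
    using assms(1,2) by (cases rs) auto
  have "rdet rs cs \<simeq> rdet rs (c # as @ bs)"
    using assms(1) by (intro rdet_permute) (auto simp: cs)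
  also have "\<dots> = rdet ((\<lambda>r. r c) # map (\<lambda>c r. r c) (as @ bs)) (r # rs')"
    using assms(1) by (subst rdet_transpose) (auto simp: cs rs)
  also have "\<dots> = r c * rdet (map (\<lambda>c r. r c) (as @ bs)) rs'"
    using assms by (subst rdet_expand) (auto simp: cs rs)
  also have "r c = 0"
    using assms(3) by (simp add: rs)
  finally show ?thesis
    by simp
qed

lemma rdet_unitriangular:
  assumes "length rs' = length cs'" "length rs = length cs"
    and "\<And>i j. i < j \<Longrightarrow> j < length cs' \<Longrightarrow> (rs' ! i) (cs' ! j) = 0"
    and "\<And>i. i < length cs' \<Longrightarrow> (rs' ! i) (cs' ! i) = 1"
    and "\<forall>r\<in>set rs'. \<forall>c\<in>set cs. r c = 0"
  shows "rdet (rs' @ rs) (cs' @ cs) = rdet rs cs"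
  using assms
proof (induction rs' cs' rule: list_induct2)
  case (Cons r rs' c cs')
  have "r d = 0" if "d \<in> set (cs' @ cs)" for d
  proof (cases "d \<in> set cs'")
    case True
    then obtain j where "j < length cs'" "d = cs' ! j"
      by (auto simp: in_set_conv_nth)
    then show ?thesis
      using Cons.prems(2)[of 0 "Suc j"] by simp
  qed (use that Cons.prems(4) in auto)
  then have "rdet ((r # rs') @ rs) ((c # cs') @ cs) = r c * rdet (rs' @ rs) (cs' @ cs)"
    using Cons.hyps Cons.prems(1) by (simp add: rdet_expand)
  also have "r c = 1"
    using Cons.prems(3)[of 0] by simp
  also have "rdet (rs' @ rs) (cs' @ cs) = rdet rs cs"
    using Cons.prems(2)[of "Suc _" "Suc _"] Cons.prems(3)[of "Suc _"] Cons.prems(1,4)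
    by (intro Cons.IH) auto
  finally show ?case
    by simp
qed simp

text \<open>A change of basis: the columns \<open>cd\<close> give way to the combinations prescribed
  by \<open>W\<close>. Since \<open>W\<close> is the identity on \<open>cd\<close>, the transition
  matrix \<open>?B\<close> is unitriangular. The sum type keeps the remaining edges
  (\<open>Inl\<close>) apart from the new indices (\<open>Inr\<close>), later the arcs.\<close>

lemma rdet_combine_cols:
  fixes rs :: "('c \<Rightarrow> 'a::comm_ring_1) list" and W :: "'c \<Rightarrow> 'd \<Rightarrow> 'a"
  assumes len: "length rs = length (cn @ cd)" "length ds = length cd" and dist: "distinct (cn @ cd)"
    and W: "\<And>i j. i < length cd \<Longrightarrow> j < length cd \<Longrightarrow> W (cd ! i) (ds ! j) = (if i = j then 1 else 0)"
  shows "rdet rs (cn @ cd) = rdet (map (\<lambda>r. case_sum r (\<lambda>d. \<Sum>z\<in>set (cn @ cd). r z * W z d)) rs) (map Inl cn @ map Inr ds)"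
proof -
  let ?C = "cn @ cd" and ?k = "length cn"
  let ?n = "length ?C"
  let ?A = "mat ?n ?n (\<lambda>(i, j). (rs ! i) (?C ! j))"
  let ?B = "mat ?n ?n (\<lambda>(i, j). if j < ?k then if i = j then 1 else 0 else W (?C ! i) (ds ! (j - ?k)))"
  have "det ?B = prod_list (diag_mat ?B)"
  proof (rule det_upper_triangular[of _ ?n])
    show "upper_triangular ?B"
    proof
      fix i j assume "j < i" "i < dim_row ?B"
      then show "?B $$ (i, j) = 0"
        using W[of "i - ?k" "j - ?k"] by (auto simp: nth_append)
    qed
  qed simp
  also have "diag_mat ?B = replicate ?n 1"
    using W by (intro nth_equalityI) (auto simp: diag_mat_def nth_append simp del: replicate.simps upt_Suc)
  finally have "det (?A * ?B) = det ?A"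
    by (subst det_mult[of _ ?n]) auto
  moreover have "?A * ?B = mat ?n ?n (\<lambda>(i, j).
      (map (\<lambda>r. case_sum r (\<lambda>d. \<Sum>z\<in>set ?C. r z * W z d)) rs ! i) ((map Inl cn @ map Inr ds) ! j))" (is "_ = ?D")
  proof (rule eq_matI)
    fix i j assume "i < dim_row ?D" "j < dim_col ?D"
    then have ij: "i < ?n" "j < ?n" by auto
    have *: "(?A * ?B) $$ (i, j) = (\<Sum>m<?n. (rs ! i) (?C ! m) *
        (if j < ?k then if m = j then 1 else 0 else W (?C ! m) (ds ! (j - ?k))))"
      using ij by (simp add: scalar_prod_def atLeast0LessThan)
    show "(?A * ?B) $$ (i, j) = ?D $$ (i, j)"
    proof (cases "j < ?k")
      case True
      then have "(?A * ?B) $$ (i, j) = (\<Sum>m\<in>{j}. (rs ! i) (?C ! m) * (if m = j then 1 else 0))"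
        unfolding * using ij by (intro sum.mono_neutral_cong_right) auto
      then show ?thesis
        using True ij len by (simp add: nth_append)
    next
      case False
      then have "(?A * ?B) $$ (i, j) = (\<Sum>m<?n. (rs ! i) (?C ! m) * W (?C ! m) (ds ! (j - ?k)))"
        unfolding * by simp
      also have "\<dots> = (\<Sum>z\<in>set ?C. (rs ! i) z * W z (ds ! (j - ?k)))"
        by (rule sum.reindex_bij_betw[OF bij_betw_nth[OF dist refl refl]])
      finally show ?thesis
        using False ij len by (simp add: nth_append)
    qed
  qed auto
  ultimately show ?thesis
    using len by (simp add: rdet_def)
qed

section \<open>Elimination of the uncut passages\<close>

text \<open>The cyclic successor as a function of the passage, so that it does not depend on the
  base point. The final \<open>[x]\<close> covers a list with one element.\<close>

definition next_passage :: "diagram \<Rightarrow> passage \<Rightarrow> passage" where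
  "next_passage K x = hd (tl (dropWhile (\<lambda>y. y \<noteq> x) K) @ takeWhile (\<lambda>y. y \<noteq> x) K @ [x])"

lemma next_passage_split:
  assumes "distinct K" "K = A @ x # B"
  shows "next_passage K x = hd (B @ A @ [x])"
proof -
  have "\<forall>y\<in>set A. y \<noteq> x"
    using assms by auto
  then show ?thesis
    unfolding next_passage_def assms(2) by (simp add: takeWhile_append2 dropWhile_append2)
qed

lemma next_passage_rotate:
  assumes "distinct (A @ B)" "x \<in> set (A @ B)"
  shows "next_passage (B @ A) x = next_passage (A @ B) x"
proof -
  have d: "distinct (B @ A)"
    using assms(1) by auto
  show ?thesis
  proof (cases "x \<in> set A")
    case True
    then obtain A1 A2 where "A = A1 @ x # A2"
      by (meson split_list)
    then show ?thesis
      using next_passage_split[OF assms(1), of A1 x "A2 @ B"] next_passage_split[OF d, of "B @ A1" x A2] by simp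
  next
    case False
    then obtain B1 B2 where "B = B1 @ x # B2"
      using assms(2) by (metis Un_iff set_append split_list)
    then show ?thesis
      using next_passage_split[OF assms(1), of "A @ B1" x B2] next_passage_split[OF d, of B1 x "B2 @ A"] by simp
  qed
qed

definition edge_row :: "(nat \<Rightarrow> kind) \<Rightarrow> diagram \<Rightarrow> passage \<Rightarrow> passage \<Rightarrow> knot_ring" where
  "edge_row T K x = passage_row (T (crossing x)) x (over_of x) x (next_passage K x)"

lemma walk_eq_map:
  assumes "distinct K" "K = A @ xs"
  shows "walk T xs (hd K) = map (edge_row T K) xs"
  using assms(2)
proof (induction xs arbitrary: A)
  case (Cons x xs)
  have "next_passage K x = hd (xs @ A @ [x])"
    using next_passage_split[OF assms(1) Cons.prems] .
  also have "\<dots> = hd (xs @ [hd K])"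
    using Cons.prems by (cases xs; cases A) auto
  finally show ?case
    using Cons.IH[of "A @ [x]"] Cons.prems by (simp add: edge_row_def)
qed simp

lemma map_next_passage:
  assumes "distinct K"
  shows "map (next_passage K) K = rotate1 K"
proof -
  have "map (next_passage K) xs = tl xs @ [hd K]" if "K = A @ xs" "xs \<noteq> []" for A xs
    using that
  proof (induction xs arbitrary: A)
    case (Cons x xs)
    have "next_passage K x = hd (xs @ [hd K])"
      using next_passage_split[OF assms Cons.prems(1)] Cons.prems(1) by (cases xs; cases A) auto
    then show ?case
      using Cons.IH[of "A @ [x]"] Cons.prems by (cases xs) auto
  qed simp
  from this[of "[]" K] show ?thesis
    by (cases K) auto
qed

text \<open>The row of a passage is paired with the edge that leaves it. These edges are all edges,
  cyclically shifted.\<close>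

lemma edge_det_reorder:
  assumes "distinct K" "K \<noteq> []" "mset ps = mset K"
  shows "edge_det T K \<simeq> rdet (map (edge_row T K) ps) (map (next_passage K) ps)"
proof -
  have "edge_det T K = rdet (map (edge_row T K) K) K"
    using assms walk_eq_map[of K "[]" K T] by (simp add: edge_det_def)
  also have "\<dots> \<simeq> rdet (map (edge_row T K) ps) (map (next_passage K) ps)"
  proof (rule rdet_permute)
    have "mset K = mset (map (next_passage K) K)"
      unfolding map_next_passage[OF assms(1)] by (cases K) auto
    then show "mset K = mset (map (next_passage K) ps)"
      using assms(3) by simp
  qed (use assms(3) in simp_all)
  finally show ?thesis .
qed

lemma sum_edge_row:
  assumes "finite Z" "x \<in> Z" "next_passage K x \<in> Z" "\<And>\<alpha> \<beta>. T (crossing x) = Skein \<alpha> \<beta> \<Longrightarrow> level x = Under \<Longrightarrow> over_of x \<in> Z"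
  shows "(\<Sum>z\<in>Z. edge_row T K x z * w z) = (case T (crossing x) of
      Through \<Rightarrow> w (next_passage K x) - w x
    | Shift \<Rightarrow> w (next_passage K x) - ring_s_pow (shift x) * w x
    | Skein \<alpha> \<beta> \<Rightarrow>
        if level x = Under
        then \<beta> * w (over_of x) + (if left_to_right x then \<alpha> * w (next_passage K x) - w x else \<alpha> * w x - w (next_passage K x))
        else w (next_passage K x) - w x)"
proof -
  have unit: "(\<Sum>z\<in>Z. \<delta> a z * w z) = w a" if "a \<in> Z" for a
  proof -
    have "(\<Sum>z\<in>Z. \<delta> a z * w z) = (\<Sum>z\<in>{a}. \<delta> a z * w z)"
      using assms(1) that by (intro sum.mono_neutral_right) auto
    then show ?thesis
      by simp
  qed
  have lin: "(\<Sum>z\<in>Z. k * \<delta> a z * w z) = k * w a" if "a \<in> Z" for a k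
    using unit[OF that] by (simp add: mult.assoc flip: sum_distrib_left)
  show ?thesis
    using assms(2-4)
    by (auto simp: edge_row_def passage_row_def left_diff_distrib distrib_right sum.distrib sum_subtractf unit lin
        split: kind.splits)
qed

lemma label_exponent_snoc:
  "label_exponent K (xs @ [x]) = label_exponent K xs + (if crossing x \<in> type0 K then shift x else 0)"
  by (simp add: label_exponent_def shift_def)

lemma cut_passage_iff: "cut_passage K x \<longleftrightarrow> level x = Under \<and> crossing x \<in> even_crossings K"
  by (auto simp: cut_passage_def types_eq)

lemma crossing_kind_Shift_iff: "crossing_kind K c = Shift \<longleftrightarrow> c \<in> type0 K"
  by (simp add: crossing_kind_def types_eq)

lemma crossing_kind_even:
  assumes "c \<in> even_crossings K"
  shows "crossing_kind K c = Skein (right_label K c) (over_label K c)"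
  using assms by (auto simp: crossing_kind_def even_crossings_eq right_label_def over_label_def types_eq)

locale wf_diagram =
  fixes K :: diagram
  assumes wf: "well_formed K"
begin

lemma distinct_K: "distinct K"
  by (rule well_formed_distinct[OF wf])

definition under :: "nat \<Rightarrow> passage" where
  "under c = K ! underpass K c"

lemma under:
  assumes "c \<in> even_crossings K"
  shows "underpass K c < length K" "under c \<in> set K" "crossing (under c) = c" "level (under c) = Under"
proof -
  have c: "c \<in> classical_crossings K"
    using assms even_subset by blast
  then obtain x where x: "x \<in> set K" "crossing x = c" "level x \<noteq> Virtual"
    by (auto simp: classical_crossings_def)
  obtain y where y: "y \<in> set K" "y \<noteq> x" "crossing y = crossing x"
    using well_formed_partner_exists[OF wf x(1)] .
  have "level x = Under \<or> level y = Under"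
    using well_formed_partner(2)[OF wf x(1) y(1)] x y by auto
  then obtain z where z: "z \<in> set K" "crossing z = c" "level z = Under"
    using x y by auto
  have uniq: "z' = z" if "z' \<in> set K" "crossing z' = c" "level z' = Under" for z'
    using well_formed_partner(2)[OF wf that(1) z(1)] that z by auto
  obtain i where i: "i < length K" "K ! i = z"
    using z(1) by (auto simp: in_set_conv_nth)
  have "\<exists>!i. i < length K \<and> crossing (K ! i) = c \<and> level (K ! i) = Under"
  proof (rule ex1I[of _ i])
    fix j assume j: "j < length K \<and> crossing (K ! j) = c \<and> level (K ! j) = Under"
    then have "K ! j = K ! i"
      using uniq[of "K ! j"] i by simp
    then show "j = i"
      using j i nth_eq_iff_index_eq[OF distinct_K, of j i] by simp
  qed (use i z in simp)
  from theI'[OF this] show *: "underpass K c < length K" "crossing (under c) = c" "level (under c) = Under"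
    unfolding under_def underpass_def by blast+
  then show "under c \<in> set K"
    by (simp add: under_def)
qed

lemma under_unique:
  assumes "x \<in> set K" "level x = Under" "crossing x \<in> even_crossings K"
  shows "under (crossing x) = x"
proof (rule ccontr)
  assume "under (crossing x) \<noteq> x"
  then show False
    using well_formed_partner(2)[OF wf under(2)[OF assms(3)] assms(1)] under(3,4)[OF assms(3)] assms(2) by simp
qed

lemma cut_under: "c \<in> even_crossings K \<Longrightarrow> cut_passage K (under c)"
  using under by (simp add: cut_passage_iff)

lemma over_of_under:
  assumes "c \<in> even_crossings K"
  shows "over_of (under c) \<in> set K" "over_of (under c) \<noteq> under c"
    and "{z \<in> set K. crossing z = c} = {over_of (under c), under c}"
    and "level (over_of (under c)) = Over" "crossing (over_of (under c)) = c"
proof -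
  note u = under[OF assms]
  obtain y where y: "y \<in> set K" "y \<noteq> under c" "crossing y = crossing (under c)"
    using well_formed_partner_exists[OF wf u(2)] .
  note y' = y(2)[symmetric] y(3)[symmetric]
  note pair = well_formed_partner[OF wf u(2) y(1) y'(2,1)]
  have over_y: "over_of (under c) = y"
    by (rule over_of_eqI[OF y(3)]) (use pair u(4) in auto)
  show "over_of (under c) \<in> set K" "over_of (under c) \<noteq> under c"
    unfolding over_y using y by simp_all
  have "z \<in> {y, under c}" if "z \<in> set K" "crossing z = c" for z
  proof (cases "z = under c")
    case False
    then show ?thesis
      using well_formed_partner_unique[OF wf u(2) that(1) y(1) _ y'(2) _ y'(1)] that(2) u(3) by simp
  qed simp
  moreover have "crossing y = c"
    using u(3) y(3) by simp
  ultimately show "{z \<in> set K. crossing z = c} = {over_of (under c), under c}"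
    unfolding over_y using u(2,3) y(1) by blast
  show "level (over_of (under c)) = Over" "crossing (over_of (under c)) = c"
    using u by (simp_all add: over_of_def)
qed

text \<open>The curve read from just after the underpass of \<open>d\<close>, hence ending with it;
  \<open>arc_passages\<close> takes an initial segment of this list.\<close>

definition rotation :: "nat \<Rightarrow> diagram" where
  "rotation d = drop (underpass K d + 1) K @ take (underpass K d + 1) K"

text \<open>The labels of the short arcs as a vector on edges: the edge arriving at \<open>x\<close>
  carries the power of \<open>s\<close> collected before \<open>x\<close>, and edges off the arc
  carry 0. The list may also be the whole curve.\<close>

definition weight :: "passage list \<Rightarrow> passage \<Rightarrow> knot_ring" where
  "weight as x = (if x \<in> set as then ring_s_pow (label_exponent K (takeWhile (\<lambda>y. y \<noteq> x) as)) else 0)"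

lemma weight_split:
  assumes "distinct (as @ x # bs)"
  shows "weight (as @ x # bs) x = ring_s_pow (label_exponent K as)"
proof -
  have "\<forall>y\<in>set as. y \<noteq> x"
    using assms by auto
  then show ?thesis
    by (simp add: weight_def takeWhile_append2)
qed

lemma rotation:
  assumes "d \<in> even_crossings K"
  obtains ys g rest where "rotation d = ys @ g # rest" "\<And>y. y \<in> set ys \<Longrightarrow> \<not> cut_passage K y" "cut_passage K g"
    "arc_passages K d = ys @ [g]" "last (g # rest) = under d" "distinct (ys @ g # rest)" "set (ys @ g # rest) = set K"
    "\<And>x. x \<in> set K \<Longrightarrow> next_passage (ys @ g # rest) x = next_passage K x"
proof -
  define i where "i = underpass K d"
  have i: "i < length K" "K ! i = under d"
    using under[OF assms] by (simp_all add: i_def under_def)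
  have rot: "rotation d = (drop (i + 1) K @ take i K) @ [under d]"
    unfolding rotation_def i_def[symmetric] using i by (simp add: take_Suc_conv_app_nth)
  define ys where "ys = takeWhile (\<lambda>x. \<not> cut_passage K x) (rotation d)"
  have "dropWhile (\<lambda>x. \<not> cut_passage K x) (rotation d) \<noteq> []"
    using cut_under[OF assms] unfolding rot by (simp add: dropWhile_eq_Nil_conv)
  then obtain g rest where g: "dropWhile (\<lambda>x. \<not> cut_passage K x) (rotation d) = g # rest"
    by (cases "dropWhile (\<lambda>x. \<not> cut_passage K x) (rotation d)") auto
  have R: "rotation d = ys @ g # rest"
    using takeWhile_dropWhile_id[of "\<lambda>x. \<not> cut_passage K x" "rotation d"] g by (simp add: ys_def)
  have "mset (rotation d) = mset (take (underpass K d + 1) K @ drop (underpass K d + 1) K)"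
    unfolding rotation_def mset_append by (rule add.commute)
  then have mset: "mset (rotation d) = mset K"
    by (simp only: append_take_drop_id)
  have "set (rotation d) = set K" "distinct (rotation d)"
    using mset_eq_setD[OF mset] mset_eq_imp_distinct_iff[OF mset] distinct_K by simp_all
  moreover have "arc_passages K d = ys @ [g]"
  proof -
    have "arc_passages K d = take (length ys + 1) (rotation d)"
      unfolding arc_passages_def Let_def ys_def rotation_def ..
    then show ?thesis
      by (simp add: R)
  qed
  moreover have "cut_passage K g"
    using hd_dropWhile[of "\<lambda>x. \<not> cut_passage K x" "rotation d"] g by simp
  moreover have "last (g # rest) = under d"
    using arg_cong[OF R, of last] by (simp add: rot)
  moreover have "next_passage (rotation d) x = next_passage K x" if "x \<in> set K" for x
    unfolding rotation_def
    using next_passage_rotate[of "take (underpass K d + 1) K" "drop (underpass K d + 1) K" x] distinct_K that by simp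
  moreover have "\<not> cut_passage K y" if "y \<in> set ys" for y
    using set_takeWhileD[OF that[unfolded ys_def]] by simp
  ultimately show thesis
    using that[of ys g rest] R by simp
qed

text \<open>The labels of an arc solve the equations at all uncut passages, and an arc departs from
  no cut underpass but its own. This makes the arcs the right combinations of edge columns.\<close>

lemma weight_next:
  assumes d: "d \<in> even_crossings K" and x: "x \<in> set K"
  shows "\<not> cut_passage K x \<Longrightarrow> weight (arc_passages K d) (next_passage K x) =
      ring_s_pow (if crossing x \<in> type0 K then shift x else 0) * weight (arc_passages K d) x"
    and "cut_passage K x \<Longrightarrow> weight (arc_passages K d) (next_passage K x) = (if x = under d then 1 else 0)"
proof -
  obtain ys g rest where R: "rotation d = ys @ g # rest" "\<And>y. y \<in> set ys \<Longrightarrow> \<not> cut_passage K y" "cut_passage K g"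
    "arc_passages K d = ys @ [g]" "last (g # rest) = under d" "distinct (ys @ g # rest)" "set (ys @ g # rest) = set K"
    "\<And>x. x \<in> set K \<Longrightarrow> next_passage (ys @ g # rest) x = next_passage K x"
    by (rule rotation[OF d]) blast
  \<comment> \<open>From \<open>g\<close>, the end of the arc, up to the underpass of
    \<open>d\<close>, every departing edge lies off the arc.\<close>
  have zero: "weight (ys @ [g]) (next_passage K x) = 0" if xr: "x \<in> set (g # rest)" "x \<noteq> under d"
  proof -
    obtain as bs where ab: "g # rest = as @ x # bs"
      using split_list[OF xr(1)] by blast
    then have "bs \<noteq> []"
      using R(5) xr(2) by (auto split: if_splits)
    then obtain y bs' where bs: "bs = y # bs'"
      by (cases bs) auto
    have "next_passage K x = y"
      using next_passage_split[OF R(6), of "ys @ as" x bs] R(8)[OF x] ab bs by simp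
    moreover have "y \<in> set rest"
      using ab bs by (cases as) auto
    ultimately show ?thesis
      using R(6) by (auto simp: weight_def)
  qed
  show "weight (arc_passages K d) (next_passage K x) =
      ring_s_pow (if crossing x \<in> type0 K then shift x else 0) * weight (arc_passages K d) x" if nc: "\<not> cut_passage K x"
  proof (cases "x \<in> set ys")
    case True
    then obtain as bs where ab: "ys = as @ x # bs"
      by (meson split_list)
    obtain y cs where y: "bs @ [g] = y # cs"
      by (cases bs) auto
    have "next_passage K x = hd ((bs @ g # rest) @ as @ [x])"
      using next_passage_split[OF R(6), of as x "bs @ g # rest"] R(8)[OF x] ab by simp
    also have "\<dots> = hd ((bs @ [g]) @ rest @ as @ [x])"
      by simp
    also have "\<dots> = y"
      unfolding y by simp
    finally have nxt: "next_passage K x = y" .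
    have 1: "ys @ [g] = (as @ [x]) @ y # cs" "ys @ [g] = as @ x # y # cs"
      using ab y by simp_all
    have dd: "distinct (ys @ [g])"
      using R(6) by auto
    have "weight (ys @ [g]) y = ring_s_pow (label_exponent K (as @ [x]))"
      using dd unfolding 1(1) by (rule weight_split)
    moreover have "weight (ys @ [g]) x = ring_s_pow (label_exponent K as)"
      using dd unfolding 1(2) by (rule weight_split)
    ultimately show ?thesis
      unfolding R(4) nxt label_exponent_snoc by (simp add: ring_s_pow_add mult.commute)
  next
    case False
    have "x \<noteq> g" "x \<noteq> under d"
      using nc R(3) cut_under[OF d] by auto
    then have "weight (ys @ [g]) x = 0" "x \<in> set (g # rest)"
      using False x R(7) by (auto simp: weight_def)
    then show ?thesis
      unfolding R(4) using zero \<open>x \<noteq> under d\<close> by simp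
  qed
  show "weight (arc_passages K d) (next_passage K x) = (if x = under d then 1 else 0)" if cut: "cut_passage K x"
  proof (cases "x = under d")
    case True
    define as where "as = butlast (g # rest)"
    have "g # rest = as @ [x]"
      using append_butlast_last_id[of "g # rest"] R(5) True by (simp add: as_def)
    then have "next_passage K x = hd ((ys @ as) @ [x])"
      using next_passage_split[OF R(6), of "ys @ as" x "[]"] R(8)[OF x] by simp
    also have "\<dots> = hd (ys @ [g])"
      using \<open>g # rest = as @ [x]\<close> by (cases ys; cases as) auto
    finally have nxt: "next_passage K x = hd (ys @ [g])" .
    have "weight (ys @ [g]) (hd (ys @ [g])) = 1"
      by (cases ys) (auto simp: weight_def label_exponent_def)
    then show ?thesis
      unfolding R(4) nxt using True by simp
  next
    case False
    moreover have "x \<in> set (g # rest)"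
      using cut R(2)[of x] R(7) x by auto
    ultimately show ?thesis
      unfolding R(4) using zero by simp
  qed
qed

lemma next_passage_in: "x \<in> set K \<Longrightarrow> next_passage K x \<in> set K"
  using arg_cong[OF map_next_passage[OF distinct_K], of set] by auto

text \<open>In the row of an underpass, the overpass edge and the incoming edge account for the
  arriving incidences. The outgoing edge has label 1 on the arc that starts there and 0 on all
  others, which gives the departing one.\<close>

lemma knot_matrix_entry_eq:
  assumes c: "c \<in> even_crossings K" and d: "d \<in> even_crossings K"
  shows "(\<Sum>z\<in>set K. edge_row (crossing_kind K) K (under c) z * weight (arc_passages K d) z) = knot_matrix_entry K c d"
proof -
  let ?A = "arc_passages K d" and ?x = "under c"
  let ?w = "weight ?A"
  obtain ys g rest where R: "rotation d = ys @ g # rest" "?A = ys @ [g]" "distinct (ys @ g # rest)" "set (ys @ g # rest) = set K"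
    by (rule rotation[OF d]) blast
  have A: "distinct ?A" "set ?A \<subseteq> set K"
    unfolding R(2) R(4)[symmetric] using R(3) by auto
  have inj: "inj_on ((!) ?A) {m. m < length ?A \<and> crossing (?A ! m) = c}"
    using A(1) by (auto simp: inj_on_def nth_eq_iff_index_eq)
  have w: "?w (?A ! m) = ring_s_pow (label_exponent K (take m ?A))" if "m < length ?A" for m
  proof -
    have eq: "take m ?A @ ?A ! m # drop (Suc m) ?A = ?A"
      using that by (rule id_take_nth_drop[symmetric])
    show ?thesis
      by (rule weight_split[of "take m ?A" "?A ! m" "drop (Suc m) ?A", unfolded eq, OF A(1)])
  qed
  have "(\<Sum>m | m < length ?A \<and> crossing (?A ! m) = c.
        arriving_label K (?A ! m) * ring_s_pow (label_exponent K (take m ?A))) =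
      (\<Sum>m | m < length ?A \<and> crossing (?A ! m) = c. arriving_label K (?A ! m) * ?w (?A ! m))"
    by (intro sum.cong refl) (simp only: mem_Collect_eq w)
  also have "\<dots> = (\<Sum>z\<in>(!) ?A ` {m. m < length ?A \<and> crossing (?A ! m) = c}. arriving_label K z * ?w z)"
    unfolding sum.reindex[OF inj] o_def ..
  also have "(!) ?A ` {m. m < length ?A \<and> crossing (?A ! m) = c} = {z \<in> set ?A. crossing z = c}"
  proof
    show "{z \<in> set ?A. crossing z = c} \<subseteq> (!) ?A ` {m. m < length ?A \<and> crossing (?A ! m) = c}"
    proof
      fix z assume z: "z \<in> {z \<in> set ?A. crossing z = c}"
      then obtain m where "m < length ?A" "z = ?A ! m"
        unfolding mem_Collect_eq in_set_conv_nth by blast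
      then show "z \<in> (!) ?A ` {m. m < length ?A \<and> crossing (?A ! m) = c}"
        using z by blast
    qed
  qed (use nth_mem in blast)
  \<comment> \<open>Passages off the arc have weight 0, so the sum may run over both passages of
    \<open>c\<close>.\<close>
  also have "(\<Sum>z | z \<in> set ?A \<and> crossing z = c. arriving_label K z * ?w z) =
      (\<Sum>z | z \<in> set K \<and> crossing z = c. arriving_label K z * ?w z)"
  proof (rule sum.mono_neutral_left)
    show "{z \<in> set ?A. crossing z = c} \<subseteq> {z \<in> set K. crossing z = c}"
      using A(2) by blast
    show "\<forall>z\<in>{z \<in> set K. crossing z = c} - {z \<in> set ?A. crossing z = c}. arriving_label K z * ?w z = 0"
      by (auto simp: weight_def)
  qed simp
  also have "\<dots> = arriving_label K (over_of ?x) * ?w (over_of ?x) + arriving_label K ?x * ?w ?x"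
    unfolding over_of_under(3)[OF c] using over_of_under(2)[OF c] by simp
  finally have entry: "knot_matrix_entry K c d = (if c = d then departing_label K ?x else 0) +
      (arriving_label K (over_of ?x) * ?w (over_of ?x) + arriving_label K ?x * ?w ?x)"
    unfolding knot_matrix_entry_def by (simp only: under_def ring_s_pow_0 mult_1_right)
  have nxt: "?w (next_passage K ?x) = (if c = d then 1 else 0)"
  proof -
    have "under c = under d \<longleftrightarrow> c = d"
      using under(3)[OF c] under(3)[OF d] by metis
    then show ?thesis
      using weight_next(2)[OF d under(2)[OF c] cut_under[OF c]] by simp
  qed
  have kind: "crossing_kind K (crossing ?x) = Skein (right_label K c) (over_label K c)"
    unfolding under(3)[OF c] by (rule crossing_kind_even[OF c])
  have labels: "arriving_label K (over_of ?x) = over_label K c"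
      "arriving_label K ?x = (if left_to_right ?x then - 1 else right_label K c)"
      "departing_label K ?x = (if left_to_right ?x then right_label K c else - 1)"
    by (simp_all add: arriving_label_def departing_label_def left_label_def under[OF c] over_of_under(4,5)[OF c])
  have "(\<Sum>z\<in>set K. edge_row (crossing_kind K) K ?x z * ?w z) = over_label K c * ?w (over_of ?x) +
      (if left_to_right ?x then right_label K c * ?w (next_passage K ?x) - ?w ?x
       else right_label K c * ?w ?x - ?w (next_passage K ?x))"
    by (subst sum_edge_row)
      (simp_all only: finite_set under(2,4)[OF c] next_passage_in[OF under(2)[OF c]] over_of_under(1)[OF c] kind kind.case simp_thms if_True)
  then show ?thesis
    unfolding entry nxt labels by (cases "left_to_right ?x"; cases "c = d") (simp_all only: simp_thms if_True if_False, simp_all)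
qed

lemma uncut_over:
  assumes "\<not> cut_passage K x" "crossing_kind K (crossing x) = Skein \<alpha> \<beta>"
  shows "level x \<noteq> Under"
proof -
  have "crossing x \<in> even_crossings K"
    using assms(2) by (auto simp: crossing_kind_def even_crossings_eq split: if_splits)
  then show ?thesis
    using assms(1) by (simp add: cut_passage_iff)
qed

lemma sum_edge_row_uncut:
  assumes x: "x \<in> set K" "\<not> cut_passage K x"
    and w: "w (next_passage K x) = ring_s_pow (if crossing x \<in> type0 K then shift x else 0) * w x"
  shows "(\<Sum>z\<in>set K. edge_row (crossing_kind K) K x z * w z) = 0"
proof -
  note over = uncut_over[OF x(2)]
  have type0: "crossing x \<in> type0 K \<longleftrightarrow> crossing_kind K (crossing x) = Shift"
    by (simp add: crossing_kind_Shift_iff)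
  have *: "(\<Sum>z\<in>set K. edge_row (crossing_kind K) K x z * w z) = (case crossing_kind K (crossing x) of
      Through \<Rightarrow> w (next_passage K x) - w x
    | Shift \<Rightarrow> w (next_passage K x) - ring_s_pow (shift x) * w x
    | Skein \<alpha> \<beta> \<Rightarrow>
        if level x = Under
        then \<beta> * w (over_of x) + (if left_to_right x then \<alpha> * w (next_passage K x) - w x else \<alpha> * w x - w (next_passage K x))
        else w (next_passage K x) - w x)"
    by (rule sum_edge_row) (use x(1) next_passage_in[OF x(1)] over in \<open>simp_all only: finite_set not_False_eq_True\<close>)
  show ?thesis
  proof (cases "crossing_kind K (crossing x)")
    case (Skein \<alpha> \<beta>)
    then show ?thesis
      using over[OF Skein] by (simp add: * w type0)
  qed (simp_all add: * w type0)
qed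

lemma edge_row_uncut:
  assumes x: "x \<in> set K" "\<not> cut_passage K x" and z: "z \<noteq> x"
  shows "edge_row (crossing_kind K) K x z = (if z = next_passage K x then 1 else 0)"
proof -
  obtain k where "edge_row (crossing_kind K) K x = (\<lambda>j. \<delta> (next_passage K x) j - k * \<delta> x j)"
  proof (cases "crossing_kind K (crossing x)")
    case Through
    then show ?thesis
      using that[of 1] by (simp add: edge_row_def passage_row_def)
  next
    case Shift
    then show ?thesis
      using that by (simp add: edge_row_def passage_row_def)
  next
    case (Skein \<alpha> \<beta>)
    then show ?thesis
      using that[of 1] uncut_over[OF x(2) Skein] by (simp add: edge_row_def passage_row_def)
  qed
  then show ?thesis
    using z by (simp add: unit_row_def)
qed

text \<open>If one strand crosses from left to right, the other one crosses from right to left, so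
  the involution \<open>p\<close> pairs opposite terms.\<close>

lemma sum_shift_eq_0: "(\<Sum>x\<in>set K. if crossing x \<in> S then shift x else 0) = 0"
proof -
  define p where "p x = (SOME y. y \<in> set K \<and> y \<noteq> x \<and> crossing y = crossing x)" for x
  have p: "p x \<in> set K" "p x \<noteq> x" "crossing (p x) = crossing x" if x: "x \<in> set K" for x
  proof -
    obtain y where "y \<in> set K" "y \<noteq> x" "crossing y = crossing x"
      using well_formed_partner_exists[OF wf x] .
    then have "\<exists>y. y \<in> set K \<and> y \<noteq> x \<and> crossing y = crossing x"
      by blast
    from someI_ex[OF this] show "p x \<in> set K" "p x \<noteq> x" "crossing (p x) = crossing x"
      unfolding p_def by blast+
  qed
  have pp: "p (p x) = x" if "x \<in> set K" for x
    using well_formed_partner_unique[OF wf p(1)[OF that] p(1)[OF p(1)[OF that]] that] p[OF that] p[OF p(1)[OF that]] by simp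
  have sh: "shift (p x) = - shift x" if "x \<in> set K" for x
    using well_formed_partner(1)[OF wf p(1)[OF that] that p(3)[OF that] p(2)[OF that]] by (auto simp: shift_def)
  let ?f = "\<lambda>x. if crossing x \<in> S then shift x else 0"
  have "(\<Sum>x\<in>set K. ?f x) = (\<Sum>x\<in>set K. ?f (p x))"
    by (rule sum.reindex_bij_witness[of _ p p]) (auto simp: p pp)
  also have "\<dots> = (\<Sum>x\<in>set K. - ?f x)"
    by (intro sum.cong) (auto simp: p sh)
  also have "\<dots> = - (\<Sum>x\<in>set K. ?f x)"
    by (rule sum_negf)
  finally show ?thesis
    by simp
qed

lemma label_exponent_K: "label_exponent K K = 0"
proof -
  have "label_exponent K K = (\<Sum>x\<in>set K. if crossing x \<in> type0 K then shift x else 0)"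
    unfolding label_exponent_def shift_def by (rule sum_list_distinct_conv_sum_set[OF distinct_K])
  then show ?thesis
    using sum_shift_eq_0 by simp
qed

text \<open>The labels collected along the whole curve return to 1, so they form a vector
  annihilated by every row. Its entry at the base point is 1, which allows a column to be replaced
  by a zero column.\<close>

lemma edge_det_uncut:
  assumes "even_crossings K = {}"
  shows "edge_det (crossing_kind K) K = 0"
proof (cases K)
  case (Cons a as)
  let ?w = "weight K"
  have w: "?w (next_passage K x) = ring_s_pow (if crossing x \<in> type0 K then shift x else 0) * ?w x" if x: "x \<in> set K" for x
  proof -
    obtain bs cs where K: "K = bs @ x # cs"
      using split_list[OF x] by blast
    have wx: "?w x = ring_s_pow (label_exponent K bs)"
      using weight_split[of bs x cs] distinct_K K by simp
    have "?w (next_passage K x) = ring_s_pow (label_exponent K (bs @ [x]))"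
    proof (cases cs)
      \<comment> \<open>The passage before the base point: here the total exponent has to be
        0.\<close>
      case Nil
      have "next_passage K x = a"
        using next_passage_split[OF distinct_K K] Nil K Cons by (cases bs) auto
      moreover have "?w a = 1"
        using weight_split[of "[]" a as] distinct_K Cons by (simp add: label_exponent_def)
      ultimately show ?thesis
        using label_exponent_K Nil K by simp
    next
      case (Cons y ds)
      then have "next_passage K x = y"
        using next_passage_split[OF distinct_K K] by simp
      then show ?thesis
        using weight_split[of "bs @ [x]" y ds] distinct_K K Cons by simp
    qed
    then show ?thesis
      unfolding wx label_exponent_snoc by (simp add: ring_s_pow_add mult.commute)
  qed
  have uncut: "\<not> cut_passage K x" for x
    using assms by (simp add: cut_passage_iff)
  let ?rows = "map (edge_row (crossing_kind K) K) K"
  have "edge_det (crossing_kind K) K \<simeq> rdet ?rows (as @ [a])"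
    using edge_det_reorder[OF distinct_K, of K] map_next_passage[OF distinct_K] Cons by simp
  also have "\<dots> = rdet (map (\<lambda>r. case_sum r (\<lambda>d. \<Sum>z\<in>set (as @ [a]). r z * ?w z)) ?rows) (map Inl as @ map Inr [()])"
    using distinct_K Cons weight_split[of "[]" a as]
    by (intro rdet_combine_cols) (auto simp: label_exponent_def)
  also have "\<dots> = 0"
  proof (rule rdet_zero_col[of _ _ "Inr ()"])
    fix r :: "passage + unit \<Rightarrow> knot_ring" assume "r \<in> set (map (\<lambda>r. case_sum r (\<lambda>d. \<Sum>z\<in>set (as @ [a]). r z * ?w z)) ?rows)"
    then obtain x where "x \<in> set K" "r = case_sum (edge_row (crossing_kind K) K x) (\<lambda>d. \<Sum>z\<in>set (as @ [a]). edge_row (crossing_kind K) K x z * ?w z)"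
      by auto
    moreover have "set (as @ [a]) = set K"
      using Cons by auto
    ultimately show "r (Inr ()) = 0"
      using sum_edge_row_uncut[OF _ uncut w] by simp
  qed (use Cons in simp_all)
  finally show ?thesis
    by simp
qed (simp add: edge_det_def)

text \<open>The columns of edges leaving cut underpasses are replaced by arc columns. There the
  uncut rows vanish, while on the remaining columns they form a unitriangular block. What is left,
  underpass rows against arc columns, is \<open>N''\<close>.\<close>

lemma knot_det_eq_edge_det:
  assumes "numbering K cs"
  shows "knot_det K cs \<simeq> edge_det (crossing_kind K) K"
proof (cases "cs = []")
  case True
  then have "even_crossings K = {}"
    using assms by (auto simp: numbering_def types_eq)
  then show ?thesis
    using True by (simp add: knot_det_def edge_det_uncut)
next
  case False
  let ?T = "crossing_kind K"
  have cs: "distinct cs" "set cs = even_crossings K"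
    using assms by (auto simp: numbering_def types_eq)
  then obtain e where e: "e \<in> even_crossings K"
    using False by (cases cs) auto
  \<comment> \<open>Reading the curve from just after a cut underpass ensures that the edge leaving
    an uncut passage always arrives later in the list.\<close>
  obtain ys g rest where R: "rotation e = ys @ g # rest" "last (g # rest) = under e" "distinct (ys @ g # rest)"
    "set (ys @ g # rest) = set K" "\<And>x. x \<in> set K \<Longrightarrow> next_passage (ys @ g # rest) x = next_passage K x"
    by (rule rotation[OF e]) blast
  define r where "r = ys @ g # rest"
  have r: "distinct r" "set r = set K" "last r = under e" "\<And>x. x \<in> set K \<Longrightarrow> next_passage r x = next_passage K x"
    using R by (simp_all add: r_def)
  define ns where "ns = filter (\<lambda>x. \<not> cut_passage K x) r"
  define us where "us = map under cs"
  have ns: "distinct ns" "set ns = {x \<in> set K. \<not> cut_passage K x}"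
    using r by (auto simp: ns_def)
  have "inj_on under (set cs)"
    unfolding cs(2) by (rule inj_on_inverseI[of _ crossing]) (rule under(3))
  then have us_dist: "distinct us"
    using cs(1) by (simp add: us_def distinct_map)
  have us: "set us = {x \<in> set K. cut_passage K x}"
  proof
    show "set us \<subseteq> {x \<in> set K. cut_passage K x}"
      unfolding us_def set_map cs(2) using under(2) cut_under by blast
    show "{x \<in> set K. cut_passage K x} \<subseteq> set us"
    proof
      fix x assume x: "x \<in> {x \<in> set K. cut_passage K x}"
      then have "crossing x \<in> set cs" "under (crossing x) = x"
        using under_unique[of x] unfolding cs(2) by (simp_all add: cut_passage_iff)
      then show "x \<in> set us"
        unfolding us_def set_map by (intro image_eqI[of _ _ "crossing x"]) simp_all
    qed
  qed
  have ps: "distinct (ns @ us)" "set (ns @ us) = set K"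
    using ns us us_dist by auto
  then have mset_ps: "mset (ns @ us) = mset K"
    using set_eq_iff_mset_eq_distinct[OF ps(1) distinct_K] ps(2) by simp
  have "K \<noteq> []"
    using under(2)[OF e] by auto
  let ?row = "edge_row ?T K" and ?nx = "next_passage K"
  let ?W = "\<lambda>z d. weight (arc_passages K d) z"
  let ?F = "\<lambda>r. case_sum r (\<lambda>d. \<Sum>z\<in>set K. r z * ?W z d)"
  define F where "F = ?F"
  define RN RU where "RN = map F (map ?row ns)" and "RU = map F (map ?row us)"
  define CN CU where "CN = (map Inl (map ?nx ns) :: (passage + nat) list)" and "CU = (map Inr cs :: (passage + nat) list)"
  have nx_set: "set (map ?nx (ns @ us)) = set K" and nx_dist: "distinct (map ?nx (ns @ us))"
  proof -
    have "mset (map ?nx (ns @ us)) = mset (map ?nx K)"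
      by (simp only: mset_map mset_ps)
    then have *: "mset (map ?nx (ns @ us)) = mset (rotate1 K)"
      unfolding map_next_passage[OF distinct_K] .
    show "set (map ?nx (ns @ us)) = set K"
      using mset_eq_setD[OF *] by simp
    show "distinct (map ?nx (ns @ us))"
      using mset_eq_imp_distinct_iff[OF *] distinct_K by simp
  qed
  have inj_nx: "?nx x = ?nx y \<longleftrightarrow> x = y" if "x \<in> set K" "y \<in> set K" for x y
  proof -
    have "inj_on ?nx (set K)"
      using nx_dist unfolding distinct_map ps(2) by blast
    then show ?thesis
      using that by (rule inj_on_eq_iff)
  qed
  have reorder: "edge_det ?T K \<simeq> rdet (map ?row (ns @ us)) (map ?nx ns @ map ?nx us)"
    using edge_det_reorder[OF distinct_K \<open>K \<noteq> []\<close> mset_ps, of ?T] unfolding map_append[of ?nx] .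
  have nx_set': "set (map ?nx ns @ map ?nx us) = set K"
    using nx_set unfolding map_append .
  have "rdet (map ?row (ns @ us)) (map ?nx ns @ map ?nx us) = rdet (map (\<lambda>r. case_sum r (\<lambda>d. \<Sum>z\<in>set (map ?nx ns @ map ?nx us). r z * ?W z d)) (map ?row (ns @ us)))
      (map Inl (map ?nx ns) @ map Inr cs)"
  proof (rule rdet_combine_cols)
    fix i j assume "i < length (map ?nx us)" "j < length (map ?nx us)"
    then have ij: "i < length cs" "j < length cs"
      by (simp_all add: us_def)
    have ev: "cs ! i \<in> even_crossings K" "cs ! j \<in> even_crossings K"
      using nth_mem[OF ij(1)] nth_mem[OF ij(2)] unfolding cs(2) .
    have "under (cs ! i) = under (cs ! j) \<longleftrightarrow> i = j"
      using nth_eq_iff_index_eq[OF us_dist, of i j] ij by (simp add: us_def)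
    \<comment> \<open>Of the edges leaving cut underpasses, an arc contains only its own first one,
      with label 1.\<close>
    then show "?W (map ?nx us ! i) (cs ! j) = (if i = j then 1 else 0)"
      using weight_next(2)[OF ev(2) under(2)[OF ev(1)] cut_under[OF ev(1)]] ij by (simp add: us_def)
  qed (use nx_dist in \<open>simp_all add: us_def\<close>)
  then have combine: "rdet (map ?row (ns @ us)) (map ?nx ns @ map ?nx us) = rdet (RN @ RU) (CN @ CU)"
    unfolding nx_set' RN_def RU_def CN_def CU_def F_def map_append .
  have eliminate: "rdet (RN @ RU) (CN @ CU) = rdet RU CU"
  proof -
    have len: "length RN = length CN" "length RU = length CU"
      by (simp_all add: RN_def CN_def RU_def CU_def us_def)
    have nth: "RN ! i = F (?row (ns ! i))" "CN ! i = Inl (?nx (ns ! i))" if "i < length ns" for i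
      using that by (simp_all add: RN_def CN_def)
    have ns_K: "ns ! i \<in> set K" "\<not> cut_passage K (ns ! i)" if "i < length ns" for i
      using nth_mem[OF that] ns(2) by auto
    have order: "\<exists>A B. r = A @ ns ! j # B \<and> ?nx (ns ! j) \<in> set B \<and> (\<forall>i<j. ns ! i \<in> set A)" if j: "j < length ns" for j
    proof -
      let ?x = "ns ! j" and ?f = "filter (\<lambda>x. \<not> cut_passage K x)"
      have "?x \<in> set r"
        using ns_K[OF j] r(2) by simp
      then obtain A B where AB: "r = A @ ?x # B"
        by (meson split_list)
      have "?x \<noteq> last r"
        unfolding r(3) using ns_K(2)[OF j] cut_under[OF e] by auto
      then have "B \<noteq> []"
        unfolding AB by auto
      moreover have "?nx ?x = hd (B @ A @ [?x])"
        using next_passage_split[OF r(1) AB] r(4)[OF ns_K(1)[OF j]] by simp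
      ultimately have nx: "?nx ?x \<in> set B"
        by simp
      have nsAB: "ns = ?f A @ ?x # ?f B"
        using arg_cong[OF AB, of ?f] ns_K(2)[OF j] by (simp only: flip: ns_def) simp
      have "(?f A @ ?x # ?f B) ! length (?f A) = ?x" "length (?f A) < length (?f A @ ?x # ?f B)"
        by simp_all
      then have "ns ! length (?f A) = ns ! j" "length (?f A) < length ns"
        unfolding nsAB[symmetric] by simp_all
      then have jA: "j = length (?f A)"
        using nth_eq_iff_index_eq[OF ns(1) j, of "length (?f A)"] by simp
      have "ns ! i \<in> set A" if "i < j" for i
      proof -
        have "(?f A @ ?x # ?f B) ! i = ?f A ! i" "?f A ! i \<in> set (?f A)"
          using that jA by (simp_all only: nth_append if_True nth_mem)
        then show ?thesis
          unfolding nsAB[symmetric] by simp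
      qed
      then show ?thesis
        using AB nx by blast
    qed
    have diag: "(RN ! i) (CN ! i) = 1" if "i < length CN" for i
    proof -
      have i: "i < length ns"
        using that by (simp add: CN_def)
      have "?nx (ns ! i) \<noteq> ns ! i"
      proof -
        obtain A B where AB: "r = A @ ns ! i # B" "?nx (ns ! i) \<in> set B"
          using order[OF i] by blast
        then have "ns ! i \<notin> set B"
          using r(1) by auto
        then show ?thesis
          using AB(2) by metis
      qed
      then show ?thesis
        using edge_row_uncut[OF ns_K[OF i]] by (simp add: nth[OF i] F_def)
    qed
    \<comment> \<open>The row of \<open>ns ! i\<close> involves only its two edges. The edge leaving
      a later \<open>ns ! j\<close> arrives after \<open>ns ! j\<close>, so it is neither of
      them.\<close>
    have triangular: "(RN ! i) (CN ! j) = 0" if ij: "i < j" "j < length CN" for i j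
    proof -
      have j: "j < length ns" "i < length ns"
        using ij by (simp_all add: CN_def)
      have "?nx (ns ! j) \<noteq> ns ! i"
      proof -
        obtain A B where AB: "r = A @ ns ! j # B" "?nx (ns ! j) \<in> set B" "\<forall>i<j. ns ! i \<in> set A"
          using order[OF j(1)] by blast
        then have "ns ! i \<in> set A" "set A \<inter> set B = {}"
          using ij(1) r(1) by auto
        then have "ns ! i \<notin> set B"
          by (simp add: disjoint_iff)
        then show ?thesis
          using AB(2) by metis
      qed
      moreover have "?nx (ns ! j) \<noteq> ?nx (ns ! i)"
        using inj_nx ns_K(1) j ns(1) ij(1) by (simp add: nth_eq_iff_index_eq)
      ultimately show ?thesis
        using edge_row_uncut[OF ns_K[OF j(2)]] by (simp add: nth(1)[OF j(2)] nth(2)[OF j(1)] F_def)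
    qed
    have zero: "\<forall>q\<in>set RN. \<forall>c\<in>set CU. q c = 0"
    proof (intro ballI)
      fix q :: "passage + nat \<Rightarrow> knot_ring" and c :: "passage + nat"
      assume q: "q \<in> set RN" and c: "c \<in> set CU"
      obtain x where x: "x \<in> set K" "\<not> cut_passage K x" "q = F (?row x)"
        using q ns(2) by (auto simp: RN_def)
      obtain d where d: "d \<in> even_crossings K" "c = Inr d"
        using c cs(2) by (auto simp: CU_def)
      show "q c = 0"
        using sum_edge_row_uncut[OF x(1,2) weight_next(1)[OF d(1) x(1,2)]] x(3) d(2) by (simp add: F_def)
    qed
    show ?thesis
      by (rule rdet_unitriangular[OF len triangular diag zero])
  qed
  have "rdet RU CU = det (knot_matrix K cs)"
  proof -
    have "mat (length CU) (length CU) (\<lambda>(i, j). (RU ! i) (CU ! j)) = knot_matrix K cs" (is "?L = _")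
    proof (rule eq_matI)
      fix i j assume "i < dim_row (knot_matrix K cs)" "j < dim_col (knot_matrix K cs)"
      then have ij: "i < length cs" "j < length cs"
        by (simp_all add: knot_matrix_def)
      have "cs ! i \<in> even_crossings K" "cs ! j \<in> even_crossings K"
        using nth_mem[OF ij(1)] nth_mem[OF ij(2)] unfolding cs(2) .
      note entry = knot_matrix_entry_eq[OF this]
      have "?L $$ (i, j) = (\<Sum>z\<in>set K. ?row (under (cs ! i)) z * ?W z (cs ! j))"
        using ij by (simp add: RU_def CU_def us_def F_def)
      then show "?L $$ (i, j) = knot_matrix K cs $$ (i, j)"
        unfolding entry using ij by (simp add: knot_matrix_def)
    qed (simp_all add: knot_matrix_def CU_def)
    then show ?thesis
      unfolding rdet_def by simp
  qed
  then show ?thesis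
    using reorder False unfolding combine eliminate by (simp add: knot_det_def eq_sign_sym)
qed

end

section \<open>Equivalent diagrams\<close>

lift_definition ring_monomial :: "int \<Rightarrow> int \<Rightarrow> knot_ring" is "\<lambda>i j. Poly_Mapping.single (i, 0, j, 0) 1" .

lemma ring_monomial_add: "ring_monomial (i + i') (j + j') = ring_monomial i j * ring_monomial i' j'"
  by transfer (simp add: mult_single knot_rel_refl)

lemma ring_monomial_0: "ring_monomial 0 0 = 1"
proof transfer
  have "(Poly_Mapping.single (0, 0, 0, 0) 1 :: laurent) = 1"
    unfolding single_one[symmetric] by (simp add: zero_prod_def)
  then show "knot_rel (Poly_Mapping.single (0, 0, 0, 0) 1) 1"
    by (simp add: knot_rel_refl)
qed

lemma ring_monomial_1: "ring_monomial 1 0 = ring_t" "ring_monomial 0 1 = ring_p"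
  by (transfer; simp add: laurent_t_def laurent_p_def knot_rel_refl)+

lemma ring_monomial_power: "ring_monomial i j ^ n = ring_monomial (int n * i) (int n * j)"
  by (induction n) (simp_all add: ring_monomial_0 ring_monomial_add distrib_right flip: ring_monomial_add)

lemma is_int_power_ring_t: "is_int_power ring_t i (ring_monomial i 0)"
proof (cases "0 \<le> i")
  case True
  then show ?thesis
    by (simp add: is_int_power_def ring_monomial_power flip: ring_monomial_1(1))
next
  case False
  then have "ring_monomial i 0 * ring_t ^ nat (- i) = ring_monomial (i + int (nat (- i))) 0"
    unfolding ring_monomial_1(1)[symmetric] ring_monomial_power by (simp flip: ring_monomial_add)
  then show ?thesis
    using False by (simp add: is_int_power_def ring_monomial_0)
qed

lemma is_int_power_ring_p: "is_int_power ring_p j (ring_monomial 0 j)"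
proof (cases "0 \<le> j")
  case True
  then show ?thesis
    by (simp add: is_int_power_def ring_monomial_power flip: ring_monomial_1(2))
next
  case False
  then have "ring_monomial 0 j * ring_p ^ nat (- j) = ring_monomial 0 (j + int (nat (- j)))"
    unfolding ring_monomial_1(2)[symmetric] ring_monomial_power by (simp flip: ring_monomial_add)
  then show ?thesis
    using False by (simp add: is_int_power_def ring_monomial_0)
qed

definition associated :: "knot_ring \<Rightarrow> knot_ring \<Rightarrow> bool" where
  "associated x y \<longleftrightarrow> (\<exists>i j. x \<simeq> y * ring_monomial i j)"

lemma eq_sign_imp_associated: "x \<simeq> y \<Longrightarrow> associated x y"
  unfolding associated_def by (intro exI[of _ 0]) (simp add: ring_monomial_0)

lemma associated_trans: "associated x y \<Longrightarrow> associated y z \<Longrightarrow> associated x z"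
  unfolding associated_def
proof (elim exE)
  fix i j i' j' assume "x \<simeq> y * ring_monomial i j" "y \<simeq> z * ring_monomial i' j'"
  then have "x \<simeq> z * ring_monomial i' j' * ring_monomial i j"
    by (auto simp: eq_sign_def)
  then have "x \<simeq> z * ring_monomial (i' + i) (j' + j)"
    by (simp add: ring_monomial_add mult.assoc)
  then show "\<exists>i j. x \<simeq> z * ring_monomial i j"
    by blast
qed

lemma associated_sym: "associated x y \<Longrightarrow> associated y x"
  unfolding associated_def
proof (elim exE)
  fix i j assume "x \<simeq> y * ring_monomial i j"
  then have "y * (ring_monomial i j * ring_monomial (- i) (- j)) \<simeq> x * ring_monomial (- i) (- j)"
    by (auto simp: eq_sign_def mult.assoc)
  then have "y \<simeq> x * ring_monomial (- i) (- j)"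
    by (simp add: ring_monomial_0 flip: ring_monomial_add)
  then show "\<exists>i j. y \<simeq> x * ring_monomial i j"
    by blast
qed

lemma associated_unit:
  assumes "\<exists>k\<in>{1, ring_t, ring_p}. x \<simeq> k * y"
  shows "associated x y"
proof -
  have "x \<simeq> y * ring_monomial 0 0 \<or> x \<simeq> y * ring_monomial 1 0 \<or> x \<simeq> y * ring_monomial 0 1"
    using assms unfolding ring_monomial_0 ring_monomial_1 by (auto simp: mult.commute)
  then show ?thesis
    unfolding associated_def by blast
qed

lemma edge_det_rotate1: "edge_det T (rotate1 K) \<simeq> edge_det T K"
  using edge_det_rotate[of T _ "[_]"] by (cases K) auto

text \<open>A crossing on the branch \<open>a\<close> is virtual at both passages, so erasing it
  loses no classical passage. Both diagrams thus have the same sequence of classical passages, which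
  determines the kinds and, by \<open>edge_det_filter\<close>, the determinant up to sign.\<close>

lemma edge_det_detour:
  assumes wf: "well_formed (a @ b)" "well_formed (a' @ b')"
    and virtual: "\<forall>x\<in>set a. level x = Virtual" "\<forall>x\<in>set a'. level x = Virtual"
    and eq: "filter (\<lambda>x. crossing x \<notin> crossings a) b = filter (\<lambda>x. crossing x \<notin> crossings a') b'"
  shows "edge_det (crossing_kind (a @ b)) (a @ b) \<simeq> edge_det (crossing_kind (a' @ b')) (a' @ b')"
proof -
  have classical: "filter (\<lambda>x. level x \<noteq> Virtual) (a @ b) =
      filter (\<lambda>x. level x \<noteq> Virtual) (filter (\<lambda>x. crossing x \<notin> crossings a) b)"
    if wf: "well_formed (a @ b)" and virtual: "\<forall>x\<in>set a. level x = Virtual" for a b :: diagram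
  proof -
    have "level x = Virtual" if x: "x \<in> set b" "crossing x \<in> crossings a" for x
    proof -
      obtain y where y: "y \<in> set a" "crossing y = crossing x"
        using x(2) by (metis imageE)
      then have "crossing y \<notin> classical_crossings (a @ b)"
        using classical_iff[OF wf, of y] virtual by simp
      then show ?thesis
        using classical_iff[OF wf, of x] x(1) y(2) by simp
    qed
    then have "filter (\<lambda>x. level x \<noteq> Virtual) b = filter (\<lambda>x. level x \<noteq> Virtual \<and> crossing x \<notin> crossings a) b"
      by (intro filter_cong) auto
    moreover have "filter (\<lambda>x. level x \<noteq> Virtual) a = []"
      using virtual by (simp add: filter_empty_conv)
    ultimately show ?thesis
      by (simp add: conj_commute)
  qed
  have eq': "filter (\<lambda>x. level x \<noteq> Virtual) (a @ b) = filter (\<lambda>x. level x \<noteq> Virtual) (a' @ b')"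
    unfolding classical[OF wf(1) virtual(1)] classical[OF wf(2) virtual(2)] eq ..
  have kind: "crossing_kind (a @ b) = crossing_kind (a' @ b')"
    by (rule crossing_kind_filter_eq[OF wf eq'])
  have reduce: "edge_det (crossing_kind K) K \<simeq> edge_det (crossing_kind K) (filter (\<lambda>x. level x \<noteq> Virtual) K)"
    if wf: "well_formed K" for K
  proof -
    have "crossing_kind K (crossing x) \<noteq> Through \<longleftrightarrow> level x \<noteq> Virtual" if "x \<in> set K" for x
      using classical_iff[OF wf that] by (simp add: crossing_kind_def)
    then have "filter (\<lambda>x. crossing_kind K (crossing x) \<noteq> Through) K = filter (\<lambda>x. level x \<noteq> Virtual) K"
      by (intro filter_cong) simp_all
    then show ?thesis
      using edge_det_filter[OF well_formed_distinct[OF wf], of "crossing_kind K"] by simp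
  qed
  show ?thesis
    using eq_sign_trans[OF reduce[OF wf(1), unfolded kind eq'] eq_sign_sym[OF reduce[OF wf(2)]]] unfolding kind .
qed

lemma associated_move:
  assumes "diagram_move K K'" "well_formed K" "well_formed K'"
  shows "associated (edge_det (crossing_kind K) K) (edge_det (crossing_kind K') K')"
  using assms
proof (induction rule: diagram_move.induct)
  case (base_point K)
  show ?case
    unfolding crossing_kind_rotate1[OF base_point]
    by (rule eq_sign_imp_associated[OF eq_sign_sym[OF edge_det_rotate1]])
next
  case (renaming f K)
  let ?K = "map (rename_passage f) K"
  have "edge_det (crossing_kind ?K) ?K = edge_det (crossing_kind ?K \<circ> f) K"
    by (rule edge_det_rename[OF renaming(1)])
  also have "\<dots> = edge_det (crossing_kind K) K"
    by (rule edge_det_cong) (simp add: crossing_kind_rename[OF renaming(1)])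
  finally show ?case
    by (simp only: eq_sign_imp_associated[OF eq_sign_refl])
next
  case (reidemeister1 x y u)
  have wf: "well_formed (x # y # u)"
    using reidemeister1(4) by (simp only: append_Cons append_Nil)
  have "\<exists>k\<in>{1, ring_t, ring_p}. edge_det (crossing_kind (x # y # u)) (x # y # u) \<simeq> k * edge_det (crossing_kind u) u"
    using edge_det_reidemeister1[OF wf reidemeister1(5,1,2,3)] by (rule bexE) (rule bexI, assumption, blast)
  then show ?case
    unfolding append_Cons append_Nil by (rule associated_unit)
next
  case (reidemeister2 x1 x2 y1 y2 u v)
  have wf: "well_formed (x1 # x2 # u @ y1 # y2 # v)"
    using reidemeister2(7) by (simp only: append_Cons append_Nil)
  show ?case
    unfolding append_Cons append_Nil
    by (rule associated_unit[OF edge_det_reidemeister2[OF wf reidemeister2(8,1-6)]])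
next
  case (reidemeister3 K x1 x2 u y1 y2 v z1 z2 w b1 b2 b3)
  let ?K' = "[x2, x1] @ u @ [y2, y1] @ v @ [z2, z1] @ w"
  obtain \<kappa> b1 b2 b3 where "triangle \<kappa> x1 x2 b1 y1 y2 b2 z1 z2 b3"
    by (rule reidemeister3_triangle[OF reidemeister3(6,1,5)])
  then interpret reidemeister3_setup K ?K' u v w x1 x2 y1 y2 z1 z2 \<kappa> b1 b2 b3
    by (rule reidemeister3_setup.intro[rotated 4, OF _ reidemeister3(2,3,4)])
      (use reidemeister3(1,6,7) in \<open>simp_all only: append_Cons append_Nil\<close>)
  show ?case
    by (rule eq_sign_imp_associated[OF edge_det_eq])
next
  case (detour a a' b b')
  show ?case
    by (rule eq_sign_imp_associated[OF edge_det_detour[OF detour(4,5,1,2,3)]])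
qed

theorem theorem4:
  fixes K K' :: diagram and cs cs' :: "nat list"
  assumes "virtual_diagram K" and "virtual_diagram K'"
    and "numbering K cs" and "numbering K' cs'"
    and "equivalent_diagrams K K'"
  shows "\<exists>(\<alpha>::int) (\<beta>::int) (\<gamma>::int) a b c.
           is_int_power ring_t \<alpha> a \<and> is_int_power ring_p \<beta> b \<and> is_int_power ring_q \<gamma> c \<and>
           (knot_det K cs = knot_det K' cs' * a * b * c \<or>
            knot_det K cs = - (knot_det K' cs' * a * b * c))"
proof -
  have moves: "associated (edge_det (crossing_kind K) K) (edge_det (crossing_kind K') K')"
    using assms(5) unfolding equivalent_diagrams_def
  proof (induction rule: equivclp_induct)
    case base
    show ?case
      by (simp add: eq_sign_imp_associated)
  next
    case (step L M)
    then have "associated (edge_det (crossing_kind L) L) (edge_det (crossing_kind M) M)"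
      unfolding virtual_diagram_def
      by (elim disjE conjE) (rule associated_move associated_sym[OF associated_move], assumption+)+
    with step.IH show ?case
      by (rule associated_trans)
  qed
  have ends: "associated (knot_det K cs) (edge_det (crossing_kind K) K)"
      "associated (edge_det (crossing_kind K') K') (knot_det K' cs')"
  proof -
    have "wf_diagram K" "wf_diagram K'"
      using assms(1,2) by (simp_all add: wf_diagram_def virtual_diagram_def)
    note knot_det = this[THEN wf_diagram.knot_det_eq_edge_det]
    show "associated (knot_det K cs) (edge_det (crossing_kind K) K)"
      by (rule eq_sign_imp_associated[OF knot_det(1)[OF assms(3)]])
    show "associated (edge_det (crossing_kind K') K') (knot_det K' cs')"
      by (rule eq_sign_imp_associated[OF eq_sign_sym[OF knot_det(2)[OF assms(4)]]])
  qed
  have "associated (knot_det K cs) (knot_det K' cs')"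
    by (rule associated_trans[OF associated_trans[OF ends(1) moves] ends(2)])
  then obtain i j where ij: "knot_det K cs \<simeq> knot_det K' cs' * ring_monomial i j"
    unfolding associated_def by blast
  have split: "ring_monomial i j = ring_monomial i 0 * ring_monomial 0 j"
    using ring_monomial_add[of i 0 0 j] by simp
  have "knot_det K cs = knot_det K' cs' * ring_monomial i 0 * ring_monomial 0 j * 1 \<or>
      knot_det K cs = - (knot_det K' cs' * ring_monomial i 0 * ring_monomial 0 j * 1)"
    using ij unfolding eq_sign_def split mult.assoc mult_1_right .
  \<comment> \<open>The exponent of \<open>q\<close> is always 0, since no move contributes a factor
    \<open>q\<close>.\<close>
  moreover have "is_int_power ring_q 0 1"
    by (simp add: is_int_power_def)
  ultimately have main: "is_int_power ring_t i (ring_monomial i 0) \<and> is_int_power ring_p j (ring_monomial 0 j) \<and>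
      is_int_power ring_q 0 1 \<and> (knot_det K cs = knot_det K' cs' * ring_monomial i 0 * ring_monomial 0 j * 1 \<or>
      knot_det K cs = - (knot_det K' cs' * ring_monomial i 0 * ring_monomial 0 j * 1))"
    using is_int_power_ring_t is_int_power_ring_p by simp
  show ?thesis
    by (rule exI[of _ i], rule exI[of _ j], rule exI[of _ 0], rule exI[of _ "ring_monomial i 0"],
        rule exI[of _ "ring_monomial 0 j"], rule exI[of _ 1], rule main)
qed

end
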